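(* Let $f(u)=u^2/2$, $\bar u_l>\bar u_r$, and $w_0\in L^\infty(\mathbb{R})$ $p$-periodic with zero average. Let $T_S$ and the shock curve $X(t)$, $t>T_S$, be as in the shock stability theorem: i.e. the entropy solution $u$ with data $\bar u_l+w_0$ for $x<0$ and $\bar u_r+w_0$ for $x>0$ equals $u_l$ for $x<X(t)$ and $u_r$ for $x>X(t)$ when $t>T_S$, where $u_l,u_r$ are the entropy solutions with data $\bar u_l+w_0$, $\bar u_r+w_0$ on $\mathbb{R}$. Let $s=(\bar u_l+\bar u_r)/2$. Then whenever $t>T_S$ and $(\bar u_l-\bar u_r)t/p$ is an integer, $X(t)=st$.
   Context: Entropy solutions of Burgers' equation $u_t+(u^2/2)_x=0$ with $L^\infty$ data. $T_S>0$ is a time (depending on $p,\bar u_l,\bar u_r$) after which the perturbed solution consists of $u_l$ and $u_r$ separated by a single Lipschitz shock curve $X(t)$. *)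

theory Defs
  imports "HOL-Analysis.Analysis"
begin

definition burgers_flux :: "real \<Rightarrow> real" where
  "burgers_flux v = v^2 / 2"

definition test_fun :: "(real \<Rightarrow> real \<Rightarrow> real) \<Rightarrow> (real \<Rightarrow> real \<Rightarrow> real) \<Rightarrow> (real \<Rightarrow> real \<Rightarrow> real) \<Rightarrow> bool" where
  "test_fun phi phit phix \<longleftrightarrow>
     (\<forall>z. ((\<lambda>w. phi (fst w) (snd w)) has_derivative
            (\<lambda>h. phit (fst z) (snd z) * fst h + phix (fst z) (snd z) * snd h)) (at z)) \<and>
     continuous_on UNIV (\<lambda>w. phit (fst w) (snd w)) \<and>
     continuous_on UNIV (\<lambda>w. phix (fst w) (snd w)) \<and>
     (\<exists>R. \<forall>t x. R < \<bar>t\<bar> \<or> R < \<bar>x\<bar> \<longrightarrow> phi t x = 0)"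

text \<open>Kruzhkov entropy solution of u_t + (u^2/2)_x = 0 on t > 0 with L-infinity data u0
  (u t x is the value at time t, position x), in the standard weak form
  including the initial datum.\<close>
definition entropy_solution :: "(real \<Rightarrow> real \<Rightarrow> real) \<Rightarrow> (real \<Rightarrow> real) \<Rightarrow> bool" where
  "entropy_solution u u0 \<longleftrightarrow>
     (\<lambda>z. u (fst z) (snd z)) \<in> borel_measurable lborel \<and>
     (\<exists>M. AE z in lborel. 0 < fst z \<longrightarrow> \<bar>u (fst z) (snd z)\<bar> \<le> M) \<and>
     (\<forall>k phi phit phix. test_fun phi phit phix \<and> (\<forall>t x. 0 \<le> phi t x) \<longrightarrow>
        0 \<le> (LINT z : {z. 0 < fst z} | lborel.
                 \<bar>u (fst z) (snd z) - k\<bar> * phit (fst z) (snd z)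
               + sgn (u (fst z) (snd z) - k) * (burgers_flux (u (fst z) (snd z)) - burgers_flux k)
                   * phix (fst z) (snd z))
           + (LINT x | lborel. \<bar>u0 x - k\<bar> * phi 0 x))"

end

theory Submission
  imports Defs
begin

text \<open>
  Extend a solution to negative times by its initial datum, so that Kruzhkov's inequality becomes an
  inequality on the whole plane whose spatial flux is switched off for \<open>t \<le> 0\<close>. Doubling of variables,
  with a mollifier that is much thinner in time than in space so that the jump of the flux at \<open>t = 0\<close>
  is negligible, gives Kato's inequality for two solutions, hence uniqueness and finite speed of
  propagation.

  Uniqueness and Galilean invariance give
  \<open>ul(s, x) = ur(s, x - (ubl - ubr)(s - t)) + (ubl - ubr)\<close>, because \<open>(ubl - ubr) t\<close> is a multiple of the
  period; in particular \<open>ul - ur\<close> is the constant \<open>ubl - ubr\<close> at time \<open>t\<close>. Thus the mass of \<open>u - ul\<close> to the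
  left of a distant, periodically averaged cut-off is an affine function of \<open>X(t)\<close> at time \<open>t\<close>, and
  it changes only by the flux through the cut-off, whose mean over a period is
  \<open>(ubl\<^sup>2 - ubr\<^sup>2)/2\<close> per unit time. Continuity of \<open>X\<close> replaces the value at time \<open>t\<close> by an
  average over nearby times, which is all that is meaningful for a weak solution.
\<close>

section \<open>Lebesgue measure on the plane\<close>

text \<open>Write d for ubl - ubr. Integrality of d t / p makes mass detect the shock: as ul and ur
  differ by a constant at time t, the mass of u - ul depends on X(t) alone and not on the unknown
  profile. The flux is the other obstacle. The mean of ur squared over a period may decay and is not
  known; but ul is a translate of ur plus d, so in the mean of (ul^2 - ur^2)/2 the quadratic means
  cancel, and d times the mean of ur plus d^2/2 remains. The mean of ur keeps its initial value ubr
  because \<open>w0\<close> has average zero. At the left end of the cut-off u and ul coincide and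
  nothing flows. The balance d X(t) = (d ubr + d^2/2) t gives the speed. A cut-off averaged over
  exactly one period makes these means exact, so no far-field limit is taken. Kato's inequality is
  proved by contradiction at one small scale e, with extent e^2 in time and e in space: the term
  from the jump of the flux then has relative size e^2 times 1/e.\<close>

lemma borel_measurable_fst_snd [measurable (raw)]:
  fixes f :: "'c \<Rightarrow> 'a::euclidean_space \<times> 'b::euclidean_space"
  assumes "f \<in> M \<rightarrow>\<^sub>M borel"
  shows "(\<lambda>x. fst (f x)) \<in> M \<rightarrow>\<^sub>M borel" "(\<lambda>x. snd (f x)) \<in> M \<rightarrow>\<^sub>M borel"
  by (intro measurable_compose[OF assms] borel_measurable_continuous_onI continuous_intros)+

lemma cball_borel [measurable]: "cball (x::'a::euclidean_space) r \<in> sets borel"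
  by (rule borel_closed) simp

lemma integrable_bounded_support:
  fixes f :: "'a::euclidean_space \<Rightarrow> real"
  assumes f: "f \<in> borel_measurable borel" and C: "\<And>x. \<bar>f x\<bar> \<le> C"
    and S: "bounded S" and 0: "\<And>x. x \<notin> S \<Longrightarrow> f x = 0"
  shows "integrable lborel f"
proof -
  obtain r where r: "S \<subseteq> cball 0 r"
    using bounded_subset_ballD[OF S, of 0] ball_subset_cball by blast
  show ?thesis
  proof (rule Bochner_Integration.integrable_bound)
    show "integrable lborel (\<lambda>x::'a. C * indicator (cball 0 r) x :: real)"
      by (intro integrable_mult_right integrable_real_indicator) (simp_all only: emeasure_lborel_cball_finite sets_lborel borel_closed closed_cball)
    show "AE x in lborel. norm (f x) \<le> norm (C * indicator (cball 0 r) x :: real)"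
    proof (rule AE_I2)
      fix x show "norm (f x) \<le> norm (C * indicator (cball 0 r) x :: real)"
        using C[of x] 0[of x] r by (cases "x \<in> cball 0 r") (auto simp del: mem_cball mem_cball_0)
    qed
  qed (use f in simp)
qed

lemma continuous_support_bounded:
  fixes f :: "'a::euclidean_space \<Rightarrow> real"
  assumes f: "continuous_on UNIV f" and S: "bounded S" and 0: "\<And>x. x \<notin> S \<Longrightarrow> f x = 0"
  obtains C where "\<And>x. \<bar>f x\<bar> \<le> C"
proof -
  obtain r where r: "S \<subseteq> cball 0 r"
    using bounded_subset_ballD[OF S, of 0] ball_subset_cball by blast
  have "compact (f ` cball 0 r)"
    using f by (intro compact_continuous_image) (auto intro: continuous_on_subset)
  then obtain C where C: "\<forall>y\<in>f ` cball 0 r. norm y \<le> C"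
    using compact_imp_bounded bounded_iff by metis
  have "\<bar>f x\<bar> \<le> max 0 C" for x
    using C 0[of x] r by (cases "x \<in> cball 0 r") fastforce+
  then show thesis by (rule that)
qed

lemma lborel_integral_translate:
  fixes f :: "'a::euclidean_space \<Rightarrow> real"
  assumes "f \<in> borel_measurable borel"
  shows "(LINT x|lborel. f (x + c)) = (LINT x|lborel. f x)"
proof -
  have "(LINT x|lborel. f x) = (LINT x|distr lborel borel ((+) c). f x)"
    by (simp add: lborel_distr_plus)
  also have "\<dots> = (LINT x|lborel. f (c + x))"
    using assms by (subst integral_distr) auto
  finally show ?thesis by (simp add: add.commute)
qed

text \<open>Density of continuous functions: on a slightly larger ball \<open>V\<close> is L1-close
  to some continuous \<open>h n\<close>, which is uniformly continuous there. The translation error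
  is at most two approximation errors plus the modulus of \<open>h n\<close>, a third of
  \<open>e\<close> each.\<close>

lemma L1_translation_continuous:
  fixes V :: "'a::euclidean_space \<Rightarrow> real"
  assumes V: "V \<in> borel_measurable borel" and M: "\<And>x. \<bar>V x\<bar> \<le> M" and e: "e > 0"
  shows "\<exists>d>0. \<forall>w. norm w < d \<longrightarrow>
           (LINT x|lborel. indicator (cball 0 r) x * \<bar>V (x + w) - V x\<bar>) \<le> e"
proof -
  have "V \<in> borel_measurable lebesgue"
    using V by (simp add: measurable_completion)
  then have "V measurable_on UNIV"
    by (simp add: lebesgue_measurable_imp_measurable_on_real)
  then obtain N g where N: "negligible N" and g: "\<And>n. continuous_on UNIV (g n)"
    and lim: "\<And>x. x \<notin> N \<Longrightarrow> (\<lambda>n. g n x) \<longlonglongrightarrow> V x"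
    unfolding measurable_on_def by auto
  \<comment> \<open>Truncation at the bound of \<open>V\<close> does not disturb the limit and gives
    dominated convergence a constant majorant.\<close>
  define h where "h n x = max (-M) (min M (g n x))" for n x
  have h: "continuous_on UNIV (h n)" for n
    unfolding h_def by (intro continuous_intros g)
  have hM: "\<bar>h n x\<bar> \<le> M" for n x
    using M[of x] by (auto simp: h_def)
  have hlim: "(\<lambda>n. h n x) \<longlonglongrightarrow> V x" if "x \<notin> N" for x
  proof -
    have "(\<lambda>n. h n x) \<longlonglongrightarrow> max (-M) (min M (V x))"
      unfolding h_def by (intro tendsto_intros lim that)
    then show ?thesis using M[of x] by (simp add: abs_le_iff min_def max_def split: if_splits)
  qed
  have hm[measurable]: "h n \<in> borel_measurable borel" for n
    by (rule borel_measurable_continuous_onI[OF h])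
  note V[measurable]
  let ?B = "cball (0::'a) (r + 1)" and ?b = "cball (0::'a) r"
  have intg: "integrable lborel (\<lambda>x. indicator (cball 0 s) x * \<bar>f x\<bar> :: real)"
    if [measurable]: "f \<in> borel_measurable borel" and f: "\<And>x. \<bar>f x\<bar> \<le> 2 * M" for s and f :: "'a \<Rightarrow> real"
  proof (rule integrable_bounded_support[where S = "cball 0 s" and C = "2*M"])
    show "\<bar>indicator (cball 0 s) x * \<bar>f x\<bar>\<bar> \<le> 2 * M" for x
      using f[of x] by (auto split: split_indicator)
    show "(\<lambda>x. indicator (cball 0 s) x * \<bar>f x\<bar> :: real) \<in> borel_measurable borel"
      using that(1) by (intro borel_measurable_times borel_measurable_indicator borel_measurable_abs) auto
  qed auto
  have M0: "0 \<le> M" using M[of 0] by linarith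
  have AEN: "AE x in lborel. x \<notin> N"
  proof -
    have "AE x in lebesgue. x \<notin> N"
      using N by (intro AE_not_in) (simp add: negligible_iff_null_sets)
    then show ?thesis by (simp add: AE_completion_iff)
  qed
  have "(\<lambda>n. LINT x|lborel. indicator ?B x * \<bar>h n x - V x\<bar>) \<longlonglongrightarrow> (LINT x|(lborel::'a measure). 0)"
  proof (rule integral_dominated_convergence[where w = "\<lambda>x. indicator ?B x * \<bar>2 * M\<bar>"])
    show "integrable lborel (\<lambda>x. indicator ?B x * \<bar>2 * M\<bar>)"
      by (rule intg) (use M in \<open>auto intro: order_trans[OF abs_ge_zero]\<close>)
    show "AE x in lborel. (\<lambda>n. indicator ?B x * \<bar>h n x - V x\<bar>) \<longlonglongrightarrow> 0"
      using AEN
    proof (rule eventually_mono)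
      fix x assume "x \<notin> N"
      from tendsto_mult[OF tendsto_const tendsto_rabs[OF tendsto_diff[OF hlim[OF this] tendsto_const]],
            of "indicator ?B x" "V x"]
      show "(\<lambda>n. indicator ?B x * \<bar>h n x - V x\<bar>) \<longlonglongrightarrow> 0" by simp
    qed
    show "AE x in lborel. norm (indicator ?B x * \<bar>h n x - V x\<bar>) \<le> indicator ?B x * \<bar>2 * M\<bar>" for n
    proof (rule AE_I2)
      fix x
      have "\<bar>h n x - V x\<bar> \<le> \<bar>2 * M\<bar>" using hM[of n x] M[of x] by linarith
      then show "norm (indicator ?B x * \<bar>h n x - V x\<bar>) \<le> indicator ?B x * \<bar>2 * M\<bar>"
        by (simp split: split_indicator)
    qed
  qed (auto, measurable)
  then have "eventually (\<lambda>n. (LINT x|lborel. indicator ?B x * \<bar>h n x - V x\<bar>) < e/3) sequentially"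
    using e by (intro order_tendstoD(2)[where y = 0]) auto
  then obtain n where n: "(LINT x|lborel. indicator ?B x * \<bar>h n x - V x\<bar>) < e/3"
    by (auto simp: eventually_sequentially)
  define m where "m = measure lborel ?b"
  have m: "m \<ge> 0" by (simp add: m_def)
  have "uniformly_continuous_on ?B (h n)"
    by (rule compact_uniformly_continuous) (use h[of n] in \<open>auto intro: continuous_on_subset\<close>)
  moreover have "e / (3 * (m + 1)) > 0" using e m by simp
  ultimately obtain d0 where d0: "d0 > 0"
    "\<And>x y. x \<in> ?B \<Longrightarrow> y \<in> ?B \<Longrightarrow> dist y x < d0 \<Longrightarrow> dist (h n y) (h n x) < e / (3 * (m + 1))"
    unfolding uniformly_continuous_on_def by blast
  \<comment> \<open>The cap 1 keeps \<open>x + w\<close> in the ball of radius \<open>r + 1\<close>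
    whenever \<open>x\<close> is in the ball of radius \<open>r\<close>.\<close>
  define d where "d = min d0 1"
  show ?thesis
  proof (intro exI[of _ d] conjI allI impI)
    show "d > 0" using d0 by (simp add: d_def)
    fix w :: 'a assume w: "norm w < d"
    have sub: "x + w \<in> ?B" if "x \<in> ?b" for x
      using that w norm_triangle_ineq[of x w] by (auto simp: d_def)
    let ?I1 = "\<lambda>x. indicator ?B (x + w) * \<bar>h n (x + w) - V (x + w)\<bar>"
    let ?I2 = "\<lambda>x. indicator ?b x * \<bar>e / (3 * (m + 1))\<bar>"
    let ?I3 = "\<lambda>x. indicator ?B x * \<bar>h n x - V x\<bar>"
    have le2: "\<bar>h n x - V y\<bar> \<le> 2 * M" for x y
      using hM[of n x] M[of y] by linarith
    have i3: "integrable lborel ?I3"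
      by (rule intg) (auto simp: le2)
    have i1: "integrable lborel ?I1"
      by (rule integrable_bounded_support[where S = "(\<lambda>x. x - w) ` ?B" and C = "2*M"])
         (auto simp: le2 M0 split: split_indicator
            intro!: bounded_translation_minus image_eqI[where x = "_ + w"])
    have i2: "integrable lborel ?I2"
      by (intro integrable_mult_left integrable_real_indicator) (simp_all only: emeasure_lborel_cball_finite sets_lborel borel_closed closed_cball)
    have "(LINT x|lborel. indicator ?b x * \<bar>V (x + w) - V x\<bar>)
       \<le> (LINT x|lborel. ?I1 x + ?I2 x + ?I3 x)"
    proof (rule integral_mono)
      show "integrable lborel (\<lambda>x. indicator ?b x * \<bar>V (x + w) - V x\<bar>)"
      proof (rule intg)
        fix x show "\<bar>V (x + w) - V x\<bar> \<le> 2 * M" using M[of x] M[of "x+w"] by linarith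
      qed measurable
      show "integrable lborel (\<lambda>x. ?I1 x + ?I2 x + ?I3 x)"
        by (intro Bochner_Integration.integrable_add i1 i2 i3)
      fix x
      show "indicator ?b x * \<bar>V (x + w) - V x\<bar> \<le> ?I1 x + ?I2 x + ?I3 x"
      proof (cases "x \<in> ?b")
        case True
        then have xB: "x \<in> ?B" by auto
        have "dist (h n (x + w)) (h n x) < e / (3 * (m + 1))"
          by (rule d0(2)[OF xB sub[OF True]]) (use w in \<open>simp add: dist_norm d_def\<close>)
        then have "\<bar>h n (x + w) - h n x\<bar> \<le> \<bar>e / (3 * (m + 1))\<bar>"
          unfolding dist_real_def by linarith
        then have "\<bar>V (x + w) - V x\<bar> \<le> \<bar>h n (x + w) - V (x + w)\<bar> + \<bar>e / (3 * (m + 1))\<bar> + \<bar>h n x - V x\<bar>"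
          by linarith
        then show ?thesis using True xB sub[OF True] by (simp only: indicator_simps mult_1)
      qed (auto intro!: add_nonneg_nonneg)
    qed
    also have "\<dots> = (LINT x|lborel. ?I1 x) + (LINT x|lborel. ?I2 x) + (LINT x|lborel. ?I3 x)"
      using i1 i2 i3 by simp
    also have "(LINT x|lborel. ?I1 x) = (LINT x|lborel. ?I3 x)"
      by (rule lborel_integral_translate) measurable
    also have "(LINT x|lborel. ?I2 x) = m * \<bar>e / (3 * (m + 1))\<bar>"
      by (simp add: m_def)
    also have "m * \<bar>e / (3 * (m + 1))\<bar> \<le> e / 3"
      using e m by (simp add: field_simps)
    finally show "(LINT x|lborel. indicator ?b x * \<bar>V (x + w) - V x\<bar>) \<le> e"
      using n by linarith
  qed
qed

section \<open>Shears of the plane, null sets and slices\<close>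

lemma measurable_shear [measurable]:
  fixes g :: "real \<Rightarrow> real"
  assumes [measurable]: "g \<in> borel_measurable borel"
  shows "(\<lambda>z. (fst z, snd z + g (fst z))) \<in> borel \<rightarrow>\<^sub>M borel"
  by (intro borel_measurable_Pair) measurable

text \<open>By Fubini: a shear translates each line of constant first coordinate, by an amount
  depending on that coordinate. It carries the Galilean boosts and the spatial shifts used
  below.\<close>

lemma lborel_shear:
  fixes g :: "real \<Rightarrow> real"
  assumes g[measurable]: "g \<in> borel_measurable borel"
  shows "distr lborel borel (\<lambda>z. (fst z, snd z + g (fst z))) = lborel"
proof (rule measure_eqI)
  let ?T = "\<lambda>z::real \<times> real. (fst z, snd z + g (fst z))"
  fix A assume "A \<in> sets (distr lborel borel ?T)"
  then have A[measurable]: "A \<in> sets borel" by simp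
  then have A': "A \<in> sets (lborel \<Otimes>\<^sub>M lborel :: (real \<times> real) measure)" by (simp only: lborel_prod sets_lborel)
  have Tm: "?T -` A \<in> sets borel"
    by (rule measurable_sets_borel[OF measurable_shear[OF g] A])
  then have Tm': "?T -` A \<in> sets (lborel \<Otimes>\<^sub>M lborel :: (real \<times> real) measure)" by (simp only: lborel_prod sets_lborel)
  have "emeasure (distr lborel borel ?T) A = emeasure (lborel \<Otimes>\<^sub>M lborel) (?T -` A)"
    by (subst emeasure_distr) (auto simp: lborel_prod)
  also have "\<dots> = (\<integral>\<^sup>+x. emeasure lborel (Pair x -` ?T -` A) \<partial>lborel)"
    by (rule lborel.emeasure_pair_measure_alt[OF Tm'])
  also have "\<dots> = (\<integral>\<^sup>+x. emeasure lborel (Pair x -` A) \<partial>lborel)"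
  proof (rule nn_integral_cong)
    fix x :: real
    have P: "Pair x -` A \<in> sets borel"
      using sets_Pair1[OF A'] by simp
    have "emeasure lborel (Pair x -` A) = emeasure (distr lborel borel ((+) (g x))) (Pair x -` A)"
      by (simp add: lborel_distr_plus)
    also have "\<dots> = emeasure lborel (((+) (g x)) -` Pair x -` A)"
      by (subst emeasure_distr) (use P in auto)
    also have "((+) (g x)) -` Pair x -` A = Pair x -` ?T -` A"
      by (auto simp: add.commute)
    finally show "emeasure lborel (Pair x -` ?T -` A) = emeasure lborel (Pair x -` A)" ..
  qed
  also have "\<dots> = emeasure (lborel \<Otimes>\<^sub>M lborel) A"
    by (rule lborel.emeasure_pair_measure_alt[OF A', symmetric])
  finally show "emeasure (distr lborel borel ?T) A = emeasure lborel A"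
    by (simp add: lborel_prod)
qed simp

lemma integral_shear:
  fixes g :: "real \<Rightarrow> real" and f :: "real \<times> real \<Rightarrow> real"
  assumes g[measurable]: "g \<in> borel_measurable borel" and f: "f \<in> borel_measurable borel"
  shows "(LINT z|lborel. f (fst z, snd z + g (fst z))) = (LINT z|lborel. f z)"
proof -
  have "(LINT z|lborel. f z) = (LINT z|distr lborel borel (\<lambda>z. (fst z, snd z + g (fst z))). f z)"
    by (simp add: lborel_shear)
  also have "\<dots> = (LINT z|lborel. f (fst z, snd z + g (fst z)))"
    using f by (subst integral_distr) simp_all
  finally show ?thesis ..
qed

lemma AE_shear:
  fixes g :: "real \<Rightarrow> real"
  assumes g[measurable]: "g \<in> borel_measurable borel" and P: "AE z in lborel. P z"
  shows "AE z in lborel. P (fst z, snd z + g (fst z))"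
proof (rule AE_distrD[where M' = borel and P = P])
  show "AE z in distr lborel borel (\<lambda>z. (fst z, snd z + g (fst z))). P z"
    using P by (simp only: lborel_shear[OF g])
qed simp

lemma AE_translate:
  fixes c :: "'a::euclidean_space"
  assumes "AE x in lborel. P x"
  shows "AE x in lborel. P (x + c)"
proof -
  have "AE x in distr lborel borel ((+) c). P x"
    using assms by (simp only: lborel_distr_plus)
  then have "AE x in lborel. P (c + x)"
    by (rule AE_distrD[rotated]) simp
  then show ?thesis by (simp add: add.commute)
qed

text \<open>A null set of the line times the time axis is null. \<open>P\<close> may fail to be
  measurable, so the argument runs through a measurable null set \<open>N\<close> covering its
  failures.\<close>

lemma AE_snd:
  fixes P :: "real \<Rightarrow> bool"
  assumes "AE x in lborel. P x"
  shows "AE z::real \<times> real in lborel. P (snd z)"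
proof -
  from AE_E[OF assms] obtain N where N: "{x \<in> space lborel. \<not> P x} \<subseteq> N" "emeasure lborel N = 0" "N \<in> sets lborel"
    by blast
  have "AE z in (lborel \<Otimes>\<^sub>M lborel :: (real \<times> real) measure). snd z \<notin> N"
  proof (rule lborel_pair.AE_pair_measure)
    show "{z \<in> space (lborel \<Otimes>\<^sub>M lborel). snd z \<notin> N} \<in> sets (lborel \<Otimes>\<^sub>M lborel)"
      using N(3) by measurable
    show "AE x in lborel. AE y in lborel. snd (x, y) \<notin> N"
      using N by (auto intro!: AE_I2 AE_not_in null_setsI)
  qed
  then show ?thesis
    unfolding lborel_prod using N(1) by (auto elim!: eventually_mono)
qed

lemma AE_lborel_slices:
  assumes "AE z::real \<times> real in lborel. P z"
  shows "AE t in lborel. AE x in lborel. P (t, x)"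
  using assms lborel_pair.AE_pair[of P] by (simp only: lborel_prod)

lemma integral_lborel_prod:
  fixes f :: "('a::euclidean_space \<times> 'b::euclidean_space) \<Rightarrow> real"
  assumes "integrable lborel f"
  shows "(LINT z|lborel. f z) = (LINT t|lborel. LINT x|lborel. f (t, x))"
    and "(LINT z|lborel. f z) = (LINT x|lborel. LINT t|lborel. f (t, x))"
    and "integrable lborel (\<lambda>t. LINT x|lborel. f (t, x))"
    and "integrable lborel (\<lambda>x. LINT t|lborel. f (t, x))"
proof -
  have i: "integrable (lborel \<Otimes>\<^sub>M lborel) (\<lambda>(x, y). f (x, y))"
    using assms by (simp add: lborel_prod)
  show "(LINT z|lborel. f z) = (LINT t|lborel. LINT x|lborel. f (t, x))"
    using lborel_pair.integral_fst[OF i] by (simp add: lborel_prod)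
  show "(LINT z|lborel. f z) = (LINT x|lborel. LINT t|lborel. f (t, x))"
    using lborel_pair.integral_snd[OF i] by (simp add: lborel_prod)
  show "integrable lborel (\<lambda>t. LINT x|lborel. f (t, x))"
    using lborel_pair.integrable_fst[OF i] .
  show "integrable lborel (\<lambda>x. LINT t|lborel. f (t, x))"
    using lborel_pair.integrable_snd[OF i] .
qed

section \<open>Entropy inequalities on the whole plane\<close>

text \<open>The Kruzhkov flux sgn(a - b) (a^2 - b^2) / 2 with the sign absorbed into the absolute
  value. This form shows the symmetry in the two arguments, on which doubling of variables rests,
  and the Lipschitz bounds.\<close>

definition qflux :: "real \<Rightarrow> real \<Rightarrow> real" where
  "qflux a b = \<bar>a - b\<bar> * (a + b) / 2"

text \<open>The switch of the spatial flux, kept as a real factor so that both half-planes share one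
  integral. Its jump at time 0 produces the error term in the doubling argument.\<close>

definition pos_time :: "real \<times> real \<Rightarrow> real" where
  "pos_time z = (if 0 < fst z then 1 else 0)"

definition nonneg_test ::
  "(real \<times> real \<Rightarrow> real) \<Rightarrow> (real \<times> real \<Rightarrow> real) \<Rightarrow> (real \<times> real \<Rightarrow> real) \<Rightarrow> bool" where
  "nonneg_test f ft fx \<longleftrightarrow>
     test_fun (\<lambda>t x. f (t, x)) (\<lambda>t x. ft (t, x)) (\<lambda>t x. fx (t, x)) \<and> (\<forall>z. 0 \<le> f z)"

text \<open>Here \<open>U\<close> carries its initial datum on \<open>t \<le> 0\<close>; integrating \<open>ft\<close> over negative times produces
  the initial term of the entropy inequality.\<close>
definition entropy_ext :: "(real \<times> real \<Rightarrow> real) \<Rightarrow> bool" where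
  "entropy_ext U \<longleftrightarrow> U \<in> borel_measurable borel \<and> (\<exists>M. \<forall>z. \<bar>U z\<bar> \<le> M) \<and>
     (\<forall>k f ft fx. nonneg_test f ft fx \<longrightarrow>
        0 \<le> (LINT z|lborel. \<bar>U z - k\<bar> * ft z + pos_time z * qflux (U z) k * fx z))"

section \<open>Calculus of bounded functions, for integrability on bounded supports\<close>

definition bdd_fun :: "('a \<Rightarrow> real) \<Rightarrow> bool" where
  "bdd_fun f \<longleftrightarrow> (\<exists>C. \<forall>x. \<bar>f x\<bar> \<le> C)"

lemma bdd_funI: "(\<And>x. \<bar>f x\<bar> \<le> C) \<Longrightarrow> bdd_fun f"
  by (auto simp: bdd_fun_def)

lemma bdd_fun_const: "bdd_fun (\<lambda>x. c)"
  by (auto simp: bdd_fun_def)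

lemma bdd_fun_add: "bdd_fun f \<Longrightarrow> bdd_fun g \<Longrightarrow> bdd_fun (\<lambda>x. f x + g x)"
  unfolding bdd_fun_def by (meson abs_triangle_ineq add_mono order_trans)

lemma bdd_fun_uminus: "bdd_fun f \<Longrightarrow> bdd_fun (\<lambda>x. - f x)"
  by (auto simp: bdd_fun_def)

lemma bdd_fun_diff: "bdd_fun f \<Longrightarrow> bdd_fun g \<Longrightarrow> bdd_fun (\<lambda>x. f x - g x)"
  using bdd_fun_add[OF _ bdd_fun_uminus, of f g] by simp

lemma bdd_fun_mult:
  assumes "bdd_fun f" "bdd_fun g" shows "bdd_fun (\<lambda>x. f x * g x)"
proof -
  obtain C D where C: "\<And>x. \<bar>f x\<bar> \<le> C" and D: "\<And>x. \<bar>g x\<bar> \<le> D"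
    using assms unfolding bdd_fun_def by metis
  show ?thesis
  proof (rule bdd_funI)
    fix x show "\<bar>f x * g x\<bar> \<le> C * D"
      unfolding abs_mult by (intro mult_mono C D) (auto intro: order_trans[OF abs_ge_zero C])
  qed
qed

lemma bdd_fun_abs: "bdd_fun f \<Longrightarrow> bdd_fun (\<lambda>x. \<bar>f x\<bar>)"
  by (auto simp: bdd_fun_def)

lemma bdd_fun_comp: "bdd_fun f \<Longrightarrow> bdd_fun (\<lambda>x. f (g x))"
  by (auto simp: bdd_fun_def)

lemma bdd_fun_pos_time: "bdd_fun pos_time"
  by (rule bdd_funI[where C = 1]) (simp add: pos_time_def)

lemma bdd_fun_power2: "bdd_fun f \<Longrightarrow> bdd_fun (\<lambda>x. (f x)\<^sup>2)"
  unfolding power2_eq_square by (rule bdd_fun_mult)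

lemma bdd_fun_qflux: "bdd_fun f \<Longrightarrow> bdd_fun g \<Longrightarrow> bdd_fun (\<lambda>x. qflux (f x) (g x))"
  unfolding qflux_def
  using bdd_fun_mult[OF bdd_fun_mult[OF bdd_fun_abs[OF bdd_fun_diff] bdd_fun_add] bdd_fun_const, of f g f g "1/2"]
  by simp

lemmas bdd_fun_intros = bdd_fun_const bdd_fun_add bdd_fun_uminus bdd_fun_diff bdd_fun_mult
  bdd_fun_abs bdd_fun_power2 bdd_fun_qflux bdd_fun_comp[OF bdd_fun_pos_time]

lemma integrable_bdd_fun:
  fixes f :: "'a::euclidean_space \<Rightarrow> real"
  assumes "f \<in> borel_measurable borel" "bdd_fun f" "bounded S" "\<And>x. x \<notin> S \<Longrightarrow> f x = 0"
  shows "integrable lborel f"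
  using assms integrable_bounded_support[of f _ S] unfolding bdd_fun_def by blast

lemma pos_time_measurable [measurable]: "pos_time \<in> borel_measurable borel"
  unfolding pos_time_def by measurable

lemma qflux_measurable [measurable]:
  assumes [measurable]: "f \<in> borel_measurable M" "g \<in> borel_measurable M"
  shows "(\<lambda>x. qflux (f x) (g x)) \<in> borel_measurable M"
  unfolding qflux_def by measurable

lemma qflux_commute: "qflux a b = qflux b a"
  by (simp add: qflux_def abs_minus_commute add.commute)

lemma qflux_bound:
  assumes "\<bar>a\<bar> \<le> M" "\<bar>b\<bar> \<le> M" shows "\<bar>qflux a b\<bar> \<le> M * \<bar>a - b\<bar>"
proof -
  have "\<bar>qflux a b\<bar> = \<bar>(a + b) / 2\<bar> * \<bar>a - b\<bar>"
    by (simp add: qflux_def abs_mult)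
  also have "\<dots> \<le> M * \<bar>a - b\<bar>"
    using assms by (intro mult_right_mono) auto
  finally show ?thesis .
qed

text \<open>The difference is split as for a product, changing first the absolute value and then the
  linear factor; each change costs at most \<open>M\<close> times the distance of \<open>b\<close>
  and \<open>c\<close>.\<close>

lemma qflux_lipschitz:
  assumes "\<bar>a\<bar> \<le> M" "\<bar>b\<bar> \<le> M" "\<bar>c\<bar> \<le> M"
  shows "\<bar>qflux a b - qflux a c\<bar> \<le> 2 * M * \<bar>b - c\<bar>"
proof -
  have "qflux a b - qflux a c = (\<bar>a - b\<bar> - \<bar>a - c\<bar>) * ((a + b) / 2) + \<bar>a - c\<bar> / 2 * (b - c)"
    unfolding qflux_def by (simp add: field_simps)
  also have "\<bar>\<dots>\<bar> \<le> \<bar>\<bar>a - b\<bar> - \<bar>a - c\<bar>\<bar> * \<bar>(a + b) / 2\<bar> + \<bar>\<bar>a - c\<bar> / 2\<bar> * \<bar>b - c\<bar>"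
    by (rule order_trans[OF abs_triangle_ineq]) (simp add: abs_mult)
  also have "\<dots> \<le> \<bar>b - c\<bar> * M + M * \<bar>b - c\<bar>"
    using assms by (intro add_mono mult_mono) auto
  finally show ?thesis by simp
qed

section \<open>Test functions on the plane\<close>

lemma nonneg_testI:
  assumes "\<And>z. (f has_derivative (\<lambda>h. ft z * fst h + fx z * snd h)) (at z)"
    and "continuous_on UNIV ft" "continuous_on UNIV fx"
    and S: "bounded S" and 0: "\<And>z. z \<notin> S \<Longrightarrow> f z = 0" and "\<And>z. 0 \<le> f z"
  shows "nonneg_test f ft fx"
proof -
  obtain r where r: "S \<subseteq> ball 0 r"
    using bounded_subset_ballD[OF S, of 0] by blast
  have "f (t, x) = 0" if "r < \<bar>t\<bar> \<or> r < \<bar>x\<bar>" for t x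
  proof -
    have "\<bar>t\<bar> \<le> norm (t, x)" "\<bar>x\<bar> \<le> norm (t, x)"
      using norm_fst_le[of t x] norm_snd_le[of x t] by auto
    then have "(t, x) \<notin> ball 0 r" using that by auto
    with r 0 show ?thesis by blast
  qed
  then have "\<exists>R. \<forall>t x. R < \<bar>t\<bar> \<or> R < \<bar>x\<bar> \<longrightarrow> f (t, x) = 0" by blast
  with assms show ?thesis
    unfolding nonneg_test_def test_fun_def by simp
qed

text \<open>A test function only comes with a bound on the support of \<open>f\<close>. Outside it
  \<open>f\<close> is zero on an open set, so uniqueness of the derivative makes both partial
  derivatives vanish there; boundedness follows by compactness.\<close>

lemma nonneg_testD:
  assumes "nonneg_test f ft fx"
  shows "\<And>z. (f has_derivative (\<lambda>h. ft z * fst h + fx z * snd h)) (at z)"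
    and "continuous_on UNIV f" "continuous_on UNIV ft" "continuous_on UNIV fx" "\<And>z. 0 \<le> f z"
    and "f \<in> borel_measurable borel" "ft \<in> borel_measurable borel" "fx \<in> borel_measurable borel"
    and "\<exists>r. \<forall>z. z \<notin> cball 0 r \<longrightarrow> f z = 0 \<and> ft z = 0 \<and> fx z = 0"
    and "bdd_fun f" "bdd_fun ft" "bdd_fun fx"
proof -
  show d: "\<And>z. (f has_derivative (\<lambda>h. ft z * fst h + fx z * snd h)) (at z)"
    and ct: "continuous_on UNIV ft" and cx: "continuous_on UNIV fx" and "\<And>z. 0 \<le> f z"
    using assms unfolding nonneg_test_def test_fun_def by auto
  show c: "continuous_on UNIV f"
    by (rule continuous_at_imp_continuous_on) (auto intro: has_derivative_continuous[OF d])
  show "f \<in> borel_measurable borel" "ft \<in> borel_measurable borel" "fx \<in> borel_measurable borel"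
    using c ct cx by (auto intro: borel_measurable_continuous_onI)
  obtain R where R: "\<And>t x. R < \<bar>t\<bar> \<or> R < \<bar>x\<bar> \<Longrightarrow> f (t, x) = 0"
    using assms unfolding nonneg_test_def test_fun_def by blast
  \<comment> \<open>The support bound is given coordinatewise; a point of norm above 2 |R| has a
    coordinate above |R| in size.\<close>
  define r where "r = 2 * \<bar>R\<bar>"
  have f0: "f z = 0" if "z \<in> - cball 0 r" for z
  proof (cases z)
    case (Pair t x)
    have "r < norm (t, x)" using that Pair by (simp add: not_le)
    also have "\<dots> \<le> \<bar>t\<bar> + \<bar>x\<bar>" using norm_Pair_le[of t x] by simp
    finally show ?thesis using R[of t x] Pair unfolding r_def by (cases "R < \<bar>t\<bar>") auto
  qed
  have ft0: "ft z = 0 \<and> fx z = 0" if z: "z \<in> - cball 0 r" for z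
  proof -
    have "(f has_derivative (\<lambda>h. 0)) (at z)"
      by (rule has_derivative_transform_within_open[where s = "- cball 0 r" and f = "\<lambda>_. 0"])
         (use z f0 in auto)
    from has_derivative_unique[OF this d]
    have "(\<lambda>h. 0) = (\<lambda>h. ft z * fst h + fx z * snd h)" .
    from fun_cong[OF this, of "(1, 0)"] fun_cong[OF this, of "(0, 1)"] show ?thesis by simp
  qed
  show "\<exists>r. \<forall>z. z \<notin> cball 0 r \<longrightarrow> f z = 0 \<and> ft z = 0 \<and> fx z = 0"
    using f0 ft0 by (intro exI[of _ r]) blast
  have "bdd_fun g" if "continuous_on UNIV g" "\<And>z. z \<notin> cball 0 r \<Longrightarrow> g z = 0" for g :: "real \<times> real \<Rightarrow> real"
    using continuous_support_bounded[OF that(1) bounded_cball that(2)] bdd_funI by blast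
  then show "bdd_fun f" "bdd_fun ft" "bdd_fun fx"
    using c ct cx f0 ft0 by simp_all
qed

text \<open>The doubled test function \<open>f z * K (y - z)\<close> as seen by \<open>U\<close>,
  the second point \<open>y\<close> being frozen. Differentiating \<open>K (y - z)\<close> in
  \<open>z\<close> yields the minus signs that later meet the terms obtained by freezing
  \<open>z\<close>.\<close>

lemma nonneg_test_mult_shift:
  assumes f: "nonneg_test f ft fx" and K: "nonneg_test K K1 K2"
  shows "nonneg_test (\<lambda>z. f z * K (y - z)) (\<lambda>z. ft z * K (y - z) - f z * K1 (y - z))
           (\<lambda>z. fx z * K (y - z) - f z * K2 (y - z))"
proof -
  note f = nonneg_testD[OF f] and K = nonneg_testD[OF K]
  obtain r where r: "\<And>z. z \<notin> cball 0 r \<Longrightarrow> f z = 0" using f(9) by auto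
  have cK: "continuous_on UNIV (\<lambda>z. k (y - z))" if "continuous_on UNIV k" for k :: "real \<times> real \<Rightarrow> real"
    by (rule continuous_on_compose2[OF that]) (auto intro!: continuous_intros)
  show ?thesis
  proof (rule nonneg_testI[where S = "cball 0 r"])
    fix z
    have "((\<lambda>z. K (y - z)) has_derivative (\<lambda>h. - (K1 (y - z) * fst h + K2 (y - z) * snd h))) (at z)"
      by (rule has_derivative_eq_rhs[OF has_derivative_compose[OF _ K(1)]])
         (auto intro!: derivative_eq_intros)
    from has_derivative_mult[OF f(1) this]
    show "((\<lambda>z. f z * K (y - z)) has_derivative
       (\<lambda>h. (ft z * K (y - z) - f z * K1 (y - z)) * fst h + (fx z * K (y - z) - f z * K2 (y - z)) * snd h)) (at z)"
      by (rule has_derivative_eq_rhs) (auto simp: algebra_simps)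
  qed (use f K r in \<open>auto intro!: continuous_intros cK\<close>)
qed

text \<open>The doubled test function as seen by \<open>V\<close>: the first point is frozen, and
  the value of \<open>f\<close> there becomes the constant \<open>c\<close>.\<close>

lemma nonneg_test_shift:
  assumes K: "nonneg_test K K1 K2" and c: "0 \<le> c"
  shows "nonneg_test (\<lambda>z. c * K (z - y)) (\<lambda>z. c * K1 (z - y)) (\<lambda>z. c * K2 (z - y))"
proof -
  note K = nonneg_testD[OF K]
  obtain r where r: "\<And>z. z \<notin> cball 0 r \<Longrightarrow> K z = 0" using K(9) by auto
  have cK: "continuous_on UNIV (\<lambda>z. k (z - y))" if "continuous_on UNIV k" for k :: "real \<times> real \<Rightarrow> real"
    by (rule continuous_on_compose2[OF that]) (auto intro!: continuous_intros)
  show ?thesis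
  proof (rule nonneg_testI[where S = "cball y r"])
    fix z
    have "((\<lambda>z. K (z - y)) has_derivative (\<lambda>h. K1 (z - y) * fst h + K2 (z - y) * snd h)) (at z)"
      by (rule has_derivative_eq_rhs[OF has_derivative_compose[OF _ K(1)]])
         (auto intro!: derivative_eq_intros)
    from has_derivative_mult[OF has_derivative_const this, of c]
    show "((\<lambda>z. c * K (z - y)) has_derivative
       (\<lambda>h. c * K1 (z - y) * fst h + c * K2 (z - y) * snd h)) (at z)"
      by (rule has_derivative_eq_rhs) (auto simp: algebra_simps)
    show "z \<notin> cball y r \<Longrightarrow> c * K (z - y) = 0"
      using r[of "z - y"] by (auto simp: dist_norm norm_minus_commute)
  qed (use K c in \<open>auto intro!: continuous_intros cK\<close>)
qed

text \<open>Squaring smooths the kink of the positive part to class C^1, the regularity asked of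
  test functions; the bump and the cone weights are built from it.\<close>

lemma has_real_derivative_max0_sq:
  "((\<lambda>s. (max 0 s)\<^sup>2) has_real_derivative 2 * max 0 s) (at (s::real))"
proof (cases "s = 0")
  case True
  have "((\<lambda>h::real. max 0 h) \<longlongrightarrow> max 0 0) (at 0)"
    by (intro tendsto_intros)
  moreover have "eventually (\<lambda>h::real. max 0 h = ((max 0 (0 + h))\<^sup>2 - (max 0 0)\<^sup>2) / h) (at 0)"
    by (auto simp: eventually_at_filter max_def power2_eq_square)
  ultimately have "((\<lambda>h::real. ((max 0 (0 + h))\<^sup>2 - (max 0 0)\<^sup>2) / h) \<longlongrightarrow> max 0 0) (at 0)"
    by (rule Lim_transform_eventually)
  then show ?thesis using True by (simp add: DERIV_def)
next
  case False
  show ?thesis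
  proof (cases "s > 0")
    case True
    have "((\<lambda>s. s\<^sup>2) has_real_derivative 2 * s) (at s)"
      by (auto intro!: derivative_eq_intros)
    then have "((\<lambda>s. (max 0 s)\<^sup>2) has_real_derivative 2 * s) (at s)"
      by (rule has_field_derivative_transform_within_open[where S = "{0<..}"]) (use True in auto)
    then show ?thesis using True by simp
  next
    case F: False
    have "((\<lambda>s. 0) has_real_derivative 0) (at s)" by simp
    then have "((\<lambda>s. (max 0 s)\<^sup>2) has_real_derivative 0) (at s)"
      by (rule has_field_derivative_transform_within_open[where S = "{..<0}"]) (use F False in auto)
    then show ?thesis using F by simp
  qed
qed

section \<open>Kato's inequality\<close>

definition line_test :: "(real \<Rightarrow> real) \<Rightarrow> (real \<Rightarrow> real) \<Rightarrow> bool" where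
  "line_test a a' \<longleftrightarrow> (\<forall>x. (a has_real_derivative a' x) (at x)) \<and> continuous_on UNIV a' \<and>
     (\<forall>x. 0 \<le> a x) \<and> (\<exists>R. \<forall>x. R < \<bar>x\<bar> \<longrightarrow> a x = 0)"

lemma line_test_continuous:
  assumes "line_test a a'" shows "continuous_on UNIV a"
  using assms unfolding line_test_def
  by (auto intro!: continuous_at_imp_continuous_on DERIV_isCont)

lemma nonneg_test_tensor:
  assumes a: "line_test a a'" and b: "line_test b b'"
  shows "nonneg_test (\<lambda>z. a (fst z) * b (snd z)) (\<lambda>z. a' (fst z) * b (snd z)) (\<lambda>z. a (fst z) * b' (snd z))"
proof -
  obtain R where R: "\<And>x. R < \<bar>x\<bar> \<Longrightarrow> a x = 0" using a unfolding line_test_def by auto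
  obtain R' where R': "\<And>x. R' < \<bar>x\<bar> \<Longrightarrow> b x = 0" using b unfolding line_test_def by auto
  have c1: "continuous_on UNIV (\<lambda>z::real \<times> real. g (fst z))" "continuous_on UNIV (\<lambda>z::real \<times> real. g (snd z))"
    if "continuous_on UNIV g" for g :: "real \<Rightarrow> real"
    by (auto intro!: continuous_on_compose2[OF that] continuous_intros)
  show ?thesis
  proof (rule nonneg_testI[where S = "{-R..R} \<times> {-R'..R'}"])
    fix z :: "real \<times> real"
    have "(a has_derivative (\<lambda>h. a' (fst z) * h)) (at (fst z))" "(b has_derivative (\<lambda>h. b' (snd z) * h)) (at (snd z))"
      using a b unfolding line_test_def has_field_derivative_def by blast+
    then have "((\<lambda>z. a (fst z)) has_derivative (\<lambda>h. a' (fst z) * fst h)) (at z)"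
      "((\<lambda>z. b (snd z)) has_derivative (\<lambda>h. b' (snd z) * snd h)) (at z)"
      by (auto intro!: has_derivative_compose[of fst fst] has_derivative_compose[of snd snd] derivative_intros)
    from has_derivative_mult[OF this]
    show "((\<lambda>z. a (fst z) * b (snd z)) has_derivative
        (\<lambda>h. a' (fst z) * b (snd z) * fst h + a (fst z) * b' (snd z) * snd h)) (at z)"
      by (rule has_derivative_eq_rhs) (auto simp: algebra_simps)
    assume "z \<notin> {- R..R} \<times> {- R'..R'}"
    then have "R < \<bar>fst z\<bar> \<or> R' < \<bar>snd z\<bar>" by (cases z) auto
    then show "a (fst z) * b (snd z) = 0" using R R' by auto
  next
    show "bounded ({- R..R} \<times> {- R'..R'})" by (intro bounded_Times) auto
  qed (use a b in \<open>auto simp: line_test_def intro!: continuous_intros c1 line_test_continuous[OF a] line_test_continuous[OF b]\<close>)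
qed

text \<open>A piecewise polynomial C^1 bump supported in [-1, 1]. Being explicit, it has the crude
  bounds wanted later: at most 1, at least 1/2 for |r| \<le> 1/2, slope at most 4.\<close>

definition bump :: "real \<Rightarrow> real" where
  "bump r = (max 0 (1 - r\<^sup>2))\<^sup>2"

definition bump' :: "real \<Rightarrow> real" where
  "bump' r = - 4 * r * max 0 (1 - r\<^sup>2)"

lemma bump_outside: "1 \<le> \<bar>r\<bar> \<Longrightarrow> bump r = 0 \<and> bump' r = 0"
  using abs_le_square_iff[of 1 r] by (simp add: bump_def bump'_def max_def)

lemma bump_bounds: "0 \<le> bump r" "bump r \<le> 1" "\<bar>bump' r\<bar> \<le> 4"
proof -
  show "0 \<le> bump r" by (simp add: bump_def)
  show "bump r \<le> 1" unfolding bump_def by (rule power_le_one) auto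
  show "\<bar>bump' r\<bar> \<le> 4"
  proof (cases "1 \<le> \<bar>r\<bar>")
    case False
    have "\<bar>r\<bar> * \<bar>max 0 (1 - r\<^sup>2)\<bar> \<le> 1 * 1"
      using False by (intro mult_mono) auto
    then show ?thesis by (simp add: bump'_def abs_mult)
  qed (simp add: bump_outside)
qed

lemma bump_ge: "\<bar>r\<bar> \<le> 1/2 \<Longrightarrow> 1/2 \<le> bump r"
proof -
  assume "\<bar>r\<bar> \<le> 1/2"
  then have "r\<^sup>2 \<le> (1/2)\<^sup>2" using abs_le_square_iff[of r "1/2"] by simp
  then have "3/4 \<le> 1 - r\<^sup>2" by (simp add: power2_eq_square)
  then have "3/4 \<le> max 0 (1 - r\<^sup>2)" by linarith
  then have "(3/4)\<^sup>2 \<le> bump r" unfolding bump_def by (rule power_mono) simp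
  then show ?thesis by (simp add: power2_eq_square)
qed

lemma line_test_bump:
  assumes "0 < d"
  shows "line_test (\<lambda>r. bump (r / d)) (\<lambda>r. bump' (r / d) / d)"
  unfolding line_test_def
proof (intro conjI allI)
  fix x
  show "((\<lambda>r. bump (r / d)) has_real_derivative bump' (x / d) / d) (at x)"
  proof -
    have "((\<lambda>r. 1 - (r / d)\<^sup>2) has_real_derivative - 2 * (x / d) / d) (at x)"
      using assms by (auto intro!: derivative_eq_intros simp: power2_eq_square)
    from DERIV_chain2[OF has_real_derivative_max0_sq this] show ?thesis
      unfolding bump_def bump'_def by (rule DERIV_cong) simp
  qed
  show "0 \<le> bump (x / d)" by (rule bump_bounds)
  show "continuous_on UNIV (\<lambda>r. bump' (r / d) / d)"
    unfolding bump'_def using assms by (intro continuous_intros) auto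
  show "\<exists>R. \<forall>x. R < \<bar>x\<bar> \<longrightarrow> bump (x / d) = 0"
    using assms by (intro exI[of _ d] allI impI bump_outside[THEN conjunct1]) (simp add: field_simps)
qed

text \<open>The two sets of variables are \<open>z\<close> and \<open>z + w\<close>, and the test function is \<open>f z * K w\<close>: derivatives of
  \<open>K\<close> survive only in the term carrying the jump of \<open>pos_time\<close>.\<close>
lemma doubling:
  assumes U: "entropy_ext U" and V: "entropy_ext V"
    and f: "nonneg_test f ft fx" and K: "nonneg_test K K1 K2"
  defines "D \<equiv> \<lambda>w. LINT z|lborel.
      (\<bar>U z - V (z + w)\<bar> * ft z + pos_time z * qflux (U z) (V (z + w)) * fx z) * K w
      + (pos_time (z + w) - pos_time z) * qflux (U z) (V (z + w)) * f z * K2 w"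
  shows "integrable lborel D" "0 \<le> (LINT w|lborel. D w)"
proof -
  note f' = nonneg_testD[OF f] and K' = nonneg_testD[OF K]
  have Um[measurable]: "U \<in> borel_measurable borel" and Vm[measurable]: "V \<in> borel_measurable borel"
    and bU: "bdd_fun U" and bV: "bdd_fun V"
    using U V by (auto simp: entropy_ext_def bdd_fun_def)
  note [measurable] = f'(6,7,8) K'(6,7,8)
  obtain r where r: "\<And>z. z \<notin> cball 0 r \<Longrightarrow> f z = 0 \<and> ft z = 0 \<and> fx z = 0"
    using f'(9) by blast
  obtain s where s: "\<And>z. z \<notin> cball 0 s \<Longrightarrow> K z = 0 \<and> K1 z = 0 \<and> K2 z = 0"
    using K'(9) by blast
  \<comment> \<open>\<open>P1\<close> is the entropy inequality of \<open>U\<close> at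
    \<open>z\<close> with constant \<open>V z'\<close>, and \<open>P2\<close> that of
    \<open>V\<close> at \<open>z'\<close> with constant \<open>U z\<close>; both use the test
    function \<open>f z * K (z' - z)\<close>.\<close>
  define P1 where "P1 y = (case y of (z, z') \<Rightarrow>
      \<bar>U z - V z'\<bar> * (ft z * K (z' - z) - f z * K1 (z' - z))
      + pos_time z * qflux (U z) (V z') * (fx z * K (z' - z) - f z * K2 (z' - z)))" for y
  define P2 where "P2 y = (case y of (z, z') \<Rightarrow>
      \<bar>V z' - U z\<bar> * (f z * K1 (z' - z)) + pos_time z' * qflux (V z') (U z) * (f z * K2 (z' - z)))" for y
  let ?S = "cball 0 r \<times> cball 0 (r + s) :: ((real \<times> real) \<times> (real \<times> real)) set"
  have bS: "bounded ?S" by (intro bounded_Times bounded_cball)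
  have out: "f z = 0 \<and> ft z = 0 \<and> fx z = 0 \<or> K (z' - z) = 0 \<and> K1 (z' - z) = 0 \<and> K2 (z' - z) = 0"
    if "(z, z') \<notin> ?S" for z z'
  proof (cases "z \<in> cball 0 r")
    case True
    then have "z' \<notin> cball 0 (r + s)" using that by auto
    then have "z' - z \<notin> cball 0 s"
      using True norm_triangle_ineq[of "z' - z" z] by auto
    then show ?thesis using s by blast
  qed (use r in blast)
  note b = bdd_fun_intros bdd_fun_comp[OF bU] bdd_fun_comp[OF bV] bdd_fun_comp[OF f'(10)] bdd_fun_comp[OF f'(11)]
    bdd_fun_comp[OF f'(12)] bdd_fun_comp[OF K'(10)] bdd_fun_comp[OF K'(11)] bdd_fun_comp[OF K'(12)]
  have i1: "integrable lborel P1"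
  proof (rule integrable_bdd_fun[OF _ _ bS])
    show "P1 \<in> borel_measurable borel" unfolding P1_def split_beta by measurable
    show "bdd_fun P1" unfolding P1_def split_beta by (intro b)
    fix y assume "y \<notin> ?S" then show "P1 y = 0"
      using out[of "fst y" "snd y"] by (auto simp: P1_def split_beta)
  qed
  have i2: "integrable lborel P2"
  proof (rule integrable_bdd_fun[OF _ _ bS])
    show "P2 \<in> borel_measurable borel" unfolding P2_def split_beta by measurable
    show "bdd_fun P2" unfolding P2_def split_beta by (intro b)
    fix y assume "y \<notin> ?S" then show "P2 y = 0"
      using out[of "fst y" "snd y"] by (auto simp: P2_def split_beta)
  qed
  \<comment> \<open>In the coordinates \<open>z\<close> and \<open>w = z' - z\<close> the
    \<open>K1\<close> terms cancel by symmetry of the entropy; the \<open>K2\<close> terms cancel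
    only as far as the two switches agree.\<close>
  define Q where "Q y = P1 (fst y, fst y + snd y) + P2 (fst y, fst y + snd y)" for y
  have Q: "Q (z, w) = (\<bar>U z - V (z + w)\<bar> * ft z + pos_time z * qflux (U z) (V (z + w)) * fx z) * K w
      + (pos_time (z + w) - pos_time z) * qflux (U z) (V (z + w)) * f z * K2 w" for z w
    unfolding Q_def P1_def P2_def
    by (simp add: algebra_simps qflux_commute[of "V (w + z)"] abs_minus_commute[of "V (w + z)"])
  have iQ: "integrable lborel Q"
  proof (rule integrable_bdd_fun[where S = "cball 0 r \<times> cball 0 s"])
    show "Q \<in> borel_measurable borel" unfolding Q_def P1_def P2_def split_beta fst_conv snd_conv by measurable
    show "bdd_fun Q" unfolding Q_def P1_def P2_def split_beta fst_conv snd_conv by (intro b)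
    fix y :: "(real \<times> real) \<times> (real \<times> real)" assume "y \<notin> cball 0 r \<times> cball 0 s"
    then show "Q y = 0"
      using r[of "fst y"] s[of "snd y"] Q[of "fst y" "snd y"] by (cases y) auto
  qed (intro bounded_Times bounded_cball)
  have D: "D = (\<lambda>w. LINT z|lborel. Q (z, w))" unfolding D_def Q ..
  show "integrable lborel D"
    unfolding D by (rule integral_lborel_prod(4)[OF iQ])
  \<comment> \<open>For each fixed \<open>z'\<close> the value \<open>V z'\<close> is a legitimate
    Kruzhkov constant, so the inner integral is nonnegative.\<close>
  have "0 \<le> (LINT z'|lborel. LINT z|lborel. P1 (z, z'))"
    using U nonneg_test_mult_shift[OF f K]
    unfolding entropy_ext_def P1_def split_beta fst_conv snd_conv
    by - (rule Bochner_Integration.integral_nonneg, blast)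
  moreover have "0 \<le> (LINT z|lborel. LINT z'|lborel. P2 (z, z'))"
    using V nonneg_test_shift[OF K f'(5)]
    unfolding entropy_ext_def P2_def split_beta fst_conv snd_conv
    by - (rule Bochner_Integration.integral_nonneg, blast)
  ultimately have "0 \<le> (LINT y|lborel. P1 y) + (LINT y|lborel. P2 y)"
    by (simp add: integral_lborel_prod(2)[OF i1] integral_lborel_prod(1)[OF i2])
  also have "\<dots> = (LINT y|lborel. P1 y + P2 y)"
    using i1 i2 by simp
  also have "\<dots> = (LINT z|lborel. LINT z'|lborel. P1 (z, z') + P2 (z, z'))"
    using i1 i2 by (intro integral_lborel_prod(1)) simp
  also have "\<dots> = (LINT z|lborel. LINT w|lborel. Q (z, w))"
  proof (rule Bochner_Integration.integral_cong[OF refl])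
    fix z :: "real \<times> real"
    have "(\<lambda>z'. P1 (z, z') + P2 (z, z')) \<in> borel_measurable borel"
      unfolding P1_def P2_def split_beta fst_conv snd_conv by measurable
    from lborel_integral_translate[OF this, of z]
    show "(LINT z'|lborel. P1 (z, z') + P2 (z, z')) = (LINT w|lborel. Q (z, w))"
      by (simp add: Q_def add.commute)
  qed
  also have "\<dots> = (LINT w|lborel. D w)"
    unfolding D using integral_lborel_prod(1,2)[OF iQ] by simp
  finally show "0 \<le> (LINT w|lborel. D w)" .
qed

lemma measure_lborel_symmetric_box:
  fixes a b :: real
  assumes "0 \<le> a" "0 \<le> b"
  shows "measure lborel (cbox (- a, - b) (a, b)) = 4 * a * b"
    "integrable lborel (indicator (cbox (- a, - b) (a, b)) :: real \<times> real \<Rightarrow> real)"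
proof -
  show "measure lborel (cbox (- a, - b) (a, b)) = 4 * a * b"
    using assms by (subst measure_lborel_cbox_eq) (auto simp: Basis_prod_def prod.union_disjoint)
qed (intro integrable_real_indicator emeasure_bounded_finite; simp)

text \<open>Within the ball the switch changes only in the strip |fst z| \<le> |fst w|; the bound is
  the area of a box with half-sides |fst w| and |r|.\<close>

lemma pos_time_shift_integral:
  "(LINT z|lborel. \<bar>pos_time (z + w) - pos_time z\<bar> * indicator (cball 0 r) z) \<le> 4 * \<bar>r\<bar> * \<bar>fst w\<bar>"
proof -
  let ?B = "cbox (- \<bar>fst w\<bar>, - \<bar>r\<bar>) (\<bar>fst w\<bar>, \<bar>r\<bar>)"
  have "(LINT z|lborel. \<bar>pos_time (z + w) - pos_time z\<bar> * indicator (cball 0 r) z)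
    \<le> (LINT z|lborel. indicator ?B z)"
  proof (rule integral_mono)
    show "integrable lborel (\<lambda>z. \<bar>pos_time (z + w) - pos_time z\<bar> * indicator (cball 0 r) z)"
    proof (rule integrable_bounded_support[where C = 1 and S = "cball 0 r"])
      show "\<bar>\<bar>pos_time (z + w) - pos_time z\<bar> * indicator (cball 0 r) z\<bar> \<le> 1" for z
        by (auto simp: pos_time_def split: split_indicator)
    qed auto
    show "integrable lborel (indicator ?B :: real \<times> real \<Rightarrow> real)"
      by (rule measure_lborel_symmetric_box) auto
    fix z :: "real \<times> real"
    show "\<bar>pos_time (z + w) - pos_time z\<bar> * indicator (cball 0 r) z \<le> indicator ?B z"
    proof (cases "z \<in> cball 0 r \<and> pos_time (z + w) \<noteq> pos_time z")
      case True
      have "\<bar>snd z\<bar> \<le> \<bar>r\<bar>"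
        using True norm_snd_le[of "snd z" "fst z"] by auto
      moreover have "\<bar>fst z\<bar> \<le> \<bar>fst w\<bar>"
        using True by (auto simp: pos_time_def split: if_splits)
      ultimately have "z \<in> ?B"
        by (cases z) (auto simp: cbox_Pair_eq)
      then show ?thesis by (auto simp: pos_time_def split: split_indicator)
    qed auto
  qed
  also have "\<dots> = 4 * \<bar>fst w\<bar> * \<bar>r\<bar>"
    using measure_lborel_symmetric_box[of "\<bar>fst w\<bar>" "\<bar>r\<bar>"] by simp
  finally show ?thesis by (simp add: mult_ac)
qed

text \<open>If the integral were negative, the doubled inequality would fail at one small scale: for
  small \<open>w\<close> the function \<open>D\<close> stays below half of that integral times
  \<open>K w\<close>, apart from the error made by the switch. Instead of normalising the mollifier
  and passing to a limit, sizes on two boxes are compared.\<close>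

theorem kato_inequality:
  assumes U: "entropy_ext U" and V: "entropy_ext V" and f: "nonneg_test f ft fx"
  shows "0 \<le> (LINT z|lborel. \<bar>U z - V z\<bar> * ft z + pos_time z * qflux (U z) (V z) * fx z)"
proof (rule ccontr)
  define I where "I = (LINT z|lborel. \<bar>U z - V z\<bar> * ft z + pos_time z * qflux (U z) (V z) * fx z)"
  assume "\<not> ?thesis"
  then have I: "I < 0" by (simp add: I_def)
  note f' = nonneg_testD[OF f]
  have Um[measurable]: "U \<in> borel_measurable borel" and Vm[measurable]: "V \<in> borel_measurable borel"
    and bU: "bdd_fun U" and bV: "bdd_fun V"
    using U V by (auto simp: entropy_ext_def bdd_fun_def)
  note [measurable] = f'(6,7,8)
  obtain r where r: "\<And>z. z \<notin> cball 0 r \<Longrightarrow> f z = 0 \<and> ft z = 0 \<and> fx z = 0"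
    using f'(9) by blast
  obtain M1 M2 where "\<And>z. \<bar>U z\<bar> \<le> M1" "\<And>z. \<bar>V z\<bar> \<le> M2"
    using bU bV by (auto simp: bdd_fun_def)
  then have M: "\<bar>U z\<bar> \<le> max M1 M2" "\<bar>V z\<bar> \<le> max M1 M2" for z
    by (simp_all add: le_max_iff_disj)
  obtain C1 C2 C3 where "\<And>z. \<bar>f z\<bar> \<le> C1" "\<And>z. \<bar>ft z\<bar> \<le> C2" "\<And>z. \<bar>fx z\<bar> \<le> C3"
    using f'(10,11,12) by (auto simp: bdd_fun_def)
  then have C: "\<bar>f z\<bar> \<le> max C1 (max C2 C3)" "\<bar>ft z\<bar> \<le> max C1 (max C2 C3)" "\<bar>fx z\<bar> \<le> max C1 (max C2 C3)" for z
    by (simp_all add: le_max_iff_disj)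
  define M where "M = max M1 M2"
  define C where "C = max C1 (max C2 C3)"
  note M = M[folded M_def] and C = C[folded C_def]
  have M0: "0 \<le> M" and C0: "0 \<le> C" using M(1)[of 0] C(1)[of 0] by linarith+
  \<comment> \<open>Cost of replacing \<open>V z\<close> by \<open>V (z + w)\<close>: Lipschitz
    constant 1 for the absolute value and \<open>2 * M\<close> for \<open>qflux\<close>, each times
    the bound \<open>C\<close> on the derivatives of the test function.\<close>
  define A where "A = C + 2 * M * C"
  have A0: "0 \<le> A" using M0 C0 by (simp add: A_def)
  let ?om = "\<lambda>w. LINT z|lborel. indicator (cball 0 r) z * \<bar>V (z + w) - V z\<bar>"
  \<comment> \<open>Chosen so that \<open>A\<close> times this amount is at most half of
    \<open>- I\<close>; the added 1 covers \<open>A = 0\<close>.\<close>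
  have "- I / (2 * (A + 1)) > 0" by (rule divide_pos_pos) (use I A0 in auto)
  from L1_translation_continuous[OF Vm M(2) this]
  obtain d where d: "d > 0" and om: "\<And>w. norm w < d \<Longrightarrow> ?om w \<le> - I / (2 * (A + 1))"
    by blast
  \<comment> \<open>\<open>2 * M\<^sup>2\<close> bounds \<open>qflux\<close>, \<open>C\<close>
    bounds \<open>f\<close>, and \<open>4 * \<bar>r\<bar>\<close> comes from the area of the strip
    where the switch changes.\<close>
  define B where "B = 2 * M\<^sup>2 * C * (4 * \<bar>r\<bar>)"
  have B0: "0 \<le> B" using C0 by (simp add: B_def)
  define D where "D K K2 = (\<lambda>w. LINT z|lborel.
      (\<bar>U z - V (z + w)\<bar> * ft z + pos_time z * qflux (U z) (V (z + w)) * fx z) * K w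
      + (pos_time (z + w) - pos_time z) * qflux (U z) (V (z + w)) * f z * K2 w)" for K K2 :: "real \<times> real \<Rightarrow> real"
  note b = bdd_fun_intros bdd_fun_comp[OF bU] bdd_fun_comp[OF bV] bdd_fun_comp[OF f'(10)] bdd_fun_comp[OF f'(11)]
    bdd_fun_comp[OF f'(12)]
  have D_le: "D K K2 w \<le> K w * (I / 2) + B * (\<bar>K2 w\<bar> * \<bar>fst w\<bar>)"
    if K: "K w \<ge> 0" "K w \<noteq> 0 \<Longrightarrow> norm w < d" for K K2 :: "real \<times> real \<Rightarrow> real" and w
  proof -
    let ?G = "\<lambda>z w. \<bar>U z - V (z + w)\<bar> * ft z + pos_time z * qflux (U z) (V (z + w)) * fx z"
    let ?H = "\<lambda>z. (pos_time (z + w) - pos_time z) * qflux (U z) (V (z + w)) * f z"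
    have iG: "integrable lborel (\<lambda>z. ?G z w)" for w
      by (rule integrable_bdd_fun[OF _ _ bounded_cball[of 0 r]]) (measurable, intro b, use r in auto)
    have iH: "integrable lborel ?H"
      by (rule integrable_bdd_fun[OF _ _ bounded_cball[of 0 r]]) (measurable, intro b, use r in auto)
    have iom: "integrable lborel (\<lambda>z. indicator (cball 0 r) z * \<bar>V (z + w) - V z\<bar>)"
      by (rule integrable_bdd_fun[OF _ _ bounded_cball[of 0 r]])
         (measurable, intro b bdd_funI[where C = 1], auto)
    have ip: "integrable lborel (\<lambda>z. \<bar>pos_time (z + w) - pos_time z\<bar> * indicator (cball 0 r) z)"
      by (rule integrable_bdd_fun[OF _ _ bounded_cball[of 0 r]])
         (measurable, intro b bdd_funI[where C = 1], auto)
    have "(LINT z|lborel. ?G z w) \<le> (LINT z|lborel. ?G z 0 + A * (indicator (cball 0 r) z * \<bar>V (z + w) - V z\<bar>))"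
    proof (rule integral_mono)
      fix z
      show "?G z w \<le> ?G z 0 + A * (indicator (cball 0 r) z * \<bar>V (z + w) - V z\<bar>)"
      proof (cases "z \<in> cball 0 r")
        case True
        have "?G z w - ?G z 0 = (\<bar>U z - V (z + w)\<bar> - \<bar>U z - V z\<bar>) * ft z
            + (pos_time z * (qflux (U z) (V (z + w)) - qflux (U z) (V z))) * fx z"
          by (simp add: algebra_simps)
        also have "\<dots> \<le> \<bar>\<bar>U z - V (z + w)\<bar> - \<bar>U z - V z\<bar>\<bar> * \<bar>ft z\<bar>
            + \<bar>pos_time z * (qflux (U z) (V (z + w)) - qflux (U z) (V z))\<bar> * \<bar>fx z\<bar>"
          by (intro add_mono) (simp_all flip: abs_mult)
        also have "\<dots> \<le> \<bar>V (z + w) - V z\<bar> * C + (2 * M * \<bar>V (z + w) - V z\<bar>) * C"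
        proof (intro add_mono mult_mono C)
          show "\<bar>pos_time z * (qflux (U z) (V (z + w)) - qflux (U z) (V z))\<bar> \<le> 2 * M * \<bar>V (z + w) - V z\<bar>"
            using qflux_lipschitz[OF M(1)[of z] M(2)[of "z+w"] M(2)[of z]] M0
            by (simp add: pos_time_def)
        qed (use M0 in auto)
        finally show ?thesis using True by (simp add: A_def algebra_simps)
      qed (use r[of z] in auto)
    next
      show "integrable lborel (\<lambda>z. ?G z 0 + A * (indicator (cball 0 r) z * \<bar>V (z + w) - V z\<bar>))"
        by (intro Bochner_Integration.integrable_add iG integrable_mult_right iom)
    qed (rule iG)
    also have "\<dots> = I + A * ?om w"
      unfolding I_def using iG[of 0] iom by (subst Bochner_Integration.integral_add) simp_all
    finally have 1: "(LINT z|lborel. ?G z w) \<le> I + A * ?om w" .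
    have 2: "K w * (I + A * ?om w) \<le> K w * (I / 2)"
    proof (cases "K w = 0")
      case False
      have "A * ?om w \<le> A * (- I / (2 * (A + 1)))"
        using om[OF K(2)[OF False]] A0 by (rule mult_left_mono)
      also have "\<dots> = (- I / 2) * (A / (A + 1))"
        using A0 by (simp add: field_simps)
      also have "\<dots> \<le> (- I / 2) * 1"
        using I A0 by (intro mult_left_mono) auto
      finally show ?thesis using K(1) by (intro mult_left_mono) auto
    qed simp
    have "\<bar>LINT z|lborel. ?H z\<bar> \<le> (LINT z|lborel. \<bar>?H z\<bar>)"
      using integral_norm_bound[of lborel ?H] by simp
    also have "\<dots> \<le> (LINT z|lborel. (2 * M\<^sup>2 * C) * (\<bar>pos_time (z + w) - pos_time z\<bar> * indicator (cball 0 r) z))"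
    proof (rule integral_mono)
      fix z
      show "\<bar>?H z\<bar> \<le> (2 * M\<^sup>2 * C) * (\<bar>pos_time (z + w) - pos_time z\<bar> * indicator (cball 0 r) z)"
      proof (cases "z \<in> cball 0 r")
        case True
        have "\<bar>qflux (U z) (V (z + w))\<bar> \<le> M * \<bar>U z - V (z + w)\<bar>"
          by (intro qflux_bound M)
        also have "\<dots> \<le> M * (2 * M)"
          using M(1)[of z] M(2)[of "z + w"] M0 by (intro mult_left_mono) linarith+
        finally have q: "\<bar>qflux (U z) (V (z + w))\<bar> \<le> 2 * M\<^sup>2" by (simp add: power2_eq_square)
        have "\<bar>?H z\<bar> \<le> \<bar>pos_time (z + w) - pos_time z\<bar> * (2 * M\<^sup>2) * C"
          unfolding abs_mult using C0 by (intro mult_mono q C order_refl) auto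
        then show ?thesis using True by (simp add: mult_ac)
      qed (use r[of z] in auto)
    qed (use iH ip in auto)
    also have "\<dots> = (2 * M\<^sup>2 * C) * (LINT z|lborel. \<bar>pos_time (z + w) - pos_time z\<bar> * indicator (cball 0 r) z)"
      by (rule integral_mult_right_zero)
    also have "\<dots> \<le> (2 * M\<^sup>2 * C) * (4 * \<bar>r\<bar> * \<bar>fst w\<bar>)"
      using C0 by (intro mult_left_mono pos_time_shift_integral) auto
    finally have 3: "\<bar>LINT z|lborel. ?H z\<bar> \<le> B * \<bar>fst w\<bar>"
      by (simp add: B_def mult_ac)
    have "D K K2 w = (LINT z|lborel. ?G z w) * K w + (LINT z|lborel. ?H z) * K2 w"
      unfolding D_def using iG[of w] iH by (subst Bochner_Integration.integral_add) auto
    also have "\<dots> \<le> K w * (I + A * ?om w) + \<bar>LINT z|lborel. ?H z\<bar> * \<bar>K2 w\<bar>"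
      using mult_left_mono[OF 1 K(1)] by (intro add_mono) (simp_all add: mult.commute flip: abs_mult)
    also have "\<dots> \<le> K w * (I / 2) + B * \<bar>fst w\<bar> * \<bar>K2 w\<bar>"
      by (intro add_mono 2 mult_right_mono 3) auto
    finally show ?thesis by (simp add: mult_ac)
  qed
  \<comment> \<open>The bound 1 gives \<open>e\<^sup>2 \<le> e\<close>; \<open>d / 3\<close> brings
    the support of the kernel, of norm at most \<open>2 * e\<close>, inside the ball of radius
    \<open>d\<close>; the last bound keeps the error \<open>16 * B * e\<close> at most half of the
    gain \<open>- I / 8\<close>.\<close>
  define e where "e = min 1 (min (d / 3) (- I / (256 * (B + 1))))"
  have e: "0 < e" "e \<le> 1" "e \<le> d / 3" "e \<le> - I / (256 * (B + 1))"
  proof -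
    have "0 < - I / (256 * (B + 1))" by (rule divide_pos_pos) (use I B0 in auto)
    then show "0 < e" using d unfolding e_def by simp
  qed (unfold e_def, linarith+)
  define K where "K = (\<lambda>w::real \<times> real. bump (fst w / e\<^sup>2) * bump (snd w / e))"
  define K1 where "K1 = (\<lambda>w::real \<times> real. (bump' (fst w / e\<^sup>2) / e\<^sup>2) * bump (snd w / e))"
  define K2 where "K2 = (\<lambda>w::real \<times> real. bump (fst w / e\<^sup>2) * (bump' (snd w / e) / e))"
  have K: "nonneg_test K K1 K2"
    unfolding K_def K1_def K2_def
    using nonneg_test_tensor[OF line_test_bump line_test_bump, of "e\<^sup>2" e] e by simp
  note K' = nonneg_testD[OF K]
  note [measurable] = K'(6,8)
  let ?B1 = "cbox (- (e\<^sup>2/2), - (e/2)) (e\<^sup>2/2, e/2)" and ?B2 = "cbox (- (e\<^sup>2), - e) (e\<^sup>2, e)"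
  note box1 = measure_lborel_symmetric_box[of "e\<^sup>2/2" "e/2"]
  note box2 = measure_lborel_symmetric_box[of "e\<^sup>2" "e"]
  have supp: "w \<in> ?B2" if "K w \<noteq> 0 \<or> K2 w \<noteq> 0" for w
  proof -
    have "bump (fst w / e\<^sup>2) \<noteq> 0" "bump (snd w / e) \<noteq> 0 \<or> bump' (snd w / e) \<noteq> 0"
      using that by (auto simp: K_def K2_def)
    then have "\<bar>fst w / e\<^sup>2\<bar> < 1" "\<bar>snd w / e\<bar> < 1"
      using bump_outside[of "fst w / e\<^sup>2"] bump_outside[of "snd w / e"] by fastforce+
    then have "\<bar>fst w\<bar> < e\<^sup>2" "\<bar>snd w\<bar> < e"
      using e by simp_all
    then show ?thesis by (cases w) (auto simp: cbox_Pair_eq)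
  qed
  have Dw: "D K K2 w \<le> (I / 8) * indicator ?B1 w + (4 * B * e) * indicator ?B2 w" for w
  proof -
    \<comment> \<open>The effect of the anisotropic scaling: the spatial derivative of the kernel
      costs 4 / e, but times differ by at most e^2 on its support, so the product is still of order
      e.\<close>
    have k2: "\<bar>K2 w\<bar> * \<bar>fst w\<bar> \<le> 4 * e * indicator ?B2 w"
    proof (cases "w \<in> ?B2")
      case True
      have "\<bar>K2 w\<bar> \<le> 1 * (4 / e)"
        unfolding K2_def abs_mult abs_divide using e bump_bounds
        by (intro mult_mono) (auto intro!: divide_right_mono)
      moreover have "\<bar>fst w\<bar> \<le> e\<^sup>2"
        using True by (cases w) (auto simp: cbox_Pair_eq)
      ultimately have "\<bar>K2 w\<bar> * \<bar>fst w\<bar> \<le> (1 * (4 / e)) * e\<^sup>2"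
        using e by (intro mult_mono) auto
      then show ?thesis using True e by (simp add: power2_eq_square)
    next
      case False
      then have "K2 w = 0" using supp[of w] by blast
      then show ?thesis using False by simp
    qed
    have "norm w < d" if "K w \<noteq> 0"
    proof -
      have w: "\<bar>fst w\<bar> \<le> e\<^sup>2" "\<bar>snd w\<bar> \<le> e"
        using supp[of w] that by (cases w, auto simp: cbox_Pair_eq)+
      have "e\<^sup>2 \<le> e" using e by (simp add: power2_eq_square mult_le_one)
      moreover have "norm w \<le> \<bar>fst w\<bar> + \<bar>snd w\<bar>"
        using norm_Pair_le[of "fst w" "snd w"] by simp
      ultimately show ?thesis using w e d by linarith
    qed
    from D_le[of K w K2, OF K'(5) this]
    have "D K K2 w \<le> K w * (I / 2) + B * (\<bar>K2 w\<bar> * \<bar>fst w\<bar>)" .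
    \<comment> \<open>As \<open>I\<close> is negative, a lower bound on \<open>K\<close> is wanted:
      on the box of half size each bump factor is at least 1/2.\<close>
    also have "K w * (I / 2) \<le> (1/4 * indicator ?B1 w) * (I / 2)"
    proof (rule mult_right_mono_neg)
      show "1/4 * indicator ?B1 w \<le> K w"
      proof (cases "w \<in> ?B1")
        case True
        then have "\<bar>fst w / e\<^sup>2\<bar> \<le> 1/2" "\<bar>snd w / e\<bar> \<le> 1/2"
          using e by (cases w, auto simp: cbox_Pair_eq abs_le_iff field_simps)+
        then have "(1/2) * (1/2) \<le> K w"
          unfolding K_def by (intro mult_mono bump_ge) (auto simp: bump_bounds)
        then show ?thesis using True by simp
      qed (simp add: K'(5))
    qed (use I in simp)
    also have "B * (\<bar>K2 w\<bar> * \<bar>fst w\<bar>) \<le> B * (4 * e * indicator ?B2 w)"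
      using k2 B0 by (rule mult_left_mono)
    finally show ?thesis by (simp add: mult_ac)
  qed
  note dbl = doubling[OF U V f K, folded D_def]
  have "0 \<le> (LINT w|lborel. D K K2 w)" by (rule dbl(2))
  also have "\<dots> \<le> (LINT w|lborel. (I / 8) * indicator ?B1 w + (4 * B * e) * indicator ?B2 w)"
    by (intro integral_mono dbl(1) Dw Bochner_Integration.integrable_add integrable_mult_right box1(2) box2(2)) (use e in auto)
  also have "\<dots> = (I / 8) * measure lborel ?B1 + (4 * B * e) * measure lborel ?B2"
    using box1(2) box2(2) e by (subst Bochner_Integration.integral_add) auto
  \<comment> \<open>The small box has area \<open>e^3\<close> and the large one
    \<open>4 * e^3\<close>, so the scale factors out and the missing normalisation of
    \<open>K\<close> is harmless.\<close>
  also have "\<dots> = e^3 * (I / 8 + 16 * B * e)"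
    using box1(1) box2(1) e by (simp add: power2_eq_square power3_eq_cube algebra_simps)
  finally have "0 \<le> I / 8 + 16 * B * e"
    using e by (simp add: zero_le_mult_iff)
  moreover have "16 * B * e \<le> 16 * (B + 1) * (- I / (256 * (B + 1)))"
    using e B0 by (intro mult_mono) auto
  moreover have "16 * (B + 1) * (- I / (256 * (B + 1))) = - I / 16"
    using B0 by (simp add: field_simps)
  ultimately show False using I by linarith
qed

section \<open>Extension of entropy solutions and Galilean invariance\<close>

lemma integral_derivative_compact_support:
  fixes a a' :: "real \<Rightarrow> real"
  assumes d: "\<And>x. (a has_real_derivative a' x) (at x)" and c: "continuous_on UNIV a'"
    and 0: "\<And>x. R < \<bar>x\<bar> \<Longrightarrow> a x = 0 \<and> a' x = 0"
  shows "(LINT x|lborel. indicator {..b} x * a' x) = a b" "(LINT x|lborel. a' x) = 0"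
proof -
  have FTC: "(LINT x|lborel. indicator {l..u} x * a' x) = a u - a l" if "l \<le> u" for l u
    using integral_FTC_Icc_real[of l u a a'] that d c
    by (simp add: continuous_on_eq_continuous_at mult.commute)
  define l where "l = - \<bar>R\<bar> - \<bar>b\<bar> - 1"
  have l: "a x = 0 \<and> a' x = 0" if "x \<le> l" for x
    using 0[of x] that by (auto simp: l_def)
  have "(LINT x|lborel. indicator {..b} x * a' x) = (LINT x|lborel. indicator {l..b} x * a' x)"
    by (rule Bochner_Integration.integral_cong) (auto split: split_indicator dest: l[OF less_imp_le] simp: not_le)
  also have "\<dots> = a b" using FTC[of l b] l[of l] by (simp add: l_def)
  finally show "(LINT x|lborel. indicator {..b} x * a' x) = a b" .
  have "(LINT x|lborel. a' x) = (LINT x|lborel. indicator {l..-l} x * a' x)"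
  proof (rule Bochner_Integration.integral_cong)
    fix x show "a' x = indicator {l..-l} x * a' x"
      using 0[of x] by (auto simp: l_def split: split_indicator)
  qed simp
  also have "\<dots> = 0" using FTC[of l "-l"] l[of l] 0[of "-l"] by (simp add: l_def)
  finally show "(LINT x|lborel. a' x) = 0" .
qed

text \<open>The fundamental theorem of calculus on lines, along which a test function has compact
  support. The first identity turns an integral over negative times, where the extended solution
  does not depend on time, into the initial term.\<close>

lemma nonneg_test_sections:
  assumes f: "nonneg_test f ft fx"
  shows "(LINT t|lborel. indicator {..0} t * ft (t, x)) = f (0, x)"
    and "(LINT t|lborel. ft (t, x)) = 0" and "(LINT x|lborel. fx (t, x)) = 0"
proof -
  note f' = nonneg_testD[OF f]
  obtain r where r: "\<And>z. z \<notin> cball 0 r \<Longrightarrow> f z = 0 \<and> ft z = 0 \<and> fx z = 0"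
    using f'(9) by blast
  have r1: "f (t, x) = 0 \<and> ft (t, x) = 0" if "r < \<bar>t\<bar>" for t
    using r[of "(t, x)"] norm_fst_le[of t x] that by auto
  have r2: "f (t, x) = 0 \<and> fx (t, x) = 0" if "r < \<bar>x\<bar>" for x
    using r[of "(t, x)"] norm_snd_le[of x t] that by auto
  have c: "continuous_on UNIV (\<lambda>t. g (t, x))" "continuous_on UNIV (\<lambda>x. g (t, x))"
    if "continuous_on UNIV g" for g :: "real \<times> real \<Rightarrow> real"
    by (auto intro!: continuous_on_compose2[OF that] continuous_intros)
  have d1: "((\<lambda>t. f (t, x)) has_real_derivative ft (s, x)) (at s)" for s
  proof -
    have "((\<lambda>t. f (t, x)) has_derivative (\<lambda>h. ft (s, x) * h + fx (s, x) * 0)) (at s)"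
      by (rule has_derivative_eq_rhs[OF has_derivative_compose[OF _ f'(1)]]) (auto intro!: derivative_eq_intros)
    then show ?thesis by (simp add: has_field_derivative_def)
  qed
  have d2: "((\<lambda>x. f (t, x)) has_real_derivative fx (t, y)) (at y)" for y
  proof -
    have "((\<lambda>x. f (t, x)) has_derivative (\<lambda>h. ft (t, y) * 0 + fx (t, y) * h)) (at y)"
      by (rule has_derivative_eq_rhs[OF has_derivative_compose[OF _ f'(1)]]) (auto intro!: derivative_eq_intros)
    then show ?thesis by (simp add: has_field_derivative_def)
  qed
  show "(LINT t|lborel. indicator {..0} t * ft (t, x)) = f (0, x)" "(LINT t|lborel. ft (t, x)) = 0"
    using integral_derivative_compact_support[OF d1 c(1)[OF f'(3)] r1] by auto
  show "(LINT x|lborel. fx (t, x)) = 0"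
    using integral_derivative_compact_support[OF d2 c(2)[OF f'(4)] r2] by auto
qed

lemma sgn_flux_eq_qflux: "sgn (a - k) * (burgers_flux a - burgers_flux k) = qflux a k"
  by (cases a k rule: linorder_cases) (auto simp: burgers_flux_def qflux_def power2_eq_square field_simps)

lemma entropy_solution_alt:
  "entropy_solution u u0 \<longleftrightarrow>
     (\<lambda>z. u (fst z) (snd z)) \<in> borel_measurable borel \<and>
     (\<exists>M. AE z in lborel. 0 < fst z \<longrightarrow> \<bar>u (fst z) (snd z)\<bar> \<le> M) \<and>
     (\<forall>k f ft fx. nonneg_test f ft fx \<longrightarrow>
        0 \<le> (LINT z|lborel. pos_time z * (\<bar>u (fst z) (snd z) - k\<bar> * ft z + qflux (u (fst z) (snd z)) k * fx z))
           + (LINT x|lborel. \<bar>u0 x - k\<bar> * f (0, x)))"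
proof -
  have pos: "indicator {z. 0 < fst z} z = pos_time z" for z
    by (simp add: pos_time_def)
  have "(\<forall>k phi phit phix. test_fun phi phit phix \<and> (\<forall>t x. 0 \<le> phi t x) \<longrightarrow> P k phi phit phix) \<longleftrightarrow>
      (\<forall>k f ft fx. nonneg_test f ft fx \<longrightarrow> P k (\<lambda>t x. f (t, x)) (\<lambda>t x. ft (t, x)) (\<lambda>t x. fx (t, x)))" for P
  proof safe
    fix k phi phit phix
    assume *: "\<forall>k f ft fx. nonneg_test f ft fx \<longrightarrow> P k (\<lambda>t x. f (t, x)) (\<lambda>t x. ft (t, x)) (\<lambda>t x. fx (t, x))"
      and "test_fun phi phit phix" "\<forall>t x. 0 \<le> phi t x"
    then have "nonneg_test (\<lambda>z. phi (fst z) (snd z)) (\<lambda>z. phit (fst z) (snd z)) (\<lambda>z. phix (fst z) (snd z))"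
      by (simp add: nonneg_test_def)
    with * show "P k phi phit phix" by fastforce
  next
    fix k f ft fx
    assume *: "\<forall>k phi phit phix. test_fun phi phit phix \<and> (\<forall>t x. 0 \<le> phi t x) \<longrightarrow> P k phi phit phix"
      and "nonneg_test f ft fx"
    then show "P k (\<lambda>t x. f (t, x)) (\<lambda>t x. ft (t, x)) (\<lambda>t x. fx (t, x))"
      by (simp add: nonneg_test_def)
  qed
  note * = this[of "\<lambda>k phi phit phix. 0 \<le> (LINT z|lborel. pos_time z *
      (\<bar>u (fst z) (snd z) - k\<bar> * phit (fst z) (snd z) + qflux (u (fst z) (snd z)) k * phix (fst z) (snd z)))
      + (LINT x|lborel. \<bar>u0 x - k\<bar> * phi 0 x)"]
  show ?thesis
    unfolding entropy_solution_def set_lebesgue_integral_def sgn_flux_eq_qflux pos real_scaleR_def *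
    by (simp only: measurable_lborel2 measurable_lborel1 prod.collapse)
qed

text \<open>Burgers' equation is invariant under passing to a frame of speed \<open>c\<close> while
  lowering the values by \<open>c\<close>. The Kruzhkov constant becomes \<open>k + c\<close> and
  the test function is pulled back by the inverse shear; \<open>c = 0\<close> is translation by
  \<open>e\<close>.\<close>

lemma entropy_solution_galilei:
  assumes u: "entropy_solution u u0" and u0[measurable]: "u0 \<in> borel_measurable borel"
  shows "entropy_solution (\<lambda>t x. u t (x + (c * t + e)) - c) (\<lambda>x. u0 (x + e) - c)"
  unfolding entropy_solution_alt
proof (intro conjI allI impI)
  let ?T = "\<lambda>z::real \<times> real. (fst z, snd z + (c * fst z + e))"
  have g: "(\<lambda>t. c * t + e) \<in> borel_measurable borel" by measurable
  have T: "?T \<in> borel \<rightarrow>\<^sub>M borel" by (rule measurable_shear[OF g])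
  have um[measurable]: "(\<lambda>z. u (fst z) (snd z)) \<in> borel_measurable borel"
    using u by (simp add: entropy_solution_alt)
  have "(\<lambda>z. u (fst (?T z)) (snd (?T z)) - c) \<in> borel_measurable borel"
    by (intro borel_measurable_diff measurable_compose[OF T um]) auto
  then show "(\<lambda>z. u (fst z) (snd z + (c * fst z + e)) - c) \<in> borel_measurable borel" by simp
  obtain M where M: "AE z in lborel. 0 < fst z \<longrightarrow> \<bar>u (fst z) (snd z)\<bar> \<le> M"
    using u by (auto simp: entropy_solution_alt)
  have "AE z in lborel. 0 < fst z \<longrightarrow> \<bar>u (fst z) (snd z + (c * fst z + e)) - c\<bar> \<le> M + \<bar>c\<bar>"
    using AE_shear[OF g M] by (rule eventually_mono) auto
  then show "\<exists>M. AE z in lborel. 0 < fst z \<longrightarrow> \<bar>u (fst z) (snd z + (c * fst z + e)) - c\<bar> \<le> M" ..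
  fix k f ft fx assume f: "nonneg_test f ft fx"
  note f' = nonneg_testD[OF f]
  note [measurable] = f'(6,7,8)
  obtain r where r: "\<And>z. z \<notin> cball 0 r \<Longrightarrow> f z = 0 \<and> ft z = 0 \<and> fx z = 0"
    using f'(9) by blast
  let ?S = "\<lambda>z::real \<times> real. (fst z, snd z - (c * fst z + e))"
  have cS: "continuous_on UNIV (\<lambda>z. h (?S z))" if "continuous_on UNIV h" for h :: "real \<times> real \<Rightarrow> real"
    by (rule continuous_on_compose2[OF that]) (auto intro!: continuous_intros)
  have "nonneg_test (\<lambda>z. f (?S z)) (\<lambda>z. ft (?S z) - c * fx (?S z)) (\<lambda>z. fx (?S z))"
  proof (rule nonneg_testI[where S = "?T ` cball 0 r"])
    fix z
    show "((\<lambda>z. f (?S z)) has_derivative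
        (\<lambda>h. (ft (?S z) - c * fx (?S z)) * fst h + fx (?S z) * snd h)) (at z)"
      by (rule has_derivative_eq_rhs[OF has_derivative_compose[OF _ f'(1)]])
         (auto intro!: derivative_eq_intros simp: algebra_simps)
    assume "z \<notin> ?T ` cball 0 r"
    then have "?S z \<notin> cball 0 r" by (cases z) (force simp: image_iff)
    then show "f (?S z) = 0" using r by blast
  next
    show "bounded (?T ` cball 0 r)"
      by (intro compact_imp_bounded compact_continuous_image) (auto intro!: continuous_intros)
  qed (use f' in \<open>auto intro!: continuous_intros cS\<close>)
  with u have "0 \<le> (LINT z|lborel. pos_time z * (\<bar>u (fst z) (snd z) - (k + c)\<bar> * (ft (?S z) - c * fx (?S z))
        + qflux (u (fst z) (snd z)) (k + c) * fx (?S z)))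
      + (LINT x|lborel. \<bar>u0 x - (k + c)\<bar> * f (?S (0, x)))"
    unfolding entropy_solution_alt by blast
  also have "(LINT z|lborel. pos_time z * (\<bar>u (fst z) (snd z) - (k + c)\<bar> * (ft (?S z) - c * fx (?S z))
        + qflux (u (fst z) (snd z)) (k + c) * fx (?S z)))
    = (LINT z|lborel. pos_time z * (\<bar>u (fst z) (snd z + (c * fst z + e)) - c - k\<bar> * ft z
        + qflux (u (fst z) (snd z + (c * fst z + e)) - c) k * fx z))" (is "?L = ?R")
  proof -
    have Sm[measurable]: "?S \<in> borel \<rightarrow>\<^sub>M borel"
      by (intro borel_measurable_Pair) measurable
    have "?L = (LINT z|lborel. pos_time (?T z) * (\<bar>u (fst (?T z)) (snd (?T z)) - (k + c)\<bar> * (ft (?S (?T z)) - c * fx (?S (?T z)))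
        + qflux (u (fst (?T z)) (snd (?T z))) (k + c) * fx (?S (?T z))))"
      by (rule integral_shear[OF g, symmetric]) measurable
    also have "\<dots> = ?R"
    proof (rule Bochner_Integration.integral_cong[OF refl])
      fix z :: "real \<times> real"
      \<comment> \<open>The last term is the transport of the entropy by the moving frame; it
        matches the \<open>- c * fx\<close> in the time derivative of the pulled back test
        function.\<close>
      have q: "qflux (a - c) k = qflux a (k + c) - c * \<bar>a - (k + c)\<bar>" for a
        by (simp add: qflux_def field_simps)
      show "pos_time (?T z) * (\<bar>u (fst (?T z)) (snd (?T z)) - (k + c)\<bar> * (ft (?S (?T z)) - c * fx (?S (?T z)))
        + qflux (u (fst (?T z)) (snd (?T z))) (k + c) * fx (?S (?T z)))
        = pos_time z * (\<bar>u (fst z) (snd z + (c * fst z + e)) - c - k\<bar> * ft z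
        + qflux (u (fst z) (snd z + (c * fst z + e)) - c) k * fx z)"
        unfolding q by (simp add: pos_time_def algebra_simps)
    qed
    finally show ?thesis .
  qed
  also have "(LINT x|lborel. \<bar>u0 x - (k + c)\<bar> * f (?S (0, x))) = (LINT x|lborel. \<bar>u0 (x + e) - c - k\<bar> * f (0, x))"
  proof -
    have [measurable]: "(\<lambda>x. f (?S (0, x))) \<in> borel_measurable borel"
      by (intro measurable_compose[OF _ f'(6)] borel_measurable_Pair) auto
    have "(LINT x|lborel. \<bar>u0 x - (k + c)\<bar> * f (?S (0, x)))
        = (LINT x|lborel. \<bar>u0 (x + e) - (k + c)\<bar> * f (?S (0, x + e)))"
      by (rule lborel_integral_translate[symmetric]) measurable
    then show ?thesis by (simp add: algebra_simps)
  qed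
  finally show "0 \<le> (LINT z|lborel. pos_time z * (\<bar>u (fst z) (snd z + (c * fst z + e)) - c - k\<bar> * ft z
        + qflux (u (fst z) (snd z + (c * fst z + e)) - c) k * fx z))
      + (LINT x|lborel. \<bar>u0 (x + e) - c - k\<bar> * f (0, x))" .
qed

lemma entropy_solution_extend:
  assumes u: "entropy_solution u u0" and u0[measurable]: "u0 \<in> borel_measurable borel"
    and b0: "AE x in lborel. \<bar>u0 x\<bar> \<le> M0"
  obtains U where "entropy_ext U"
    "AE z in lborel. 0 < fst z \<longrightarrow> U z = u (fst z) (snd z)"
    "AE z in lborel. fst z \<le> 0 \<longrightarrow> U z = u0 (snd z)"
proof -
  have um[measurable]: "(\<lambda>z. u (fst z) (snd z)) \<in> borel_measurable borel"
    using u by (simp add: entropy_solution_alt)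
  obtain M1 where b1: "AE z in lborel. 0 < fst z \<longrightarrow> \<bar>u (fst z) (snd z)\<bar> \<le> M1"
    using u by (auto simp: entropy_solution_alt)
  define M where "M = \<bar>M0\<bar> + \<bar>M1\<bar>"
  \<comment> \<open>The bounds on the solution and its datum hold almost everywhere, while
    \<open>entropy_ext\<close> asks for one valid everywhere; clamping alters values only on null
    sets.\<close>
  define cl where "cl y = max (- M) (min M y)" for y
  have clm[measurable]: "cl \<in> borel_measurable borel" unfolding cl_def by measurable
  have clb: "\<bar>cl y\<bar> \<le> M" for y unfolding cl_def M_def by linarith
  have cl_eq: "cl y = y" if "\<bar>y\<bar> \<le> M" for y using that by (auto simp: cl_def)
  define U where "U z = cl (if 0 < fst z then u (fst z) (snd z) else u0 (snd z))" for z
  have Um[measurable]: "U \<in> borel_measurable borel" unfolding U_def by measurable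
  have bU: "bdd_fun U" by (rule bdd_funI[where C = M]) (simp add: U_def clb)
  have U1: "AE z in lborel. 0 < fst z \<longrightarrow> U z = u (fst z) (snd z)"
    using b1 by (rule eventually_mono) (auto simp: U_def M_def intro!: cl_eq)
  have cl0: "AE x in lborel. cl (u0 x) = u0 x"
    using b0 by (rule eventually_mono) (auto simp: M_def intro!: cl_eq)
  have U2: "AE z in lborel. fst z \<le> 0 \<longrightarrow> U z = u0 (snd z)"
    using AE_snd[OF cl0] by (rule eventually_mono) (auto simp: U_def)
  have "entropy_ext U"
    unfolding entropy_ext_def
  proof (intro conjI allI impI)
    show "U \<in> borel_measurable borel" by (rule Um)
    show "\<exists>M. \<forall>z. \<bar>U z\<bar> \<le> M" using bU by (simp add: bdd_fun_def)
    fix k f ft fx assume f: "nonneg_test f ft fx"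
    note f' = nonneg_testD[OF f]
    note [measurable] = f'(6,7,8)
    obtain r where r: "\<And>z. z \<notin> cball 0 r \<Longrightarrow> f z = 0 \<and> ft z = 0 \<and> fx z = 0"
      using f'(9) by blast
    note b = bdd_fun_intros bdd_fun_comp[OF bU] f'(10,11,12) bdd_fun_pos_time
    let ?P = "\<lambda>z. pos_time z * (\<bar>U z - k\<bar> * ft z + qflux (U z) k * fx z)"
    let ?N = "\<lambda>z. (1 - pos_time z) * (\<bar>U z - k\<bar> * ft z)"
    have iP: "integrable lborel ?P"
      by (rule integrable_bdd_fun[OF _ _ bounded_cball[of 0 r]]) (measurable, intro b, use r in auto)
    have iN: "integrable lborel ?N"
      by (rule integrable_bdd_fun[OF _ _ bounded_cball[of 0 r]]) (measurable, intro b, use r in auto)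
    have "0 \<le> (LINT z|lborel. pos_time z * (\<bar>u (fst z) (snd z) - k\<bar> * ft z + qflux (u (fst z) (snd z)) k * fx z))
           + (LINT x|lborel. \<bar>u0 x - k\<bar> * f (0, x))"
      using u f unfolding entropy_solution_alt by blast
    also have "(LINT z|lborel. pos_time z * (\<bar>u (fst z) (snd z) - k\<bar> * ft z + qflux (u (fst z) (snd z)) k * fx z))
      = (LINT z|lborel. ?P z)"
    proof (rule integral_cong_AE)
      show "AE z in lborel. pos_time z * (\<bar>u (fst z) (snd z) - k\<bar> * ft z + qflux (u (fst z) (snd z)) k * fx z) = ?P z"
        using U1 by (rule eventually_mono) (auto simp: pos_time_def)
    qed measurable
    also have "(LINT x|lborel. \<bar>u0 x - k\<bar> * f (0, x)) = (LINT x|lborel. \<bar>cl (u0 x) - k\<bar> * f (0, x))"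
    proof (rule integral_cong_AE)
      show "AE x in lborel. \<bar>u0 x - k\<bar> * f (0, x) = \<bar>cl (u0 x) - k\<bar> * f (0, x)"
        using cl0 by (rule eventually_mono) auto
    qed measurable
    also have "\<dots> = (LINT x|lborel. LINT t|lborel. ?N (t, x))"
    proof (rule Bochner_Integration.integral_cong[OF refl])
      fix x
      have "(LINT t|lborel. ?N (t, x)) = (LINT t|lborel. \<bar>cl (u0 x) - k\<bar> * (indicator {..0} t * ft (t, x)))"
        by (rule Bochner_Integration.integral_cong) (auto simp: pos_time_def U_def split: split_indicator)
      also have "\<dots> = \<bar>cl (u0 x) - k\<bar> * f (0, x)"
        by (simp add: nonneg_test_sections(1)[OF f])
      finally show "\<bar>cl (u0 x) - k\<bar> * f (0, x) = (LINT t|lborel. ?N (t, x))" ..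
    qed
    also have "\<dots> = (LINT z|lborel. ?N z)"
      by (rule integral_lborel_prod(2)[OF iN, symmetric])
    also have "(LINT z|lborel. ?P z) + (LINT z|lborel. ?N z) = (LINT z|lborel. ?P z + ?N z)"
      using iP iN by simp
    also have "\<dots> = (LINT z|lborel. \<bar>U z - k\<bar> * ft z + pos_time z * qflux (U z) k * fx z)"
      by (simp add: algebra_simps)
    finally show "0 \<le> (LINT z|lborel. \<bar>U z - k\<bar> * ft z + pos_time z * qflux (U z) k * fx z)" .
  qed
  then show thesis using U1 U2 that by blast
qed

text \<open>The Kruzhkov constants \<open>M\<close> and \<open>- M\<close>, with \<open>M\<close> a
  bound of \<open>U\<close>, resolve the absolute value with either sign. As constants integrate to
  zero against \<open>ft\<close> and the switched \<open>fx\<close>, the two entropy inequalities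
  are opposite halves of the weak equation.\<close>

lemma entropy_ext_weak:
  assumes U: "entropy_ext U" and f: "nonneg_test f ft fx"
  shows "(LINT z|lborel. U z * ft z + pos_time z * ((U z)\<^sup>2 / 2) * fx z) = 0"
proof -
  note f' = nonneg_testD[OF f]
  have Um[measurable]: "U \<in> borel_measurable borel" and bU: "bdd_fun U"
    using U by (auto simp: entropy_ext_def bdd_fun_def)
  obtain M where M: "\<And>z. \<bar>U z\<bar> \<le> M" using bU by (auto simp: bdd_fun_def)
  note [measurable] = f'(6,7,8)
  obtain r where r: "\<And>z. z \<notin> cball 0 r \<Longrightarrow> f z = 0 \<and> ft z = 0 \<and> fx z = 0"
    using f'(9) by blast
  note b = bdd_fun_intros bdd_fun_comp[OF bU] f'(10,11,12) bdd_fun_pos_time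
  let ?W = "\<lambda>z. U z * ft z + pos_time z * ((U z)\<^sup>2 * (1/2)) * fx z"
  let ?C = "\<lambda>z. M * ft z + pos_time z * (M\<^sup>2 / 2) * fx z"
  have iW: "integrable lborel ?W"
    by (rule integrable_bdd_fun[OF _ _ bounded_cball[of 0 r]]) (measurable, intro b, use r in auto)
  have i1: "integrable lborel (\<lambda>z. M * ft z)"
    by (rule integrable_bdd_fun[OF _ _ bounded_cball[of 0 r]]) (measurable, intro b, use r in auto)
  have i2: "integrable lborel (\<lambda>z. pos_time z * (M\<^sup>2 / 2) * fx z)"
    by (rule integrable_bdd_fun[OF _ _ bounded_cball[of 0 r]]) (measurable, intro b, use r in auto)
  have "(LINT t|lborel. LINT x|lborel. pos_time (t, x) * (M\<^sup>2 / 2) * fx (t, x)) = 0"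
  proof -
    have "(LINT x|lborel. pos_time (t, x) * (M\<^sup>2 / 2) * fx (t, x)) = 0" for t
      using nonneg_test_sections(3)[OF f, of t] by (simp add: pos_time_def)
    then show ?thesis by simp
  qed
  then have z2: "(LINT z|lborel. pos_time z * (M\<^sup>2 / 2) * fx z) = 0"
    by (rule trans[OF integral_lborel_prod(1)[OF i2]])
  have z1: "(LINT z|lborel. M * ft z) = 0"
    by (rule trans[OF integral_lborel_prod(2)[OF i1]]) (simp add: nonneg_test_sections(2)[OF f])
  have C0: "(LINT z|lborel. ?C z) = 0"
    by (simp only: Bochner_Integration.integral_add[OF i1 i2] z1 z2)
  have iC: "integrable lborel ?C" using i1 i2 by simp
  have "0 \<le> (LINT z|lborel. \<bar>U z - M\<bar> * ft z + pos_time z * qflux (U z) M * fx z)"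
    using U f unfolding entropy_ext_def by blast
  also have "\<dots> = (LINT z|lborel. ?C z - ?W z)"
  proof (rule Bochner_Integration.integral_cong[OF refl])
    fix z
    have a: "\<bar>U z - M\<bar> = M - U z" using M[of z] by auto
    show "\<bar>U z - M\<bar> * ft z + pos_time z * qflux (U z) M * fx z = ?C z - ?W z"
      unfolding qflux_def a by (simp add: power2_eq_square field_simps)
  qed
  also have "\<dots> = - (LINT z|lborel. ?W z)"
    using iW iC C0 by simp
  finally have 1: "(LINT z|lborel. ?W z) \<le> 0" by simp
  have "0 \<le> (LINT z|lborel. \<bar>U z - (- M)\<bar> * ft z + pos_time z * qflux (U z) (- M) * fx z)"
    using U f unfolding entropy_ext_def by blast
  also have "\<dots> = (LINT z|lborel. (M * ft z - pos_time z * (M\<^sup>2 / 2) * fx z) + ?W z)"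
  proof (rule Bochner_Integration.integral_cong[OF refl])
    fix z
    have a: "\<bar>U z - (- M)\<bar> = M + U z" using M[of z] by auto
    show "\<bar>U z - (- M)\<bar> * ft z + pos_time z * qflux (U z) (- M) * fx z = (M * ft z - pos_time z * (M\<^sup>2 / 2) * fx z) + ?W z"
      unfolding qflux_def a by (simp add: power2_eq_square field_simps)
  qed
  also have "\<dots> = (LINT z|lborel. M * ft z - pos_time z * (M\<^sup>2 / 2) * fx z) + (LINT z|lborel. ?W z)"
    by (rule Bochner_Integration.integral_add[OF Bochner_Integration.integrable_diff[OF i1 i2] iW])
  also have "(LINT z|lborel. M * ft z - pos_time z * (M\<^sup>2 / 2) * fx z) = 0"
    by (simp only: Bochner_Integration.integral_diff[OF i1 i2] z1 z2)
  finally show ?thesis using 1 by simp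
qed

section \<open>Uniqueness and finite speed of propagation\<close>

text \<open>The test function is supported in a backward cone. The shift \<open>fst z + 1\<close> keeps its part in
  negative time inside the strip where the data agree, and the factor \<open>A\<close> is strictly decreasing for
  positive times only.\<close>
theorem entropy_ext_unique:
  assumes U: "entropy_ext U" and V: "entropy_ext V"
    and M: "\<And>z. \<bar>U z\<bar> \<le> L" "\<And>z. \<bar>V z\<bar> \<le> L" and L: "0 < L"
    and eq: "AE z in lborel. fst z \<le> 0 \<and> a < snd z \<and> snd z < b \<longrightarrow> U z = V z"
  shows "AE z in lborel. 0 < fst z \<and> a + L * (fst z + 1) < snd z \<and> snd z < b - L * (fst z + 1) \<longrightarrow> U z = V z"
proof -
  define m :: "real \<Rightarrow> real" where "m s = max 0 s" for s
  define P where "P z = m (snd z - a - L * (fst z + 1))" for z :: "real \<times> real"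
  define Q where "Q z = m (b - snd z - L * (fst z + 1))" for z :: "real \<times> real"
  \<comment> \<open>The exponent 2 places the maximum of (s + 1)^2 exp(-2 s) exactly at s = 0: its
    derivative \<open>A'\<close> carries the factor -2 s and is therefore negative for positive
    times.\<close>
  define A where "A z = (m (fst z + 1))\<^sup>2 * exp (- 2 * fst z)" for z :: "real \<times> real"
  define A' where "A' z = - 2 * fst z * m (fst z + 1) * exp (- 2 * fst z)" for z :: "real \<times> real"
  define f where "f z = A z * (P z)\<^sup>2 * (Q z)\<^sup>2" for z
  define ft where "ft z = A' z * (P z)\<^sup>2 * (Q z)\<^sup>2 + A z * (- 2 * L * P z * (Q z)\<^sup>2 - 2 * L * Q z * (P z)\<^sup>2)" for z
  define fx where "fx z = A z * (2 * P z * (Q z)\<^sup>2 - 2 * Q z * (P z)\<^sup>2)" for z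
  \<comment> \<open>Both cone factors are positive only while 2 L (fst z + 1) < b - a, which bounds
    the time.\<close>
  define S where "S = {-1..(b - a) / (2 * L)} \<times> {a..b}"
  have m0: "m s \<ge> 0" for s by (simp add: m_def)
  have P0: "P z \<ge> 0" and Q0: "Q z \<ge> 0" and A0: "A z \<ge> 0" for z
    by (simp_all add: P_def Q_def A_def m0)
  have outS: "P z * Q z = 0 \<or> m (fst z + 1) = 0" if "z \<notin> S" for z
  proof (rule ccontr)
    assume *: "\<not> ?thesis"
    then have 1: "fst z + 1 > 0" "snd z - a - L * (fst z + 1) > 0" "b - snd z - L * (fst z + 1) > 0"
      by (auto simp: P_def Q_def m_def max_def split: if_splits)
    have 2: "L * (fst z + 1) > 0" using 1 L by simp
    have "2 * (L * fst z) < b - a" using 1 2 L by (simp add: algebra_simps)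
    then have "fst z < (b - a) / (2 * L)" using L by (simp add: field_simps)
    with 1 2 have "z \<in> S" unfolding S_def by (cases z) auto
    with that show False by simp
  qed
  have out: "f z = 0 \<and> ft z = 0 \<and> fx z = 0 \<and> A' z * (P z)\<^sup>2 * (Q z)\<^sup>2 = 0"
    if "P z * Q z = 0 \<or> m (fst z + 1) = 0" for z
    using that by (auto simp: f_def ft_def fx_def A_def A'_def)
  have bS: "bounded S" unfolding S_def by (intro bounded_Times) auto
  have cA': "continuous_on UNIV (\<lambda>z. A' z * (P z)\<^sup>2 * (Q z)\<^sup>2)"
    unfolding A'_def P_def Q_def m_def by (intro continuous_intros)
  have test: "nonneg_test f ft fx"
  proof (rule nonneg_testI[OF _ _ _ bS])
    fix z :: "real \<times> real"
    have msq: "((\<lambda>z. (m (g z))\<^sup>2) has_derivative (\<lambda>h. 2 * m (g z) * g' h)) (at z)"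
      if "(g has_derivative g') (at z)" for g g' :: "real \<times> real \<Rightarrow> real"
      using has_derivative_compose[OF that has_real_derivative_max0_sq[unfolded has_field_derivative_def]]
      by (simp add: m_def)
    have dP: "((\<lambda>z. (P z)\<^sup>2) has_derivative (\<lambda>h. 2 * P z * (snd h - L * fst h))) (at z)"
      unfolding P_def by (rule msq) (auto intro!: derivative_eq_intros)
    have dQ: "((\<lambda>z. (Q z)\<^sup>2) has_derivative (\<lambda>h. 2 * Q z * (- snd h - L * fst h))) (at z)"
      unfolding Q_def by (rule msq) (auto intro!: derivative_eq_intros)
    have d1: "((\<lambda>z. (m (fst z + 1))\<^sup>2) has_derivative (\<lambda>h. 2 * m (fst z + 1) * fst h)) (at z)"
      by (rule msq) (auto intro!: derivative_eq_intros)
    have d2: "((\<lambda>z::real\<times>real. exp (- 2 * fst z)) has_derivative (\<lambda>h. exp (- 2 * fst z) * (- 2 * fst h))) (at z)"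
      by (auto intro!: derivative_eq_intros)
    have "(m (fst z + 1))\<^sup>2 = (fst z + 1) * m (fst z + 1)"
      by (simp add: m_def max_def power2_eq_square)
    then have dA: "(A has_derivative (\<lambda>h. A' z * fst h)) (at z)"
      unfolding A_def by (intro has_derivative_eq_rhs[OF has_derivative_mult[OF d1 d2]])
        (auto simp: A'_def algebra_simps)
    show "(f has_derivative (\<lambda>h. ft z * fst h + fx z * snd h)) (at z)"
      unfolding f_def
      by (rule has_derivative_eq_rhs[OF has_derivative_mult[OF has_derivative_mult[OF dA dP] dQ]])
         (auto simp: ft_def fx_def algebra_simps)
    show "0 \<le> f z" by (simp add: f_def A0)
    assume "z \<notin> S" then show "f z = 0" using out outS by blast
  next
    show "continuous_on UNIV ft" "continuous_on UNIV fx"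
      unfolding ft_def fx_def A_def A'_def P_def Q_def m_def by (intro continuous_intros)+
  qed
  note f' = nonneg_testD[OF test]
  have Um[measurable]: "U \<in> borel_measurable borel" and bU: "bdd_fun U"
    and Vm[measurable]: "V \<in> borel_measurable borel" and bV: "bdd_fun V"
    using U V by (auto simp: entropy_ext_def bdd_fun_def)
  note [measurable] = f'(6,7,8) borel_measurable_continuous_onI[OF cA']
  obtain C where "\<And>z. \<bar>A' z * (P z)\<^sup>2 * (Q z)\<^sup>2\<bar> \<le> C"
    using continuous_support_bounded[OF cA' bS] out outS by metis
  then have bA': "bdd_fun (\<lambda>z. A' z * (P z)\<^sup>2 * (Q z)\<^sup>2)" by (rule bdd_funI)
  note b = bdd_fun_intros bdd_fun_comp[OF bU] bdd_fun_comp[OF bV] f'(10,11,12) bdd_fun_pos_time bA'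
  let ?k = "\<lambda>z. \<bar>U z - V z\<bar> * ft z + pos_time z * qflux (U z) (V z) * fx z"
  let ?g = "\<lambda>z. pos_time z * \<bar>U z - V z\<bar> * (- (A' z * (P z)\<^sup>2 * (Q z)\<^sup>2))"
  have ik: "integrable lborel ?k"
    by (rule integrable_bdd_fun[OF _ _ bS]) (measurable, intro b, use out outS in auto)
  have ig: "integrable lborel ?g"
  proof (rule integrable_bdd_fun[OF _ _ bS])
    show "?g z = 0" if "z \<notin> S" for z using out[OF outS[OF that]] by simp
  qed (measurable, intro b)
  have g0: "0 \<le> ?g z" for z
    using m0[of "fst z + 1"] by (auto simp: pos_time_def A'_def intro!: mult_nonneg_nonneg)
  \<comment> \<open>For positive times the flux, at most \<open>L\<close> times the entropy, is
    absorbed by the slope \<open>L\<close> of the cone sides, leaving the decay of \<open>A\<close>,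
    which is \<open>?g\<close>. At other times the test function vanishes or the data agree.\<close>
  have le: "AE z in lborel. ?k z \<le> - ?g z"
    using eq
  proof (rule eventually_mono)
    fix z :: "real \<times> real"
    assume e: "fst z \<le> 0 \<and> a < snd z \<and> snd z < b \<longrightarrow> U z = V z"
    show "?k z \<le> - ?g z"
    proof (cases "0 < fst z")
      case True
      have "qflux (U z) (V z) * fx z \<le> \<bar>qflux (U z) (V z)\<bar> * \<bar>fx z\<bar>"
        by (simp flip: abs_mult)
      also have "\<dots> \<le> (L * \<bar>U z - V z\<bar>) * (A z * (2 * P z * (Q z)\<^sup>2 + 2 * Q z * (P z)\<^sup>2))"
      proof (intro mult_mono qflux_bound M)
        have "\<bar>fx z\<bar> = A z * \<bar>2 * P z * (Q z)\<^sup>2 - 2 * Q z * (P z)\<^sup>2\<bar>"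
          by (simp add: fx_def abs_mult A0)
        also have "\<dots> \<le> A z * (2 * P z * (Q z)\<^sup>2 + 2 * Q z * (P z)\<^sup>2)"
        proof (rule mult_left_mono[OF _ A0])
          have "0 \<le> P z * (Q z)\<^sup>2" "0 \<le> Q z * (P z)\<^sup>2" using P0 Q0 by simp_all
          then show "\<bar>2 * P z * (Q z)\<^sup>2 - 2 * Q z * (P z)\<^sup>2\<bar> \<le> 2 * P z * (Q z)\<^sup>2 + 2 * Q z * (P z)\<^sup>2"
            by linarith
        qed
        finally show "\<bar>fx z\<bar> \<le> A z * (2 * P z * (Q z)\<^sup>2 + 2 * Q z * (P z)\<^sup>2)" .
      qed (use L in auto)
      finally show ?thesis using True by (simp add: pos_time_def ft_def algebra_simps)
    next
      case False
      show ?thesis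
      proof (cases "P z * Q z = 0 \<or> m (fst z + 1) = 0")
        case True
        then show ?thesis using out[OF True] False by (simp add: pos_time_def)
      next
        case nz: False
        then have 1: "fst z + 1 > 0" "snd z - a - L * (fst z + 1) > 0" "b - snd z - L * (fst z + 1) > 0"
          by (auto simp: P_def Q_def m_def max_def split: if_splits)
        have 2: "L * (fst z + 1) > 0" using 1 L by simp
        have "a < snd z" "snd z < b" using 1 2 by linarith+
        then have "U z = V z" using e False by simp
        then show ?thesis using False by (simp add: pos_time_def)
      qed
    qed
  qed
  have "0 \<le> (LINT z|lborel. ?k z)" by (rule kato_inequality[OF U V test])
  also have "\<dots> \<le> (LINT z|lborel. - ?g z)"
    by (rule integral_mono_AE[OF ik _ le]) (use ig in simp)
  also have "\<dots> = - (LINT z|lborel. ?g z)" by (rule Bochner_Integration.integral_minus)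
  finally have "(LINT z|lborel. ?g z) \<le> 0" by simp
  moreover have "0 \<le> (LINT z|lborel. ?g z)" by (rule Bochner_Integration.integral_nonneg[OF g0])
  ultimately have "AE z in lborel. ?g z = 0"
    using integral_nonneg_eq_0_iff_AE[OF ig AE_I2[OF g0]] by simp
  then show ?thesis
  proof (rule eventually_mono, intro impI)
    fix z :: "real \<times> real"
    assume g: "?g z = 0" and z: "0 < fst z \<and> a + L * (fst z + 1) < snd z \<and> snd z < b - L * (fst z + 1)"
    have "P z > 0" "Q z > 0" "A' z \<noteq> 0" "pos_time z \<noteq> 0"
      using z by (auto simp: P_def Q_def A'_def m_def max_def pos_time_def)
    with g show "U z = V z" by simp
  qed
qed

text \<open>A common bound of both extensions serves as propagation speed; cones over the intervals
  from -n to n exhaust the upper half-plane.\<close>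

corollary entropy_solution_unique:
  assumes u: "entropy_solution u u0" and v: "entropy_solution v v0"
    and m[measurable]: "u0 \<in> borel_measurable borel" "v0 \<in> borel_measurable borel"
    and b: "AE x in lborel. \<bar>u0 x\<bar> \<le> M" and eq: "AE x in lborel. u0 x = v0 x"
  shows "AE z in lborel. 0 < fst z \<longrightarrow> u (fst z) (snd z) = v (fst z) (snd z)"
proof -
  have b': "AE x in lborel. \<bar>v0 x\<bar> \<le> M"
    using b eq by eventually_elim auto
  obtain U where U: "entropy_ext U" "AE z in lborel. 0 < fst z \<longrightarrow> U z = u (fst z) (snd z)"
      "AE z in lborel. fst z \<le> 0 \<longrightarrow> U z = u0 (snd z)"
    by (rule entropy_solution_extend[OF u m(1) b])
  obtain V where V: "entropy_ext V" "AE z in lborel. 0 < fst z \<longrightarrow> V z = v (fst z) (snd z)"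
      "AE z in lborel. fst z \<le> 0 \<longrightarrow> V z = v0 (snd z)"
    by (rule entropy_solution_extend[OF v m(2) b'])
  obtain M1 M2 where M12: "\<And>z. \<bar>U z\<bar> \<le> M1" "\<And>z. \<bar>V z\<bar> \<le> M2"
    using U(1) V(1) unfolding entropy_ext_def by blast
  define L where "L = \<bar>M1\<bar> + \<bar>M2\<bar> + 1"
  have L: "\<bar>U z\<bar> \<le> L" "\<bar>V z\<bar> \<le> L" "0 < L" for z
    using M12(1)[of z] M12(2)[of z] unfolding L_def by linarith+
  have UV: "AE z in lborel. fst z \<le> 0 \<longrightarrow> U z = V z"
    using U(3) V(3) AE_snd[OF eq] by eventually_elim auto
  have "AE z in lborel. \<forall>n::nat. 0 < fst z \<and> - real n + L * (fst z + 1) < snd z \<and> snd z < real n - L * (fst z + 1)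
      \<longrightarrow> U z = V z"
    unfolding AE_all_countable
    by (intro allI entropy_ext_unique[OF U(1) V(1) L]) (use UV in \<open>auto elim!: eventually_mono\<close>)
  with U(2) V(2) show ?thesis
  proof eventually_elim
    case (elim z)
    obtain n :: nat where "\<bar>snd z\<bar> + \<bar>L * (fst z + 1)\<bar> < real n"
      using reals_Archimedean2 by blast
    then have "- real n + L * (fst z + 1) < snd z" "snd z < real n - L * (fst z + 1)" by linarith+
    then show ?case using elim by auto
  qed
qed

section \<open>Averages of periodic functions\<close>

lemma antiderivative_exists:
  fixes b :: "real \<Rightarrow> real"
  assumes b: "continuous_on UNIV b"
  obtains B where "\<And>x. (B has_real_derivative b x) (at x)"
proof -
  have "\<exists>F. \<forall>x. - \<infinity> < ereal x \<longrightarrow> ereal x < \<infinity> \<longrightarrow> (F has_vector_derivative b x) (at x)"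
    by (rule einterval_antiderivative) (use b in \<open>auto simp: continuous_on_eq_continuous_at\<close>)
  then show thesis using that by (auto simp: has_real_derivative_iff_has_vector_derivative)
qed

lemma constant_on_interval_outside_support:
  fixes B :: "real \<Rightarrow> real"
  assumes d: "\<And>x. (B has_real_derivative b x) (at x)" and c: "convex S" and 0: "\<And>x. x \<in> S \<Longrightarrow> b x = 0"
    and xy: "x \<in> S" "y \<in> S"
  shows "B x = B y"
proof -
  have "\<exists>c. \<forall>x\<in>S. B x = c"
  proof (rule has_field_derivative_zero_constant[OF c])
    fix x assume "x \<in> S"
    then show "(B has_real_derivative 0) (at x within S)"
      using d[of x] 0[of x] by (auto intro: has_field_derivative_at_within)
  qed
  then show ?thesis using xy by auto
qed

text \<open>The function is the integral of \<open>b\<close> over the window from \<open>x\<close>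
  to \<open>x + T\<close>: full when the window covers the support, zero when it misses it.
  Continuity of \<open>b\<close> gives a C^1 cut-off with known derivative, used in space and in
  time.\<close>

lemma line_test_window:
  fixes b :: "real \<Rightarrow> real"
  assumes b: "continuous_on UNIV b" and b0: "\<And>x. 0 \<le> b x" and supp: "\<And>x. x \<notin> {l<..<u} \<Longrightarrow> b x = 0"
    and T: "0 \<le> T"
  obtains a where "line_test a (\<lambda>x. b (x + T) - b x)"
    "\<And>x. x \<le> l \<Longrightarrow> u \<le> x + T \<Longrightarrow> a x = (LINT y|lborel. b y)"
    "\<And>x. a x \<le> (LINT y|lborel. b y)"
    "\<And>x. u \<le> x \<Longrightarrow> a x = 0" "\<And>x. x + T \<le> l \<Longrightarrow> a x = 0"
proof -
  obtain B where B: "\<And>x. (B has_real_derivative b x) (at x)"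
    using antiderivative_exists[OF b] by blast
  have mono: "B x \<le> B y" if "x \<le> y" for x y
    by (rule DERIV_nonneg_imp_nondecreasing[OF that]) (use B b0 in blast)
  have left: "B x = B l" if "x \<le> l" for x
    by (rule constant_on_interval_outside_support[OF B, of "{..l}"]) (use that supp in auto)
  have right: "B x = B u" if "u \<le> x" for x
    by (rule constant_on_interval_outside_support[OF B, of "{u..}"]) (use that supp in auto)
  define c where "c = min l u - 1" define e where "e = max l u + 1"
  have "(LINT y|lborel. b y) = (LINT y|lborel. b y * indicator {c..e} y)"
  proof (rule Bochner_Integration.integral_cong[OF refl])
    show "b y = b y * indicator {c..e} y" for y
      using supp[of y] by (cases "y \<in> {c..e}") (auto simp: c_def e_def min_def max_def split: if_splits)
  qed
  also have "\<dots> = B e - B c"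
    by (rule integral_FTC_Icc_real) (use B b in \<open>auto simp: c_def e_def continuous_on_eq_continuous_at\<close>)
  finally have I: "(LINT y|lborel. b y) = B u - B l"
    using left[of c] right[of e] by (simp add: c_def e_def)
  have bd: "B l \<le> B x \<and> B x \<le> B u" for x
    using mono[of l x] mono[of x u] left[of x] right[of x] left[of u] mono[of l u] right[of l]
    by (smt (verit) mono)
  have lt: "line_test (\<lambda>x. B (x + T) - B x) (\<lambda>x. b (x + T) - b x)"
    unfolding line_test_def
  proof (intro conjI allI)
    fix x
    show "((\<lambda>x. B (x + T) - B x) has_real_derivative b (x + T) - b x) (at x)"
      by (intro DERIV_diff B) (use B[of "x + T"] in \<open>simp add: DERIV_shift\<close>)
    show "0 \<le> B (x + T) - B x" using mono[of x "x + T"] T by simp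
    show "continuous_on UNIV (\<lambda>x. b (x + T) - b x)"
      by (intro continuous_intros b continuous_on_compose2[OF b]) auto
    have "B (x + T) - B x = 0" if "\<bar>l\<bar> + \<bar>u\<bar> + T < \<bar>x\<bar>" for x
      using that T left[of x] right[of x] left[of "x + T"] right[of "x + T"] by (cases "x < 0") auto
    then show "\<exists>R. \<forall>x. R < \<bar>x\<bar> \<longrightarrow> B (x + T) - B x = 0" by blast
  qed
  show thesis
  proof (rule that[OF lt])
    show "B (x + T) - B x = (LINT y|lborel. b y)" if "x \<le> l" "u \<le> x + T" for x
      using left[OF that(1)] right[OF that(2)] I by simp
    show "B (x + T) - B x \<le> (LINT y|lborel. b y)" for x
      using bd[of x] bd[of "x + T"] I by simp
    show "B (x + T) - B x = 0" if "u \<le> x" for x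
      using right[of x] right[of "x + T"] that T by simp
    show "B (x + T) - B x = 0" if "x + T \<le> l" for x
      using left[of x] left[of "x + T"] that T by simp
  qed
qed

text \<open>Shifting the integration variable by the period carries \<open>k (x + p)\<close> back to
  \<open>k x\<close> and leaves \<open>g\<close> unchanged; the bounded support of \<open>k\<close>
  makes both terms integrable.\<close>

lemma periodic_telescope:
  fixes g k :: "real \<Rightarrow> real"
  assumes g: "g \<in> borel_measurable borel" "bdd_fun g" and per: "AE x in lborel. g (x + p) = g x"
    and k: "k \<in> borel_measurable borel" "bdd_fun k" and supp: "\<And>x. x \<notin> {l..u} \<Longrightarrow> k x = 0"
  shows "(LINT x|lborel. (k (x + p) - k x) * g x) = 0"
proof -
  note [measurable] = g(1) k(1)
  have i1: "integrable lborel (\<lambda>x. k (x + p) * g x)"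
    by (rule integrable_bdd_fun[where S = "{l-p..u-p}"])
       (measurable, intro bdd_fun_intros g bdd_fun_comp[OF k(2)], auto intro: supp)
  have i2: "integrable lborel (\<lambda>x. k x * g x)"
    by (rule integrable_bdd_fun[where S = "{l..u}"])
       (measurable, intro bdd_fun_intros g bdd_fun_comp[OF k(2)], auto intro: supp)
  have "(LINT x|lborel. k (x + p) * g x) = (LINT x|lborel. k (x + p) * g (x + p))"
    by (rule integral_cong_AE) (use per in \<open>auto elim!: eventually_mono\<close>)
  also have "\<dots> = (LINT x|lborel. k x * g x)"
    by (rule lborel_integral_translate[of "\<lambda>x. k x * g x" p]) measurable
  finally show ?thesis
    using i1 i2 by (simp add: left_diff_distrib)
qed

text \<open>The kernel averages over a period exactly, wherever it is placed, which makes the flux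
  through the cut-off explicit. Its derivative annihilates periodic functions, which makes the
  weighted mean of a periodic solution constant in time.\<close>

lemma periodic_averaging_kernel:
  fixes p :: real
  assumes p: "0 < p"
  obtains hat hat' where "line_test hat hat'" "\<And>x. x \<notin> {- 1 - p<..<1} \<Longrightarrow> hat x = 0"
    "(LINT x|lborel. hat x) = 1"
    "\<And>g c. g \<in> borel_measurable borel \<Longrightarrow> bdd_fun g \<Longrightarrow> AE x in lborel. g (x + p) = g x \<Longrightarrow>
       (LINT x|lborel. hat (x + c) * g x) = (LINT x|lborel. indicator {0..p} x * g x) / p"
    "\<And>g. g \<in> borel_measurable borel \<Longrightarrow> bdd_fun g \<Longrightarrow> AE x in lborel. g (x + p) = g x \<Longrightarrow>
       (LINT x|lborel. hat' x * g x) = 0"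
proof -
  have cb: "continuous_on UNIV bump" unfolding bump_def by (intro continuous_intros)
  have b0: "bump x = 0" if "x \<notin> {-1<..<1}" for x
    using bump_outside[of x] that by auto
  \<comment> \<open>The shift 4 exceeds the width 2 of the bump, so \<open>a\<close> has a plateau
    on [-3, -1] before its descent on [-1, 1]; the descent supplies a smooth step.\<close>
  obtain a where a: "line_test a (\<lambda>x. bump (x + 4) - bump x)"
    "\<And>x. x \<le> -1 \<Longrightarrow> 1 \<le> x + 4 \<Longrightarrow> a x = (LINT y|lborel. bump y)"
    "\<And>x. a x \<le> (LINT y|lborel. bump y)"
    "\<And>x. 1 \<le> x \<Longrightarrow> a x = 0"
    by (rule line_test_window[OF cb bump_bounds(1) b0, where T = 4 and l = "-1" and u = 1])
       (assumption, simp, (rule that; assumption))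
  define J where "J = (LINT y|lborel. bump y)"
  have ib: "integrable lborel bump"
    by (rule integrable_bounded_support[where C = 1 and S = "{-1..1}"])
       (use borel_measurable_continuous_onI[OF cb] bump_bounds b0 in auto)
  have J: "0 < J"
  proof -
    have "1/2 = (LINT y|lborel. 1/2 * indicator {-1/2..1/2::real} y :: real)" by simp
    also have "\<dots> \<le> J"
      unfolding J_def
    proof (rule integral_mono)
      show "1/2 * indicator {- 1 / 2..1 / 2} y \<le> bump y" for y
        using bump_ge[of y] bump_bounds(1)[of y] by (auto split: split_indicator)
    qed (use ib in auto)
    finally show ?thesis by simp
  qed
  note da = a(1)[unfolded line_test_def, THEN conjunct1, rule_format]
  text \<open>A smooth Heaviside function: the discrete difference of its translates is the kernel,
    and two such functions differ by a compactly supported one.\<close>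
  define H where "H x = (if x \<le> -1 then 0 else 1 - a x / J)" for x
  define h where "h x = bump x / J" for x
  have dH: "(H has_real_derivative h x) (at x)" for x
  proof (cases "x < -1")
    case True
    have "((\<lambda>x. 0) has_real_derivative h x) (at x)"
      using True b0[of x] by (simp add: h_def)
    then show ?thesis
      by (rule has_field_derivative_transform_within_open[where S = "{..<-1}"]) (use True in \<open>auto simp: H_def\<close>)
  next
    case False
    \<comment> \<open>\<open>a\<close> equals \<open>J\<close> on [-3, -1], so the second branch of
      \<open>H\<close> is valid on all of (-3, infinity) and the change of branch at -1 is an
      interior point.\<close>
    have "((\<lambda>x. 1 - a x / J) has_real_derivative h x) (at x)"
      using J False b0[of "x + 4"] unfolding h_def
      by (auto intro!: derivative_eq_intros da simp: field_simps)
    then show ?thesis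
    proof (rule has_field_derivative_transform_within_open[where S = "{-3<..}"])
      fix y :: real assume "y \<in> {-3<..}"
      then show "1 - a y / J = H y" using a(2)[of y] J by (auto simp: H_def J_def)
    qed (use False in auto)
  qed
  have H1: "H x = 1" if "1 \<le> x" for x using a(4)[OF that] that by (simp add: H_def)
  have H0: "H x = 0" if "x \<le> -1" for x using that by (simp add: H_def)
  have a0: "0 \<le> a x" for x using a(1) by (simp add: line_test_def)
  have Hb: "0 \<le> H x \<and> H x \<le> 1" for x
    using a(3)[of x] a0[of x] J by (auto simp: H_def J_def)
  have Hmono: "H x \<le> H y" if "x \<le> y" for x y
  proof (rule DERIV_nonneg_imp_nondecreasing[OF that])
    fix x show "\<exists>y. (H has_real_derivative y) (at x) \<and> 0 \<le> y"
      using dH[of x] bump_bounds(1)[of x] J by (intro exI[of _ "h x"]) (auto simp: h_def)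
  qed
  have cH: "continuous_on UNIV H"
    by (intro continuous_at_imp_continuous_on ballI DERIV_isCont[OF dH])
  note [measurable] = borel_measurable_continuous_onI[OF cH] borel_measurable_continuous_onI[OF cb]
  have bH: "bdd_fun H" by (rule bdd_funI[where C = 1]) (use Hb in auto)
  have ch: "continuous_on UNIV h" unfolding h_def using J by (intro continuous_intros cb) auto
  have hm[measurable]: "h \<in> borel_measurable borel" by (rule borel_measurable_continuous_onI[OF ch])
  have bh: "bdd_fun h" by (rule bdd_funI[where C = "1/J"]) (use J bump_bounds in \<open>auto simp: h_def divide_right_mono\<close>)
  have h0: "h x = 0" if "x \<notin> {-1<..<1}" for x using b0[OF that] by (simp add: h_def)
  define hat where "hat x = (H (x + p) - H x) / p" for x
  define hat' where "hat' x = (h (x + p) - h x) / p" for x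
  have hat_out: "hat x = 0" if "x \<notin> {- 1 - p<..<1}" for x
  proof (cases "x \<ge> 1")
    case True then show ?thesis using p by (simp add: hat_def H1)
  next
    case False then show ?thesis using that p by (simp add: hat_def H0)
  qed
  have lt: "line_test hat hat'"
    unfolding line_test_def
  proof (intro conjI allI)
    fix x
    have "((\<lambda>x. H (x + p)) has_real_derivative h (x + p)) (at x)"
      using dH[of "x + p"] by (simp add: DERIV_shift)
    then show "(hat has_real_derivative hat' x) (at x)"
      unfolding hat_def hat'_def by (intro DERIV_cdivide DERIV_diff dH)
    show "continuous_on UNIV hat'"
      unfolding hat'_def using p
      by (intro continuous_intros ch continuous_on_compose2[OF ch]) auto
    show "0 \<le> hat x" using Hmono[of x "x + p"] p by (simp add: hat_def)
    show "\<exists>R. \<forall>x. R < \<bar>x\<bar> \<longrightarrow> hat x = 0"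
      using p by (intro exI[of _ "1 + p"] allI impI hat_out) auto
  qed
  have hat_av: "(LINT x|lborel. hat (x + c) * g x) = (LINT x|lborel. indicator {0..p} x * g x) / p"
    if g: "g \<in> borel_measurable borel" "bdd_fun g" "AE x in lborel. g (x + p) = g x" for g c
  proof -
    note [measurable] = g(1)
    \<comment> \<open>A sharp step at \<open>p\<close>, whose difference over a period is the
      indicator of (0, p]. \<open>H (x + c) - ?Th x\<close> has bounded support, so telescoping
      equates the smooth average and the sharp one.\<close>
    let ?Th = "\<lambda>x::real. if p < x then 1 else (0::real)"
    let ?k = "\<lambda>x. H (x + c) - ?Th x"
    have tel: "(LINT x|lborel. (?k (x + p) - ?k x) * g x) = 0"
    proof (rule periodic_telescope[OF g])
      show "?k \<in> borel_measurable borel" by measurable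
      show "bdd_fun ?k" by (intro bdd_fun_intros bdd_fun_comp[OF bH] bdd_funI[where C = 1]) auto
      show "?k x = 0" if "x \<notin> {- 1 - \<bar>c\<bar>..1 + p + \<bar>c\<bar>}" for x
        using that p H1[of "x + c"] H0[of "x + c"] by (auto simp: not_le)
    qed
    have ae: "AE x in lborel. (?k (x + p) - ?k x) * g x = p * (hat (x + c) * g x) - indicator {0..p} x * g x"
      using AE_lborel_singleton[of 0]
    proof (rule eventually_mono)
      fix x :: real assume "x \<noteq> 0"
      then have "?Th (x + p) - ?Th x = indicator {0..p} x"
        using p by (auto split: split_indicator)
      moreover have ph: "p * hat (x + c) = H (x + c + p) - H (x + c)"
        using p by (simp add: hat_def)
      ultimately have eq: "?k (x + p) - ?k x = p * hat (x + c) - indicator {0..p} x"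
        using ph by (simp add: algebra_simps)
      show "(?k (x + p) - ?k x) * g x = p * (hat (x + c) * g x) - indicator {0..p} x * g x"
        unfolding eq by (simp add: algebra_simps)
    qed
    have hatm[measurable]: "hat \<in> borel_measurable borel" unfolding hat_def by measurable
    have "(LINT x|lborel. (?k (x + p) - ?k x) * g x) = (LINT x|lborel. p * (hat (x + c) * g x) - indicator {0..p} x * g x)"
      by (rule integral_cong_AE[OF _ _ ae]) measurable
    then have "(LINT x|lborel. p * (hat (x + c) * g x) - indicator {0..p} x * g x) = 0"
      using tel by simp
    moreover have "integrable lborel (\<lambda>x. hat (x + c) * g x)"
    proof (rule integrable_bdd_fun[where S = "{- 1 - p - c..1 - c}"])
      have "bdd_fun (\<lambda>x. (H (x + p) - H x) * inverse p)"
        by (intro bdd_fun_intros bH bdd_fun_comp[OF bH])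
      then have "bdd_fun hat" by (simp add: hat_def[abs_def] divide_inverse)
      from bdd_fun_comp[OF this] show "bdd_fun (\<lambda>x. hat (x + c) * g x)" by (intro bdd_fun_mult g)
      show "hat (x + c) * g x = 0" if "x \<notin> {- 1 - p - c..1 - c}" for x
        using hat_out[of "x + c"] that by auto
    qed simp_all
    moreover have "integrable lborel (\<lambda>x. indicator {0..p} x * g x)"
      by (rule integrable_bdd_fun[where S = "{0..p}"])
         (measurable, intro bdd_fun_intros g bdd_funI[where C = 1], auto split: split_indicator)
    ultimately show ?thesis using p by (simp add: field_simps)
  qed
  have one: "(LINT x|lborel. hat x) = 1"
    using hat_av[of "\<lambda>_. 1" 0] p by (simp add: bdd_fun_const)
  have "(LINT x|lborel. hat' x * g x) = 0"
    if g: "g \<in> borel_measurable borel" "bdd_fun g" "AE x in lborel. g (x + p) = g x" for g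
  proof -
    have "h x = 0" if "x \<notin> {-1..1}" for x using h0[of x] that by auto
    from periodic_telescope[OF g hm bh this] show ?thesis by (simp add: hat'_def)
  qed
  then show thesis
    using that[OF lt hat_out one hat_av] by blast
qed

text \<open>\<open>g\<close> plays ur and \<open>g (x - del) + d\<close> plays ul, with
  \<open>del\<close> the misalignment at a time slightly off the one where they differ by a
  constant. Right of \<open>X\<close> the mass of u - ul is \<open>- d\<close> times that of the
  cut-off, up to the displacement, which is thrown onto the cut-off.\<close>

lemma mass_beyond_shock:
  fixes g chi chi' :: "real \<Rightarrow> real"
  assumes g[measurable]: "g \<in> borel_measurable borel" and gL: "\<And>x. \<bar>g x\<bar> \<le> L"
    and chi: "line_test chi chi'" "\<And>x. chi x \<le> 1" and one: "\<And>x. \<bar>x\<bar> \<le> E \<Longrightarrow> chi x = 1"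
    and out: "\<And>x. x \<notin> {-R..R} \<Longrightarrow> chi x = 0" and K: "\<And>x. \<bar>chi' x\<bar> \<le> K"
    and X: "\<bar>X\<bar> \<le> E" and del: "\<bar>del\<bar> \<le> 1" and R: "0 \<le> R"
  shows "\<bar>(LINT x|lborel. (if x < X then 0 else g x - (g (x - del) + d)) * chi x)
      + d * ((LINT x|lborel. indicator {0..} x * chi x) - X)\<bar> \<le> L * (2 + K * (2 * R + 2)) * \<bar>del\<bar>"
proof -
  have chi0: "0 \<le> chi x" for x using chi(1) by (simp add: line_test_def)
  have cc: "continuous_on UNIV chi" by (rule line_test_continuous[OF chi(1)])
  note [measurable] = borel_measurable_continuous_onI[OF cc]
  have bchi: "bdd_fun chi" by (rule bdd_funI[where C = 1]) (use chi0 chi(2) in auto)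
  have bg: "bdd_fun g" by (rule bdd_funI[OF gL])
  have bi: "bdd_fun (indicator S :: real \<Rightarrow> real)" for S
    by (rule bdd_funI[where C = 1]) auto
  note b = bdd_fun_intros bchi bg bdd_fun_comp[OF bchi] bdd_fun_comp[OF bg] bi bdd_fun_comp[OF bi]
  define k where "k x = indicator {X..} x * chi x" for x
  have km[measurable]: "k \<in> borel_measurable borel" unfolding k_def by measurable
  have bk: "bdd_fun k" unfolding k_def by (intro b)
  have k0: "k x = 0" if "x \<notin> {-R..R}" for x using out[OF that] by (simp add: k_def)
  have ik: "integrable lborel k"
    by (rule integrable_bdd_fun[OF km bk, where S = "{-R..R}"]) (auto intro: k0)
  have i0: "integrable lborel (\<lambda>x. indicator {0..} x * chi x)"
    by (rule integrable_bdd_fun[where S = "{-R..R}"]) (measurable, intro b, auto intro: out)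
  have i1: "integrable lborel (\<lambda>x. k x * g x)"
    by (rule integrable_bdd_fun[where S = "{-R..R}"]) (measurable, intro b bk, auto intro: k0)
  have i2: "integrable lborel (\<lambda>x. k x * g (x - del))"
    by (rule integrable_bdd_fun[where S = "{-R..R}"]) (measurable, intro b bk, auto intro: k0)
  have i3: "integrable lborel (\<lambda>x. k (x + del) * g x)"
    by (rule integrable_bdd_fun[where S = "{-R-1..R+1}"])
       (measurable, intro b bdd_fun_comp[OF bk], use del in \<open>auto intro!: k0\<close>)
  have kint: "(LINT x|lborel. k x) = (LINT x|lborel. indicator {0..} x * chi x) - X"
  proof -
    have "(LINT x|lborel. indicator {0..} x * chi x) - (LINT x|lborel. k x)
        = (LINT x|lborel. indicator {0..} x * chi x - k x)"
      using i0 ik by simp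
    also have "\<dots> = (LINT x|lborel. indicator {0..<X} x - indicator {X..<0} x)"
    proof (rule Bochner_Integration.integral_cong[OF refl])
      fix x
      show "indicator {0..} x * chi x - k x = indicator {0..<X} x - indicator {X..<0} x"
        using one[of x] X by (auto simp: k_def split: split_indicator)
    qed
    also have "\<dots> = X" by (cases "0 \<le> X") auto
    finally show ?thesis by simp
  qed
  have "(LINT x|lborel. (if x < X then 0 else g x - (g (x - del) + d)) * chi x)
      = (LINT x|lborel. k x * g x - k x * g (x - del) - d * k x)"
    by (rule Bochner_Integration.integral_cong) (auto simp: k_def algebra_simps split: split_indicator)
  also have "\<dots> = (LINT x|lborel. k x * g x) - (LINT x|lborel. k x * g (x - del)) - d * (LINT x|lborel. k x)"
    using i1 i2 ik by simp
  \<comment> \<open>\<open>g\<close> is merely measurable and offers no modulus of continuity; the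
    shift is moved to \<open>k\<close>, which is Lipschitz apart from one jump at
    \<open>X\<close>.\<close>
  also have "(LINT x|lborel. k x * g (x - del)) = (LINT x|lborel. k (x + del) * g x)"
    using lborel_integral_translate[of "\<lambda>x. k x * g (x - del)" del] by simp
  finally have eq: "(LINT x|lborel. (if x < X then 0 else g x - (g (x - del) + d)) * chi x)
      + d * ((LINT x|lborel. indicator {0..} x * chi x) - X)
      = (LINT x|lborel. k x * g x - k (x + del) * g x)"
    using i1 i3 kint by simp
  have K0: "0 \<le> K" using K[of 0] by linarith
  have L0: "0 \<le> L" using gL[of 0] by linarith
  have lip: "\<bar>chi x - chi (x + del)\<bar> \<le> K * \<bar>del\<bar>" for x
  proof -
    have "norm (chi x - chi (x + del)) \<le> K * norm (x - (x + del))"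
      by (rule field_differentiable_bound[of UNIV chi chi'])
         (use chi(1) K in \<open>auto simp: line_test_def\<close>)
    then show ?thesis by simp
  qed
  \<comment> \<open>The jump of \<open>k\<close> is felt on an interval of length
    \<open>2 * \<bar>del\<bar>\<close>, the slope of \<open>chi\<close> on its support enlarged by 1
    on both sides; hence the 2 and the \<open>2 * R + 2\<close> of the bound.\<close>
  let ?I = "\<lambda>x. L * (indicator {X - \<bar>del\<bar>..X + \<bar>del\<bar>} x + K * \<bar>del\<bar> * indicator {-R-1..R+1} x)"
  have ii: "integrable lborel (indicator {a..b} :: real \<Rightarrow> real)" for a b :: real
    by (intro integrable_real_indicator emeasure_bounded_finite) auto
  have pt: "\<bar>k x * g x - k (x + del) * g x\<bar> \<le> ?I x" for x
  proof -
    have "\<bar>k x - k (x + del)\<bar> \<le> indicator {X - \<bar>del\<bar>..X + \<bar>del\<bar>} x + K * \<bar>del\<bar> * indicator {-R-1..R+1} x"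
    proof (cases "x \<in> {-R-1..R+1}")
      case True
      show ?thesis
      proof (cases "x \<in> {X - \<bar>del\<bar>..X + \<bar>del\<bar>}")
        case T: True
        have "0 \<le> k y \<and> k y \<le> 1" for y using chi0[of y] chi(2)[of y] by (auto simp: k_def split: split_indicator)
        then have "\<bar>k x - k (x + del)\<bar> \<le> 1" by (smt (verit))
        then show ?thesis using T K0 by (simp add: add_increasing2)
      next
        case False
        then have "indicator {X..} x = (indicator {X..} (x + del) :: real)"
          by (auto split: split_indicator)
        then have "\<bar>k x - k (x + del)\<bar> \<le> \<bar>chi x - chi (x + del)\<bar>"
          by (simp add: k_def split: split_indicator)
        then show ?thesis using lip[of x] True False by simp
      qed
    next
      case False
      then have "k x = 0" "k (x + del) = 0" using del by (auto intro!: k0)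
      then show ?thesis using K0 by (auto split: split_indicator)
    qed
    then have "\<bar>k x - k (x + del)\<bar> * \<bar>g x\<bar> \<le>
        (indicator {X - \<bar>del\<bar>..X + \<bar>del\<bar>} x + K * \<bar>del\<bar> * indicator {-R-1..R+1} x) * L"
      using gL[of x] by (intro mult_mono) auto
    moreover have "\<bar>k x * g x - k (x + del) * g x\<bar> = \<bar>k x - k (x + del)\<bar> * \<bar>g x\<bar>"
      by (simp flip: abs_mult left_diff_distrib)
    ultimately show ?thesis by (simp add: mult.commute)
  qed
  have "\<bar>LINT x|lborel. k x * g x - k (x + del) * g x\<bar> \<le> (LINT x|lborel. \<bar>k x * g x - k (x + del) * g x\<bar>)"
    using integral_norm_bound[of lborel "\<lambda>x. k x * g x - k (x + del) * g x"] by simp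
  also have "\<dots> \<le> (LINT x|lborel. ?I x)"
    by (rule integral_mono)
       (use i1 i3 pt ii in \<open>auto intro!: integrable_mult_right Bochner_Integration.integrable_add simp del: integrable_mult_right_iff\<close>)
  also have "\<dots> = L * (2 + K * (2 * R + 2)) * \<bar>del\<bar>"
    using R by (simp add: algebra_simps)
  finally show ?thesis unfolding eq .
qed

section \<open>Conservation of mass\<close>

lemma line_testD:
  assumes a: "line_test a a'"
  shows "\<And>x. (a has_real_derivative a' x) (at x)" "continuous_on UNIV a" "continuous_on UNIV a'" "\<And>x. 0 \<le> a x"
    "a \<in> borel_measurable borel" "a' \<in> borel_measurable borel"
    "\<exists>R. \<forall>x. x \<notin> {-R..R} \<longrightarrow> a x = 0 \<and> a' x = 0" "bdd_fun a" "bdd_fun a'"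
proof -
  show d: "\<And>x. (a has_real_derivative a' x) (at x)" and c': "continuous_on UNIV a'" and "\<And>x. 0 \<le> a x"
    using a by (auto simp: line_test_def)
  show c: "continuous_on UNIV a" by (rule line_test_continuous[OF a])
  show "a \<in> borel_measurable borel" "a' \<in> borel_measurable borel"
    using c c' by (auto intro: borel_measurable_continuous_onI)
  obtain R where R: "\<And>x. R < \<bar>x\<bar> \<Longrightarrow> a x = 0" using a by (auto simp: line_test_def)
  have R': "a x = 0 \<and> a' x = 0" if x: "x \<in> - {-R..R}" for x
  proof -
    have "((\<lambda>x. 0) has_real_derivative a' x) (at x)"
      by (rule has_field_derivative_transform_within_open[OF d, where S = "- {-R..R}"]) (use x R in auto)
    then have "a' x = 0" using DERIV_unique[OF _ DERIV_const] by blast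
    with x R show ?thesis by auto
  qed
  then show "\<exists>R. \<forall>x. x \<notin> {-R..R} \<longrightarrow> a x = 0 \<and> a' x = 0" by blast
  have "bdd_fun g" if "continuous_on UNIV g" "\<And>x. x \<notin> {-R..R} \<Longrightarrow> g x = 0" for g
    using continuous_support_bounded[OF that(1) bounded_closed_interval that(2)] bdd_funI by blast
  then show "bdd_fun a" "bdd_fun a'" using c c' R' by auto
qed

lemma integrable_tensor:
  fixes W :: "real \<times> real \<Rightarrow> real" and g k :: "real \<Rightarrow> real"
  assumes W: "W \<in> borel_measurable borel" "bdd_fun W"
    and g: "g \<in> borel_measurable borel" "bdd_fun g" "\<And>x. x \<notin> {-R..R} \<Longrightarrow> g x = 0"
    and k: "k \<in> borel_measurable borel" "bdd_fun k" "\<And>x. x \<notin> {-R'..R'} \<Longrightarrow> k x = 0"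
  shows "integrable lborel (\<lambda>z. W z * (g (fst z) * k (snd z)))"
    and "integrable lborel (\<lambda>t. g t * (LINT x|lborel. W (t, x) * k x))"
    and "(LINT z|lborel. W z * (g (fst z) * k (snd z))) = (LINT t|lborel. g t * (LINT x|lborel. W (t, x) * k x))"
proof -
  note [measurable] = W(1) g(1) k(1)
  show i: "integrable lborel (\<lambda>z. W z * (g (fst z) * k (snd z)))"
  proof (rule integrable_bdd_fun[where S = "{-R..R} \<times> {-R'..R'}"])
    show "bdd_fun (\<lambda>z. W z * (g (fst z) * k (snd z)))"
      by (intro bdd_fun_mult W bdd_fun_comp[OF g(2)] bdd_fun_comp[OF k(2)])
    show "bounded ({-R..R} \<times> {-R'..R'})" by (intro bounded_Times) auto
    fix z assume "z \<notin> {-R..R} \<times> {-R'..R'}"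
    then have "fst z \<notin> {-R..R} \<or> snd z \<notin> {-R'..R'}" by (cases z) auto
    then show "W z * (g (fst z) * k (snd z)) = 0" using g(3) k(3) by auto
  qed measurable
  have "(LINT x|lborel. W (t, x) * (g (fst (t, x)) * k (snd (t, x)))) = g t * (LINT x|lborel. W (t, x) * k x)" for t
  proof -
    have "(LINT x|lborel. W (t, x) * (g (fst (t, x)) * k (snd (t, x)))) = (LINT x|lborel. g t * (W (t, x) * k x))"
      by (simp add: mult_ac)
    then show ?thesis by simp
  qed
  with integral_lborel_prod(1,3)[OF i]
  show "integrable lborel (\<lambda>t. g t * (LINT x|lborel. W (t, x) * k x))"
    "(LINT z|lborel. W z * (g (fst z) * k (snd z))) = (LINT t|lborel. g t * (LINT x|lborel. W (t, x) * k x))"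
    by simp_all
qed

lemma weak_form_tensor:
  assumes U: "entropy_ext U" and a: "line_test a a'" and k: "line_test k k'"
  shows "(LINT t|lborel. a' t * (LINT x|lborel. U (t, x) * k x))
       + (LINT t|lborel. a t * (LINT x|lborel. pos_time (t, x) * ((U (t, x))\<^sup>2 / 2) * k' x)) = 0"
proof -
  note a' = line_testD[OF a] and k' = line_testD[OF k]
  obtain R where R: "\<And>x. x \<notin> {-R..R} \<Longrightarrow> a x = 0 \<and> a' x = 0" using a'(7) by blast
  obtain R' where R': "\<And>x. x \<notin> {-R'..R'} \<Longrightarrow> k x = 0 \<and> k' x = 0" using k'(7) by blast
  have Um[measurable]: "U \<in> borel_measurable borel" and bU: "bdd_fun U"
    using U by (auto simp: entropy_ext_def bdd_fun_def)
  have "bdd_fun (\<lambda>z. pos_time z * ((U z)\<^sup>2 * (1/2)))"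
    by (intro bdd_fun_intros bU bdd_fun_pos_time)
  then have bQ: "bdd_fun (\<lambda>z. pos_time z * ((U z)\<^sup>2 / 2))" by simp
  have Qm: "(\<lambda>z. pos_time z * ((U z)\<^sup>2 / 2)) \<in> borel_measurable borel" by measurable
  note 1 = integrable_tensor[OF Um bU a'(6) a'(9) _ k'(5) k'(8), of R R']
  note 2 = integrable_tensor[OF Qm bQ a'(5) a'(8) _ k'(6) k'(9), of R R']
  have "(LINT z|lborel. U z * (a' (fst z) * k (snd z)) + pos_time z * ((U z)\<^sup>2 / 2) * (a (fst z) * k' (snd z))) = 0"
    using entropy_ext_weak[OF U nonneg_test_tensor[OF a k]] .
  then show ?thesis
    using 1 2 R R' by (subst (asm) Bochner_Integration.integral_add) auto
qed

text \<open>The mass balance of \<open>U - V\<close>: pairing with \<open>a'\<close> is, up to sign,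
  the weak time derivative of the mass weighted by \<open>k\<close>, and the other term is the flux
  through the edges of \<open>k\<close>.\<close>

lemma weak_form_difference:
  assumes U: "entropy_ext U" and V: "entropy_ext V" and a: "line_test a a'" and k: "line_test k k'"
  shows "integrable lborel (\<lambda>t. a' t * (LINT x|lborel. (U (t, x) - V (t, x)) * k x))"
    and "(LINT t|lborel. a' t * (LINT x|lborel. (U (t, x) - V (t, x)) * k x))
       + (LINT t|lborel. a t * (LINT x|lborel. pos_time (t, x) * ((U (t, x))\<^sup>2 / 2 - (V (t, x))\<^sup>2 / 2) * k' x)) = 0"
proof -
  note a' = line_testD[OF a] and k' = line_testD[OF k]
  obtain R where R: "\<And>x. x \<notin> {-R..R} \<Longrightarrow> a x = 0 \<and> a' x = 0" using a'(7) by blast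
  obtain R' where R': "\<And>x. x \<notin> {-R'..R'} \<Longrightarrow> k x = 0 \<and> k' x = 0" using k'(7) by blast
  have Q: "(\<lambda>z. pos_time z * ((W z)\<^sup>2 / 2)) \<in> borel_measurable borel" "bdd_fun (\<lambda>z. pos_time z * ((W z)\<^sup>2 / 2))"
    and W: "W \<in> borel_measurable borel" "bdd_fun W" if "entropy_ext W" for W
  proof -
    show W[measurable]: "W \<in> borel_measurable borel" and bW: "bdd_fun W"
      using that by (auto simp: entropy_ext_def bdd_fun_def)
    show "(\<lambda>z. pos_time z * ((W z)\<^sup>2 / 2)) \<in> borel_measurable borel" by measurable
    have "bdd_fun (\<lambda>z. pos_time z * ((W z)\<^sup>2 * (1/2)))"
      by (intro bdd_fun_intros bW bdd_fun_pos_time)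
    then show "bdd_fun (\<lambda>z. pos_time z * ((W z)\<^sup>2 / 2))" by simp
  qed
  have ten1: "integrable lborel (\<lambda>z. W z * (a' (fst z) * k (snd z)))"
    "integrable lborel (\<lambda>t. a' t * (LINT x|lborel. W (t, x) * k x))"
    "(LINT z|lborel. W z * (a' (fst z) * k (snd z))) = (LINT t|lborel. a' t * (LINT x|lborel. W (t, x) * k x))"
    if "W \<in> borel_measurable borel" "bdd_fun W" for W
    by (rule integrable_tensor[OF that a'(6) a'(9) _ k'(5) k'(8), of R R']; use R R' in blast)+
  have ten2: "integrable lborel (\<lambda>z. W z * (a (fst z) * k' (snd z)))"
    "(LINT z|lborel. W z * (a (fst z) * k' (snd z))) = (LINT t|lborel. a t * (LINT x|lborel. W (t, x) * k' x))"
    if "W \<in> borel_measurable borel" "bdd_fun W" for W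
    by (rule integrable_tensor[OF that a'(5) a'(8) _ k'(6) k'(9), of R R']; use R R' in blast)+
  let ?D = "\<lambda>z. U z - V z" and ?F = "\<lambda>z. pos_time z * ((U z)\<^sup>2 / 2) - pos_time z * ((V z)\<^sup>2 / 2)"
  have D: "?D \<in> borel_measurable borel" "bdd_fun ?D" and F: "?F \<in> borel_measurable borel" "bdd_fun ?F"
    using W[OF U] W[OF V] Q[OF U] Q[OF V] by (auto intro!: bdd_fun_diff)
  show "integrable lborel (\<lambda>t. a' t * (LINT x|lborel. (U (t, x) - V (t, x)) * k x))"
    by (rule ten1(2)[OF D])
  have "(LINT t|lborel. a' t * (LINT x|lborel. (U (t, x) - V (t, x)) * k x))
      = (LINT z|lborel. U z * (a' (fst z) * k (snd z)) - V z * (a' (fst z) * k (snd z)))"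
    using ten1(3)[OF D] by (simp add: left_diff_distrib)
  also have "\<dots> = (LINT t|lborel. a' t * (LINT x|lborel. U (t, x) * k x)) - (LINT t|lborel. a' t * (LINT x|lborel. V (t, x) * k x))"
    unfolding ten1(3)[OF W[OF U], symmetric] ten1(3)[OF W[OF V], symmetric]
    by (rule Bochner_Integration.integral_diff[OF ten1(1)[OF W[OF U]] ten1(1)[OF W[OF V]]])
  finally have 1: "(LINT t|lborel. a' t * (LINT x|lborel. (U (t, x) - V (t, x)) * k x))
      = (LINT t|lborel. a' t * (LINT x|lborel. U (t, x) * k x)) - (LINT t|lborel. a' t * (LINT x|lborel. V (t, x) * k x))" .
  have "(LINT t|lborel. a t * (LINT x|lborel. pos_time (t, x) * ((U (t, x))\<^sup>2 / 2 - (V (t, x))\<^sup>2 / 2) * k' x))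
      = (LINT z|lborel. pos_time z * ((U z)\<^sup>2 / 2) * (a (fst z) * k' (snd z)) - pos_time z * ((V z)\<^sup>2 / 2) * (a (fst z) * k' (snd z)))"
    using ten2(2)[OF F] by (simp add: left_diff_distrib right_diff_distrib)
  also have "\<dots> = (LINT t|lborel. a t * (LINT x|lborel. pos_time (t, x) * ((U (t, x))\<^sup>2 / 2) * k' x))
      - (LINT t|lborel. a t * (LINT x|lborel. pos_time (t, x) * ((V (t, x))\<^sup>2 / 2) * k' x))"
    unfolding ten2(2)[OF Q[OF U], symmetric] ten2(2)[OF Q[OF V], symmetric]
    by (rule Bochner_Integration.integral_diff[OF ten2(1)[OF Q[OF U]] ten2(1)[OF Q[OF V]]])
  finally show "(LINT t|lborel. a' t * (LINT x|lborel. (U (t, x) - V (t, x)) * k x))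
       + (LINT t|lborel. a t * (LINT x|lborel. pos_time (t, x) * ((U (t, x))\<^sup>2 / 2 - (V (t, x))\<^sup>2 / 2) * k' x)) = 0"
    using 1 weak_form_tensor[OF U a k] weak_form_tensor[OF V a k] by linarith
qed

text \<open>On almost every time slice the flux is periodic in space, so \<open>k'\<close>
  annihilates it and only the time term of the weak form is left.\<close>

lemma conserved_mean:
  assumes V: "entropy_ext V" and per: "AE z in lborel. V (fst z, snd z + p) = V z"
    and k: "line_test k k'"
    and k'0: "\<And>g. g \<in> borel_measurable borel \<Longrightarrow> bdd_fun g \<Longrightarrow> AE x in lborel. g (x + p) = g x \<Longrightarrow>
       (LINT x|lborel. k' x * g x) = 0"
    and a: "line_test a a'"
  shows "(LINT t|lborel. a' t * (LINT x|lborel. V (t, x) * k x)) = 0"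
proof -
  have Vm[measurable]: "V \<in> borel_measurable borel" and bV: "bdd_fun V"
    using V by (auto simp: entropy_ext_def bdd_fun_def)
  have "(LINT t|lborel. a t * (LINT x|lborel. pos_time (t, x) * ((V (t, x))\<^sup>2 / 2) * k' x)) = (LINT t|(lborel::real measure). 0)"
  proof (rule integral_cong_AE)
    show "AE t in lborel. a t * (LINT x|lborel. pos_time (t, x) * ((V (t, x))\<^sup>2 / 2) * k' x) = 0"
      using AE_lborel_slices[OF per]
    proof (rule eventually_mono)
      fix t assume t: "AE x in lborel. V (fst (t, x), snd (t, x) + p) = V (t, x)"
      have "(LINT x|lborel. k' x * (pos_time (t, 0) * ((V (t, x))\<^sup>2 * (1/2)))) = 0"
      proof (rule k'0)
        show "(\<lambda>x. pos_time (t, 0) * ((V (t, x))\<^sup>2 * (1/2))) \<in> borel_measurable borel"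
          by measurable
        show "bdd_fun (\<lambda>x. pos_time (t, 0) * ((V (t, x))\<^sup>2 * (1/2)))"
          by (intro bdd_fun_intros bdd_fun_comp[OF bV])
        show "AE x in lborel. pos_time (t, 0) * ((V (t, x + p))\<^sup>2 * (1/2)) = pos_time (t, 0) * ((V (t, x))\<^sup>2 * (1/2))"
          using t by (rule eventually_mono) simp
      qed
      then show "a t * (LINT x|lborel. pos_time (t, x) * ((V (t, x))\<^sup>2 / 2) * k' x) = 0"
        by (simp add: pos_time_def mult_ac)
    qed
    have k'm[measurable]: "k' \<in> borel_measurable borel" and am[measurable]: "a \<in> borel_measurable borel"
      using line_testD[OF k] line_testD[OF a] by auto
    show "(\<lambda>t. a t * (LINT x|lborel. pos_time (t, x) * ((V (t, x))\<^sup>2 / 2) * k' x)) \<in> borel_measurable lborel"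
      by (intro borel_measurable_times lborel.borel_measurable_lebesgue_integral) measurable
  qed simp
  then show ?thesis
    using weak_form_tensor[OF V a k] by simp
qed

text \<open>Expanding the square, the average of \<open>g\<close> squared appears twice, once
  translated, and cancels because the average does not depend on the position of the kernel. The
  nonlinear flux difference thus sees only the mean of \<open>g\<close>.\<close>

lemma flux_difference_average:
  fixes g k :: "real \<Rightarrow> real"
  assumes g[measurable]: "g \<in> borel_measurable borel" and bg: "bdd_fun g" and per: "AE x in lborel. g (x + p) = g x"
    and k: "k \<in> borel_measurable borel" "bdd_fun k" "\<And>x. x \<notin> {l..u} \<Longrightarrow> k x = 0" and one: "(LINT x|lborel. k x) = 1"
    and av: "\<And>g c. g \<in> borel_measurable borel \<Longrightarrow> bdd_fun g \<Longrightarrow> AE x in lborel. g (x + p) = g x \<Longrightarrow>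
       (LINT x|lborel. k (x + c) * g x) = A g"
  shows "(LINT x|lborel. k (x - b) * (((g (x - e) + d)\<^sup>2 - (g x)\<^sup>2) / 2)) = d * (LINT x|lborel. k x * g x) + d\<^sup>2 / 2"
proof -
  note [measurable] = k(1)
  have int: "integrable lborel (\<lambda>x. k (x - c) * h x)" if [measurable]: "h \<in> borel_measurable borel" and h: "bdd_fun h" for h c
    by (rule integrable_bdd_fun[where S = "{l + c..u + c}"])
       (measurable, intro bdd_fun_intros bdd_fun_comp[OF k(2)] h, auto intro: k(3))
  have b2: "bdd_fun (\<lambda>x. (g x)\<^sup>2)" by (intro bdd_fun_intros bg)
  have shift: "(LINT x|lborel. k (x - b) * h (x - e)) = A h"
    if h[measurable]: "h \<in> borel_measurable borel" and "bdd_fun h" "AE x in lborel. h (x + p) = h x" for h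
  proof -
    have "(LINT x|lborel. k (x - b) * h (x - e)) = (LINT x|lborel. k (x + (e - b)) * h x)"
      using lborel_integral_translate[of "\<lambda>x. k (x - b) * h (x - e)" e] by (simp add: algebra_simps)
    then show ?thesis using av[OF that] by simp
  qed
  have per2: "AE x in lborel. (g (x + p))\<^sup>2 = (g x)\<^sup>2"
    using per by (rule eventually_mono) simp
  have i1: "integrable lborel (\<lambda>x. k (x - b) * (g (x - e))\<^sup>2)" and i2: "integrable lborel (\<lambda>x. k (x - b) * g (x - e))"
    and i3: "integrable lborel (\<lambda>x. k (x - b) * (g x)\<^sup>2)" and i4: "integrable lborel (\<lambda>x. k (x - b))"
    using int[of "\<lambda>x. (g (x - e))\<^sup>2" b] int[of "\<lambda>x. g (x - e)" b] int[OF _ b2, of b] int[of "\<lambda>_. 1" b]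
      bdd_fun_comp[OF b2, of "\<lambda>x. x - e"] bdd_fun_comp[OF bg, of "\<lambda>x. x - e"] bdd_fun_const[of 1] by auto
  have "(LINT x|lborel. k (x - b) * (((g (x - e) + d)\<^sup>2 - (g x)\<^sup>2) / 2))
      = (LINT x|lborel. (1/2) * (k (x - b) * (g (x - e))\<^sup>2) + d * (k (x - b) * g (x - e)) + d\<^sup>2 / 2 * k (x - b)
          - (1/2) * (k (x - b) * (g x)\<^sup>2))"
    by (rule Bochner_Integration.integral_cong) (auto simp: power2_eq_square field_simps)
  also have "\<dots> = (1/2) * (LINT x|lborel. k (x - b) * (g (x - e))\<^sup>2) + d * (LINT x|lborel. k (x - b) * g (x - e))
      + d\<^sup>2 / 2 * (LINT x|lborel. k (x - b)) - (1/2) * (LINT x|lborel. k (x - b) * (g x)\<^sup>2)"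
    using i1 i2 i3 i4 by simp
  also have "(LINT x|lborel. k (x - b) * (g (x - e))\<^sup>2) = A (\<lambda>x. (g x)\<^sup>2)"
    by (rule shift[OF _ b2 per2]) measurable
  also have "(LINT x|lborel. k (x - b) * (g x)\<^sup>2) = A (\<lambda>x. (g x)\<^sup>2)"
    using av[OF _ b2 per2, of "- b"] by simp
  also have "(LINT x|lborel. k (x - b) * g (x - e)) = (LINT x|lborel. k x * g x)"
    using shift[OF g bg per] av[OF g bg per, of 0] by simp
  also have "(LINT x|lborel. k (x - b)) = 1"
    using lborel_integral_translate[of "\<lambda>x. k x" "- b"] one by simp
  finally show ?thesis by simp
qed

section \<open>The shock position\<close>

text \<open>An unnormalised mass concentrated at time \<open>t\<close>, used as derivative of a time
  test function. Its first moment tracks \<open>t\<close> up to \<open>e\<close>, which is how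
  elapsed time enters the mass balance.\<close>

lemma tent_function:
  fixes t e :: real
  assumes e: "0 < e" and b_def: "b = (\<lambda>s. max 0 (e - \<bar>s - t\<bar>))"
  shows "continuous_on UNIV b" "\<And>s. 0 \<le> b s" "\<And>s. s \<notin> {t - e<..<t + e} \<Longrightarrow> b s = 0"
    "integrable lborel b" "0 < (LINT s|lborel. b s)"
    "integrable lborel (\<lambda>s. s * b s)" "\<bar>(LINT s|lborel. s * b s) - t * (LINT s|lborel. b s)\<bar> \<le> e * (LINT s|lborel. b s)"
proof -
  show c: "continuous_on UNIV b" unfolding b_def by (intro continuous_intros)
  show b0: "0 \<le> b s" for s by (simp add: b_def)
  show out: "b s = 0" if "s \<notin> {t - e<..<t + e}" for s using that unfolding b_def by auto
  have be: "b s \<le> e" for s using e by (simp add: b_def)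
  have bm[measurable]: "b \<in> borel_measurable borel" by (rule borel_measurable_continuous_onI[OF c])
  show i: "integrable lborel b"
    by (rule integrable_bounded_support[where C = e and S = "{t-e..t+e}"])
       (use b0 be out in \<open>auto simp: abs_of_nonneg\<close>)
  have i1: "integrable lborel (\<lambda>s. (s - t) * b s)"
  proof (rule integrable_bounded_support[where C = "e * e" and S = "{t-e..t+e}"])
    show "\<bar>(s - t) * b s\<bar> \<le> e * e" for s
    proof (cases "s \<in> {t - e<..<t + e}")
      case True
      then show ?thesis unfolding abs_mult using b0[of s] be[of s] by (intro mult_mono) auto
    qed (use out[of s] e in auto)
  qed (use out in auto)
  have "e / 2 * e = (LINT s|lborel. e / 2 * indicator {t - e/2..t + e/2} s)"
    using e by simp
  also have "\<dots> \<le> (LINT s|lborel. b s)"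
  proof (rule integral_mono)
    show "integrable lborel (\<lambda>s. e / 2 * indicator {t - e/2..t + e/2} s)"
      by (intro integrable_mult_right integrable_real_indicator emeasure_bounded_finite) auto
    show "e / 2 * indicator {t - e/2..t + e/2} s \<le> b s" for s
    proof (cases "s \<in> {t - e/2..t + e/2}")
      case True
      then have "\<bar>s - t\<bar> \<le> e / 2" unfolding abs_le_iff by auto
      then have "e / 2 \<le> b s" unfolding b_def by linarith
      then show ?thesis using True by simp
    qed (use b0[of s] in simp)
  qed (rule i)
  finally show "0 < (LINT s|lborel. b s)" using e by (smt (verit) mult_pos_pos half_gt_zero)
  have eq: "s * b s = (s - t) * b s + t * b s" for s by (simp add: algebra_simps)
  show "integrable lborel (\<lambda>s. s * b s)" unfolding eq using i i1 by auto
  have "(LINT s|lborel. s * b s) - t * (LINT s|lborel. b s) = (LINT s|lborel. (s - t) * b s)"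
    unfolding eq using i i1 by simp
  also have "\<bar>\<dots>\<bar> \<le> (LINT s|lborel. \<bar>(s - t) * b s\<bar>)"
    using integral_norm_bound[of lborel "\<lambda>s. (s - t) * b s"] by simp
  also have "\<dots> \<le> (LINT s|lborel. e * b s)"
  proof (rule integral_mono)
    show "\<bar>(s - t) * b s\<bar> \<le> e * b s" for s
    proof (cases "s \<in> {t - e<..<t + e}")
      case True
      then show ?thesis unfolding abs_mult using b0[of s] by (intro mult_mono) auto
    qed (use out[of s] in auto)
  qed (use i i1 in auto)
  finally show "\<bar>(LINT s|lborel. s * b s) - t * (LINT s|lborel. b s)\<bar> \<le> e * (LINT s|lborel. b s)"
    by simp
qed

text \<open>The integrand is the derivative of \<open>s * a s\<close>, which vanishes at 0 and at
  infinity. This converts the integral of \<open>a\<close> over positive times into the first moment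
  of \<open>- a'\<close>.\<close>

lemma positive_part_integral_by_parts:
  assumes a: "line_test a a'"
  shows "(LINT s|lborel. indicator {0<..} s * (a s + s * a' s)) = 0"
    "integrable lborel (\<lambda>s. indicator {0<..} s * a s)"
    "integrable lborel (\<lambda>s. indicator {0<..} s * (s * a' s))"
proof -
  note a' = line_testD[OF a]
  obtain R where R: "\<And>x. x \<notin> {-R..R} \<Longrightarrow> a x = 0 \<and> a' x = 0" using a'(7) by blast
  note [measurable] = a'(5,6)
  have c: "continuous_on UNIV (\<lambda>s. a s + s * a' s)"
    by (intro continuous_intros a')
  have d: "((\<lambda>s. s * a s) has_real_derivative (a s + s * a' s)) (at s)" for s
    by (auto intro!: derivative_eq_intros a')
  have out: "s * a s = 0 \<and> a s + s * a' s = 0" if "R < \<bar>s\<bar>" for s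
  proof -
    have "s \<notin> {-R..R}" using that by auto
    then show ?thesis using R by simp
  qed
  note z = integral_derivative_compact_support(1)[OF d c out, where b = 0]
    integral_derivative_compact_support(2)[OF d c out]
  have bd: "bdd_fun (\<lambda>s. g s * f s)"
    if bf: "bdd_fun f" and f0: "\<And>x. x \<notin> {-R..R} \<Longrightarrow> f x = 0" and gR: "\<And>x. \<bar>x\<bar> \<le> \<bar>R\<bar> \<Longrightarrow> \<bar>g x\<bar> \<le> \<bar>R\<bar> + 1" for f g
  proof -
    obtain C where C: "\<And>x. \<bar>f x\<bar> \<le> C" using bf by (auto simp: bdd_fun_def)
    show ?thesis
    proof (rule bdd_funI)
      fix x show "\<bar>g x * f x\<bar> \<le> (\<bar>R\<bar> + 1) * C"
      proof (cases "x \<in> {-R..R}")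
        case True
        then show ?thesis unfolding abs_mult using gR[of x] C by (intro mult_mono) auto
      next
        case False
        then show ?thesis using f0 C[of x] by simp
      qed
    qed
  qed
  have i: "integrable lborel (\<lambda>s. g s * f s)"
    if [measurable]: "f \<in> borel_measurable borel" "g \<in> borel_measurable borel" and "bdd_fun f" "\<And>x. x \<notin> {-R..R} \<Longrightarrow> f x = 0" "\<And>x. \<bar>x\<bar> \<le> \<bar>R\<bar> \<Longrightarrow> \<bar>g x\<bar> \<le> \<bar>R\<bar> + 1" for f g
    by (rule integrable_bdd_fun[where S = "{-R..R}"]) (use bd[OF that(3-5)] that in auto)
  show i1: "integrable lborel (\<lambda>s. indicator {0<..} s * a s)"
    by (rule i) (use a' R in \<open>auto split: split_indicator\<close>)
  have "integrable lborel (\<lambda>s. (indicator {0<..} s * s) * a' s)"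
    by (rule i) (use a' R in \<open>auto split: split_indicator\<close>)
  then show i2: "integrable lborel (\<lambda>s. indicator {0<..} s * (s * a' s))"
    by (simp add: mult.assoc)
  have j1: "integrable lborel (\<lambda>s. indicator {..0} s * a s)"
    by (rule i) (use a' R in \<open>auto split: split_indicator\<close>)
  have "integrable lborel (\<lambda>s. (indicator {..0} s * s) * a' s)"
    by (rule i) (use a' R in \<open>auto split: split_indicator\<close>)
  then have j2: "integrable lborel (\<lambda>s. indicator {..0} s * (s * a' s))"
    by (simp add: mult.assoc)
  have "(LINT s|lborel. a s + s * a' s) = (LINT s|lborel. (indicator {..0} s * a s + indicator {..0} s * (s * a' s))
      + (indicator {0<..} s * a s + indicator {0<..} s * (s * a' s)))"
    by (rule Bochner_Integration.integral_cong) (auto split: split_indicator)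
  also have "\<dots> = (LINT s|lborel. indicator {..0} s * a s + indicator {..0} s * (s * a' s))
      + (LINT s|lborel. indicator {0<..} s * a s + indicator {0<..} s * (s * a' s))"
    by (intro Bochner_Integration.integral_add Bochner_Integration.integrable_add i1 i2 j1 j2)
  finally show "(LINT s|lborel. indicator {0<..} s * (a s + s * a' s)) = 0"
    using z by (simp add: distrib_left)
qed

text \<open>Balance of the mass \<open>m\<close> of \<open>U - Ul\<close> under the plateau function
  \<open>chi\<close>: it is \<open>- d * R0\<close> for the data and close to
  \<open>- d * (R0 - X t)\<close> near time \<open>t\<close>, while flux enters at mean rate d c +
  d^2 / 2. Equating gain and inflow gives d X(t) = (d c + d^2 / 2) t. In the application
  \<open>c\<close> is the mean \<open>ubr\<close> and \<open>d\<close> is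
  \<open>ubl - ubr\<close>.\<close>

lemma shock_position_extended:
  fixes U Ul Ur :: "real \<times> real \<Rightarrow> real" and X :: "real \<Rightarrow> real"
  assumes U: "entropy_ext U" and Ul: "entropy_ext Ul" and Ur: "entropy_ext Ur"
    and p: "0 < p" and d: "d \<noteq> 0" and T0: "0 < T0" and t: "T0 < t"
    and per: "AE z in lborel. Ur (fst z, snd z + p) = Ur z"
    and mean: "AE s in lborel. s \<le> 0 \<longrightarrow> (LINT x|lborel. indicator {0..p} x * Ur (s, x)) = p * c"
    and gal: "AE z in lborel. 0 < fst z \<longrightarrow> Ul z = Ur (fst z, snd z - d * (fst z - t)) + d"
    and init: "AE z in lborel. fst z \<le> 0 \<longrightarrow> Ul z = Ur z + d \<and> U z = (if snd z < 0 then Ul z else Ur z)"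
    and shock: "AE z in lborel. T0 < fst z \<longrightarrow> U z = (if snd z < X (fst z) then Ul z else Ur z)"
    and lip: "\<And>s. T0 < s \<Longrightarrow> \<bar>X s - X t\<bar> \<le> K * \<bar>s - t\<bar>" and K: "0 \<le> K"
  shows "X t = (c + d / 2) * t"
proof -
  obtain M1 M2 M3 where M123: "\<And>z. \<bar>U z\<bar> \<le> M1" "\<And>z. \<bar>Ul z\<bar> \<le> M2" "\<And>z. \<bar>Ur z\<bar> \<le> M3"
    using U Ul Ur unfolding entropy_ext_def by blast
  define L where "L = \<bar>M1\<bar> + \<bar>M2\<bar> + \<bar>M3\<bar> + 1"
  have L: "\<bar>U z\<bar> \<le> L" "\<bar>Ul z\<bar> \<le> L" "\<bar>Ur z\<bar> \<le> L" "0 < L" for z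
    using M123(1)[of z] M123(2)[of z] M123(3)[of z] unfolding L_def by linarith+
  have bU: "bdd_fun U" "bdd_fun Ul" "bdd_fun Ur" by (rule bdd_funI, rule L)+
  have meas[measurable]: "U \<in> borel_measurable borel" "Ul \<in> borel_measurable borel" "Ur \<in> borel_measurable borel"
    using U Ul Ur by (auto simp: entropy_ext_def)
  obtain hat hat' where hat: "line_test hat hat'" and hat_out: "\<And>x. x \<notin> {- 1 - p<..<1} \<Longrightarrow> hat x = 0"
    and hat1: "(LINT x|lborel. hat x) = 1"
    and hat_av: "\<And>g c. g \<in> borel_measurable borel \<Longrightarrow> bdd_fun g \<Longrightarrow> AE x in lborel. g (x + p) = g x \<Longrightarrow>
       (LINT x|lborel. hat (x + c) * g x) = (LINT x|lborel. indicator {0..p} x * g x) / p"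
    and hat'0: "\<And>g. g \<in> borel_measurable borel \<Longrightarrow> bdd_fun g \<Longrightarrow> AE x in lborel. g (x + p) = g x \<Longrightarrow>
       (LINT x|lborel. hat' x * g x) = 0"
    by (rule periodic_averaging_kernel[OF p]) blast
  note hat_D = line_testD[OF hat]
  obtain C where C: "\<And>x. \<bar>hat x\<bar> \<le> C" using hat_D(8) by (auto simp: bdd_fun_def)
  define A where "A s = (LINT x|lborel. Ur (s, x) * hat x)" for s
  \<comment> \<open>The first bound outruns signals of speed \<open>L\<close> from the origin up to
    time t + 1, including the unit of time by which the cones are shifted; the second keeps X(s) on
    the plateau while |s - t| < 1.\<close>
  define E where "E = max (L * (t + 2)) (\<bar>X t\<bar> + K + 1)"
  \<comment> \<open>\<open>hat\<close> lives on (-1 - p, 1), so the right edge of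
    \<open>chi\<close>, placed at \<open>B\<close>, begins exactly at \<open>E\<close>; the left
    edge, placed at \<open>- B\<close>, reaches down to \<open>- R\<close>.\<close>
  define B where "B = E + 1 + p"
  define R where "R = B + 1 + p"
  have E0: "0 < E" and EX: "\<bar>X t\<bar> + K + 1 \<le> E" and EL: "L * (t + 2) \<le> E"
    using K by (auto simp: E_def)
  have chat: "continuous_on UNIV (\<lambda>y. hat (y - B))"
    by (rule continuous_on_compose2[OF hat_D(2)]) (auto intro!: continuous_intros)
  have hat_out2: "hat (y - B) = 0" if "y \<notin> {B - 1 - p<..<B + 1}" for y
    using hat_out[of "y - B"] that by auto
  have hatB1: "(LINT y|lborel. hat (y - B)) = 1"
    using lborel_integral_translate[OF hat_D(5), of "- B"] hat1 by simp
  obtain chi where chi: "line_test chi (\<lambda>x. hat (x + 2 * B - B) - hat (x - B))"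
      "\<And>x. x \<le> B - 1 - p \<Longrightarrow> B + 1 \<le> x + 2 * B \<Longrightarrow> chi x = (LINT y|lborel. hat (y - B))"
      "\<And>x. chi x \<le> (LINT y|lborel. hat (y - B))"
      "\<And>x. B + 1 \<le> x \<Longrightarrow> chi x = 0" "\<And>x. x + 2 * B \<le> B - 1 - p \<Longrightarrow> chi x = 0"
    by (rule line_test_window[OF chat hat_D(4), where T = "2 * B" and l = "B - 1 - p" and u = "B + 1"])
       (erule hat_out2, use E0 p in \<open>simp add: B_def\<close>, (rule that; assumption))
  define chi' where "chi' x = hat (x + B) - hat (x - B)" for x
  have chi_t: "line_test chi chi'" 
  proof -
    have "x + 2 * B - B = x + B" for x by simp
    then show ?thesis using chi(1) by (simp only: chi'_def[abs_def])
  qed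
  have chi_one: "chi x = 1" if "\<bar>x\<bar> \<le> E" for x
  proof -
    have "x \<le> B - 1 - p" "B + 1 \<le> x + 2 * B" using that p unfolding B_def by auto
    then show ?thesis using chi(2) hatB1 by simp
  qed
  have chi_le: "chi x \<le> 1" for x using chi(3)[of x] by (simp add: hatB1)
  have chi_out: "chi x = 0" if "x \<notin> {-R..R}" for x
    using chi(4)[of x] chi(5)[of x] that p E0 by (auto simp: R_def B_def)
  have chi'_le: "\<bar>chi' x\<bar> \<le> 2 * C" for x
    using C[of "x + B"] C[of "x - B"] unfolding chi'_def by linarith
  note chi_D = line_testD[OF chi_t]
  obtain R' where R': "\<And>x. x \<notin> {-R'..R'} \<Longrightarrow> chi x = 0 \<and> chi' x = 0" using chi_D(7) by blast
  define R0 where "R0 = (LINT x|lborel. indicator {0..} x * chi x)"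
  note [measurable] = hat_D(5,6) chi_D(5,6)

  have far_left: "AE z in lborel. 0 < fst z \<and> fst z < t + 1 \<and> snd z \<in> {-R..-E} \<longrightarrow> U z = Ul z"
  proof -
    \<comment> \<open>The base extends so far to the left that the cone still contains [-R, -E] at
      all times up to t + 1.\<close>
    define a where "a = - (R + L * (t + 2) + 1)"
    have "AE z in lborel. 0 < fst z \<and> a + L * (fst z + 1) < snd z \<and> snd z < 0 - L * (fst z + 1) \<longrightarrow> U z = Ul z"
      by (rule entropy_ext_unique[OF U Ul L(1,2,4)]) (use init in \<open>auto elim!: eventually_mono\<close>)
    then show ?thesis
    proof (rule eventually_mono, intro impI)
      fix z :: "real \<times> real"
      assume u: "0 < fst z \<and> a + L * (fst z + 1) < snd z \<and> snd z < 0 - L * (fst z + 1) \<longrightarrow> U z = Ul z"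
        and z: "0 < fst z \<and> fst z < t + 1 \<and> snd z \<in> {-R..-E}"
      have "L * (fst z + 1) < L * (t + 2)" using z L(4) by (intro mult_strict_left_mono) auto
      with z EL have "a + L * (fst z + 1) < snd z" "snd z < 0 - L * (fst z + 1)"
        unfolding a_def by auto
      with u z show "U z = Ul z" by blast
    qed
  qed
  have far_right: "AE z in lborel. 0 < fst z \<and> fst z < t + 1 \<and> snd z \<in> {E..R} \<longrightarrow> U z = Ur z"
  proof -
    define a where "a = R + L * (t + 2) + 1"
    have "AE z in lborel. 0 < fst z \<and> 0 + L * (fst z + 1) < snd z \<and> snd z < a - L * (fst z + 1) \<longrightarrow> U z = Ur z"
      by (rule entropy_ext_unique[OF U Ur L(1,3,4)]) (use init in \<open>auto elim!: eventually_mono\<close>)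
    then show ?thesis
    proof (rule eventually_mono, intro impI)
      fix z :: "real \<times> real"
      assume u: "0 < fst z \<and> 0 + L * (fst z + 1) < snd z \<and> snd z < a - L * (fst z + 1) \<longrightarrow> U z = Ur z"
        and z: "0 < fst z \<and> fst z < t + 1 \<and> snd z \<in> {E..R}"
      have "L * (fst z + 1) < L * (t + 2)" using z L(4) by (intro mult_strict_left_mono) auto
      with z EL have "0 + L * (fst z + 1) < snd z" "snd z < a - L * (fst z + 1)"
        unfolding a_def by auto
      with u z show "U z = Ur z" by blast
    qed
  qed

  define m where "m s = (LINT x|lborel. (U (s, x) - Ul (s, x)) * chi x)" for s
  define fl where "fl s = (LINT x|lborel. ((U (s, x))\<^sup>2 / 2 - (Ul (s, x))\<^sup>2 / 2) * chi' x)" for s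
  have sl_b: "bdd_fun (\<lambda>x. Ur (s, x))" for s by (rule bdd_fun_comp[OF bU(3)])
  have A_av: "AE s in lborel. A s = (LINT x|lborel. indicator {0..p} x * Ur (s, x)) / p"
    using AE_lborel_slices[OF per]
  proof (rule eventually_mono)
    fix s assume "AE x in lborel. Ur (fst (s, x), snd (s, x) + p) = Ur (s, x)"
    then show "A s = (LINT x|lborel. indicator {0..p} x * Ur (s, x)) / p"
      using hat_av[of "\<lambda>x. Ur (s, x)" 0] sl_b[of s] by (simp add: A_def mult.commute)
  qed
  have A_init: "AE s in lborel. s \<le> 0 \<longrightarrow> A s = c"
    using A_av mean by eventually_elim (use p in auto)
  \<comment> \<open>At the left edge of \<open>chi\<close> both solutions coincide. At the right
    edge \<open>U\<close> is \<open>Ur\<close> while \<open>Ul\<close> is a translate of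
    \<open>Ur\<close> plus \<open>d\<close>, so the averaged flux difference is explicit.\<close>
  have fl_eq: "AE s in lborel. 0 < s \<and> s < t + 1 \<longrightarrow> fl s = d * A s + d\<^sup>2 / 2"
    using AE_lborel_slices[OF per] AE_lborel_slices[OF gal] AE_lborel_slices[OF far_left] AE_lborel_slices[OF far_right]
  proof eventually_elim
    case (elim s)
    show ?case
    proof
      assume s: "0 < s \<and> s < t + 1"
      have "fl s = (LINT x|lborel. hat (x - B) * (((Ur (s, x - d * (s - t)) + d)\<^sup>2 - (Ur (s, x))\<^sup>2) / 2))"
        unfolding fl_def
      proof (rule integral_cong_AE)
        show "AE x in lborel. ((U (s, x))\<^sup>2 / 2 - (Ul (s, x))\<^sup>2 / 2) * chi' x
            = hat (x - B) * (((Ur (s, x - d * (s - t)) + d)\<^sup>2 - (Ur (s, x))\<^sup>2) / 2)"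
          using elim(2,3,4)
        proof eventually_elim
          case (elim x)
          show ?case
          proof (cases "x \<le> - E")
            case True
            then have h: "hat (x - B) = 0" using E0 p by (intro hat_out) (auto simp: B_def)
            show ?thesis
            proof (cases "x \<in> {-R..-E}")
              case T: True
              then have "U (s, x) = Ul (s, x)" using elim s by simp
              then show ?thesis using h by simp
            next
              case False
              then have "hat (x + B) = 0" using True by (intro hat_out) (auto simp: R_def)
              then show ?thesis using h by (simp add: chi'_def)
            qed
          next
            case False
            then have h: "hat (x + B) = 0" using E0 p by (intro hat_out) (auto simp: B_def)
            show ?thesis
            proof (cases "x \<in> {E..R}")
              case T: True
              then have "U (s, x) = Ur (s, x)" "Ul (s, x) = Ur (s, x - d * (s - t)) + d" using elim s by simp_all
              then show ?thesis using h by (simp add: chi'_def field_simps)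
            next
              case F: False
              then have "hat (x - B) = 0" using False p by (intro hat_out) (auto simp: R_def B_def)
              then show ?thesis using h by (simp add: chi'_def)
            qed
          qed
        qed
      qed measurable
      then have fl: "fl s = (LINT x|lborel. hat (x - B) * (((Ur (s, x - d * (s - t)) + d)\<^sup>2 - (Ur (s, x))\<^sup>2) / 2))" .
      have "(LINT x|lborel. hat (x - B) * (((Ur (s, x - d * (s - t)) + d)\<^sup>2 - (Ur (s, x))\<^sup>2) / 2))
          = d * (LINT x|lborel. hat x * Ur (s, x)) + d\<^sup>2 / 2"
      proof (rule flux_difference_average[where p = p and l = "-1-p" and u = 1
            and A = "\<lambda>g. (LINT x|lborel. indicator {0..p} x * g x) / p"])
        show "AE x in lborel. Ur (s, x + p) = Ur (s, x)" using elim(1) by simp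
        show "hat x = 0" if "x \<notin> {- 1 - p..1}" for x using hat_out[of x] that by auto
      qed (use hat_D sl_b hat1 hat_av in auto)
      with fl show "fl s = d * A s + d\<^sup>2 / 2" by (simp add: A_def mult.commute)
    qed
  qed
  have m_init: "AE s in lborel. s \<le> 0 \<longrightarrow> m s = - d * R0"
    using AE_lborel_slices[OF init]
  proof (rule eventually_mono, intro impI)
    fix s :: real
    assume i: "AE x in lborel. fst (s, x) \<le> 0 \<longrightarrow> Ul (s, x) = Ur (s, x) + d \<and> U (s, x) = (if snd (s, x) < 0 then Ul (s, x) else Ur (s, x))"
      and s: "s \<le> 0"
    have "m s = (LINT x|lborel. - d * (indicator {0..} x * chi x))"
      unfolding m_def
    proof (rule integral_cong_AE)
      show "AE x in lborel. (U (s, x) - Ul (s, x)) * chi x = - d * (indicator {0..} x * chi x)"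
        using i by (rule eventually_mono) (use s in \<open>auto split: split_indicator\<close>)
    qed measurable
    then show "m s = - d * R0" by (simp add: R0_def)
  qed
  \<comment> \<open>First the displacement error for \<open>del = d * (s - t)\<close> and a cut-off
    of slope at most \<open>2 * C\<close>, then the motion of the shock between \<open>s\<close> and
    \<open>t\<close>.\<close>
  define C0 where "C0 = L * (2 + 2 * C * (2 * R + 2)) * \<bar>d\<bar> + \<bar>d\<bar> * K"
  have C0: "0 \<le> C" "0 \<le> R" using C[of 0] E0 p by (auto simp: R_def B_def)
  have m_near: "AE s in lborel. T0 < s \<and> \<bar>s - t\<bar> < 1 \<and> \<bar>d\<bar> * \<bar>s - t\<bar> \<le> 1 \<longrightarrow> \<bar>m s + d * (R0 - X t)\<bar> \<le> C0 * \<bar>s - t\<bar>"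
    using AE_lborel_slices[OF gal] AE_lborel_slices[OF shock]
  proof eventually_elim
    case (elim s)
    show ?case
    proof
      assume s: "T0 < s \<and> \<bar>s - t\<bar> < 1 \<and> \<bar>d\<bar> * \<bar>s - t\<bar> \<le> 1"
      have "K * \<bar>s - t\<bar> \<le> K * 1" using s K by (intro mult_left_mono) auto
      then have Xs: "\<bar>X s\<bar> \<le> E" using lip[of s] s EX by auto
      have "m s = (LINT x|lborel. (if x < X s then 0 else Ur (s, x) - (Ur (s, x - d * (s - t)) + d)) * chi x)"
        unfolding m_def
      proof (rule integral_cong_AE)
        show "AE x in lborel. (U (s, x) - Ul (s, x)) * chi x
            = (if x < X s then 0 else Ur (s, x) - (Ur (s, x - d * (s - t)) + d)) * chi x"
          using elim by eventually_elim (use s T0 in auto)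
      qed measurable
      moreover have "\<bar>(LINT x|lborel. (if x < X s then 0 else Ur (s, x) - (Ur (s, x - d * (s - t)) + d)) * chi x)
          + d * (R0 - X s)\<bar> \<le> L * (2 + 2 * C * (2 * R + 2)) * \<bar>d * (s - t)\<bar>"
        unfolding R0_def
        by (rule mass_beyond_shock[where E = E and chi' = chi'])
           (use L chi_t chi_le chi_one chi_out chi'_le Xs s C0 in \<open>auto simp: abs_mult\<close>)
      ultimately have 1: "\<bar>m s + d * (R0 - X s)\<bar> \<le> L * (2 + 2 * C * (2 * R + 2)) * \<bar>d * (s - t)\<bar>" by simp
      have "\<bar>d * (X s - X t)\<bar> \<le> \<bar>d\<bar> * (K * \<bar>s - t\<bar>)"
        unfolding abs_mult using lip[of s] s by (intro mult_left_mono) auto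
      moreover have "m s + d * (R0 - X t) = (m s + d * (R0 - X s)) + d * (X s - X t)" by (simp add: algebra_simps)
      ultimately have "\<bar>m s + d * (R0 - X t)\<bar> \<le> L * (2 + 2 * C * (2 * R + 2)) * \<bar>d * (s - t)\<bar> + \<bar>d\<bar> * (K * \<bar>s - t\<bar>)"
        using 1 by linarith
      then show "\<bar>m s + d * (R0 - X t)\<bar> \<le> C0 * \<bar>s - t\<bar>"
        unfolding abs_mult[of d "s - t"] C0_def by (simp add: algebra_simps)
    qed
  qed
  have est: "\<bar>d * X t - d * (c + d / 2) * t\<bar> \<le> (C0 + \<bar>d * (c + d / 2)\<bar>) * e"
    if e: "0 < e" "e < 1" "e < t - T0" "\<bar>d\<bar> * e \<le> 1" for e
  proof -
    define b where "b = (\<lambda>s. max 0 (e - \<bar>s - t\<bar>))"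
    note b = tent_function[OF e(1) b_def]
    define \<beta> where "\<beta> = (LINT s|lborel. b s)"
    have \<beta>: "0 < \<beta>" using b(5) by (simp add: \<beta>_def)
    \<comment> \<open>The window length \<open>t + 1\<close> puts the second tent at time -1. As
      \<open>e < 1\<close>, it lies in negative time, where \<open>U - Ul\<close> is given by the
      data.\<close>
    obtain a where a: "line_test a (\<lambda>s. b (s + (t + 1)) - b s)"
        "\<And>s. t + e \<le> s \<Longrightarrow> a s = 0" "\<And>s. s + (t + 1) \<le> t - e \<Longrightarrow> a s = 0"
      by (rule line_test_window[OF b(1,2), where T = "t + 1" and l = "t - e" and u = "t + e"])
         (erule b(3), use t T0 in simp, (rule that; assumption))
    define a' where "a' s = b (s + (t + 1)) - b s" for s
    have a_t: "line_test a a'" using a(1) by (simp add: a'_def[abs_def])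
    note a_D = line_testD[OF a_t]
    \<comment> \<open>A second window, with \<open>a\<close> as the weight: it transfers the mean
      known at negative times to the weight \<open>a\<close> on positive times.\<close>
    obtain a2 where a2: "line_test a2 (\<lambda>s. a (s + (t + 1)) - a s)"
      by (rule line_test_window[OF a_D(2,4), where T = "t + 1" and l = "- 1 - e" and u = "t + e"])
         (use a(2,3) t T0 in \<open>auto simp: not_less\<close>)
    note a2_D = line_testD[OF a2]
    note [measurable] = a_D(5,6)
    have bm[measurable]: "b \<in> borel_measurable borel" by (rule borel_measurable_continuous_onI[OF b(1)])
    have b_nonpos: "b s = 0" if "s \<le> 0" for s using b(3)[of s] that e t T0 by auto
    have b_shift: "b (s + (t + 1)) = 0" if "0 \<le> s" for s using b(3)[of "s + (t + 1)"] that e by auto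

    \<comment> \<open>On positive times \<open>a'\<close> is \<open>- b\<close>, so the total weight
      of \<open>a\<close> there is the first moment of the tent, close to \<open>t\<close> times its
      mass.\<close>
    have int_a: "(LINT s|lborel. indicator {0<..} s * a s) = (LINT s|lborel. s * b s)"
    proof -
      have "(LINT s|lborel. indicator {0<..} s * (s * a' s)) = (LINT s|lborel. - (s * b s))"
        by (rule Bochner_Integration.integral_cong[OF refl])
           (auto simp: a'_def b_shift b_nonpos split: split_indicator)
      then show ?thesis
        using positive_part_integral_by_parts[OF a_t] by (simp add: distrib_left)
    qed
    \<comment> \<open>The derivative of \<open>a2\<close> pairs to zero with \<open>A\<close>, by
      conservation of the mean, and with the constant \<open>c\<close>. Since \<open>A\<close>
      equals \<open>c\<close> at nonpositive times, only the positive-time part of \<open>a\<close>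
      survives.\<close>
    have int_a_mean: "integrable lborel (\<lambda>s. indicator {0<..} s * a s * (A s - c))"
      "(LINT s|lborel. indicator {0<..} s * a s * (A s - c)) = 0"
    proof -
      let ?a2 = "\<lambda>s. a (s + (t + 1)) - a s"
      obtain R2 where R2: "\<And>x. x \<notin> {-R2..R2} \<Longrightarrow> a2 x = 0 \<and> ?a2 x = 0" using a2_D(7) by blast
      have i1: "integrable lborel (\<lambda>s. ?a2 s * A s)"
        unfolding A_def
        by (rule integrable_tensor(2)[OF meas(3) bU(3) a2_D(6,9) _ hat_D(5,8), where R = R2 and R' = "1 + p"])
           (use R2 hat_out p in auto)
      have i2: "integrable lborel ?a2"
        by (rule integrable_bdd_fun[OF a2_D(6,9), where S = "{-R2..R2}"]) (use R2 in auto)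
      have z1: "(LINT s|lborel. ?a2 s * A s) = 0"
        unfolding A_def by (rule conserved_mean[OF Ur per hat hat'0 a2])
      have z2: "(LINT s|lborel. ?a2 s) = 0"
      proof (rule integral_derivative_compact_support(2)[OF a2_D(1,3), where R = R2])
        fix s :: real assume "R2 < \<bar>s\<bar>"
        then have "s \<notin> {-R2..R2}" by auto
        then show "a2 s = 0 \<and> ?a2 s = 0" by (rule R2)
      qed
      have i3: "integrable lborel (\<lambda>s. - (?a2 s * A s - c * ?a2 s))" using i1 i2 by simp
      have ae: "AE s in lborel. - (?a2 s * A s - c * ?a2 s) = indicator {0<..} s * a s * (A s - c)"
        using A_init
      proof (rule eventually_mono)
        fix s assume A0: "s \<le> 0 \<longrightarrow> A s = c"
        show "- (?a2 s * A s - c * ?a2 s) = indicator {0<..} s * a s * (A s - c)"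
        proof (cases "0 < s")
          case True
          then have "a (s + (t + 1)) = 0" using e by (intro a(2)) auto
          then show ?thesis using True by (simp add: algebra_simps)
        qed (use A0 in auto)
      qed
      have Am[measurable]: "A \<in> borel_measurable borel"
        unfolding A_def using lborel.borel_measurable_lebesgue_integral[of "\<lambda>s x. Ur (s, x) * hat x" borel] by simp
      show "integrable lborel (\<lambda>s. indicator {0<..} s * a s * (A s - c))"
        by (rule integrable_cong_AE_imp[OF i3 _ ae]) measurable
      have "(LINT s|lborel. indicator {0<..} s * a s * (A s - c)) = (LINT s|lborel. - (?a2 s * A s - c * ?a2 s))"
        by (rule integral_cong_AE[symmetric, OF _ _ ae]) (use i3 in measurable)
      also have "\<dots> = 0" using i1 i2 z1 z2 by simp
      finally show "(LINT s|lborel. indicator {0<..} s * a s * (A s - c)) = 0" .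
    qed
    have flm[measurable]: "fl \<in> borel_measurable borel" and mm[measurable]: "m \<in> borel_measurable borel"
      and Am[measurable]: "A \<in> borel_measurable borel"
      unfolding fl_def m_def A_def
      using lborel.borel_measurable_lebesgue_integral[of "\<lambda>s x. ((U (s, x))\<^sup>2 / 2 - (Ul (s, x))\<^sup>2 / 2) * chi' x" borel]
        lborel.borel_measurable_lebesgue_integral[of "\<lambda>s x. (U (s, x) - Ul (s, x)) * chi x" borel]
        lborel.borel_measurable_lebesgue_integral[of "\<lambda>s x. Ur (s, x) * hat x" borel] by simp_all
    have I2: "(LINT s|lborel. a s * (LINT x|lborel. pos_time (s, x) * ((U (s, x))\<^sup>2 / 2 - (Ul (s, x))\<^sup>2 / 2) * chi' x))
        = d * (c + d / 2) * (LINT s|lborel. s * b s)"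
    proof -
      have eq: "a s * (LINT x|lborel. pos_time (s, x) * ((U (s, x))\<^sup>2 / 2 - (Ul (s, x))\<^sup>2 / 2) * chi' x)
          = indicator {0<..} s * a s * fl s" for s
        by (auto simp: pos_time_def fl_def)
      have "(LINT s|lborel. a s * (LINT x|lborel. pos_time (s, x) * ((U (s, x))\<^sup>2 / 2 - (Ul (s, x))\<^sup>2 / 2) * chi' x))
          = (LINT s|lborel. indicator {0<..} s * a s * fl s)"
        unfolding eq ..
      also have "\<dots> = (LINT s|lborel. d * (indicator {0<..} s * a s * (A s - c)) + d * (c + d / 2) * (indicator {0<..} s * a s))"
      proof (rule integral_cong_AE)
        show "AE s in lborel. indicator {0<..} s * a s * fl s
            = d * (indicator {0<..} s * a s * (A s - c)) + d * (c + d / 2) * (indicator {0<..} s * a s)"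
          using fl_eq
        proof (rule eventually_mono)
          fix s assume f: "0 < s \<and> s < t + 1 \<longrightarrow> fl s = d * A s + d\<^sup>2 / 2"
          show "indicator {0<..} s * a s * fl s
            = d * (indicator {0<..} s * a s * (A s - c)) + d * (c + d / 2) * (indicator {0<..} s * a s)"
          proof (cases "0 < s \<and> s < t + 1")
            case True
            then show ?thesis using f by (simp add: algebra_simps power2_eq_square)
          next
            case False
            then show ?thesis using a(2)[of s] e by (auto split: split_indicator)
          qed
        qed
      qed measurable
      also have "\<dots> = d * (c + d / 2) * (LINT s|lborel. indicator {0<..} s * a s)"
        using int_a_mean positive_part_integral_by_parts(2)[OF a_t] by simp
      finally show ?thesis using int_a by simp
    qed
    have I1: "\<bar>(LINT s|lborel. a' s * m s) + d * X t * \<beta>\<bar> \<le> C0 * e * \<beta>"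
    proof -
      \<comment> \<open>The expected value of \<open>m\<close> is removed under each tent. Under the
        one at time -1 it is exact; under the one at \<open>t\<close> it is off by at most
        \<open>C0 * e\<close>. The terms with \<open>R0\<close> cancel in the integral.\<close>
      let ?G = "\<lambda>s. a' s * m s + d * R0 * b (s + (t + 1)) - d * (R0 - X t) * b s"
      have ib': "integrable lborel (\<lambda>s. b (s + (t + 1)))"
        by (rule integrable_bounded_support[where C = e and S = "{-1-e..e-1}"])
           (use b(2,3) e in \<open>auto simp: b_def\<close>)
      have ia: "integrable lborel (\<lambda>s. a' s * m s)"
        unfolding m_def by (rule weak_form_difference(1)[OF U Ul a_t chi_t])
      have iG: "integrable lborel ?G" using ia ib' b(4) by auto
      have "(LINT s|lborel. ?G s) = (LINT s|lborel. a' s * m s) + d * R0 * (LINT s|lborel. b (s + (t + 1))) - d * (R0 - X t) * \<beta>"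
        using ia ib' b(4) by (simp add: \<beta>_def)
      also have "(LINT s|lborel. b (s + (t + 1))) = \<beta>"
        unfolding \<beta>_def by (rule lborel_integral_translate[OF bm])
      finally have G: "(LINT s|lborel. ?G s) = (LINT s|lborel. a' s * m s) + d * X t * \<beta>"
        by (simp add: algebra_simps)
      have "\<bar>LINT s|lborel. ?G s\<bar> \<le> (LINT s|lborel. \<bar>?G s\<bar>)"
        using integral_norm_bound[of lborel ?G] by simp
      also have "\<dots> \<le> (LINT s|lborel. C0 * e * b s)"
      proof (rule integral_mono_AE)
        show "AE s in lborel. \<bar>?G s\<bar> \<le> C0 * e * b s"
          using m_init m_near
        proof eventually_elim
          case (elim s)
          have e1: "d * R0 * b (s + (t + 1)) = - m s * b (s + (t + 1))"
          proof (cases "s \<le> 0")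
            case True then show ?thesis using elim by simp
          next
            case False then show ?thesis using b_shift[of s] by simp
          qed
          have G: "?G s = - b s * (m s + d * (R0 - X t))"
            unfolding e1 a'_def by (simp add: algebra_simps)
          show "\<bar>?G s\<bar> \<le> C0 * e * b s"
          proof (cases "s \<in> {t - e<..<t + e}")
            case True
            then have se: "\<bar>s - t\<bar> < e" by auto
            have "\<bar>d\<bar> * \<bar>s - t\<bar> \<le> \<bar>d\<bar> * e" using se by (intro mult_left_mono) auto
            then have "\<bar>m s + d * (R0 - X t)\<bar> \<le> C0 * \<bar>s - t\<bar>" using elim se e True by auto
            also have "\<dots> \<le> C0 * e" using se C0 K L(4) by (intro mult_left_mono) (auto simp: C0_def)
            finally show ?thesis unfolding G abs_mult using b(2)[of s] by (simp add: mult_mono mult.commute)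
          next
            case False
            then show ?thesis unfolding G using b(3)[of s] by simp
          qed
        qed
      qed (use iG b(4) in auto)
      finally show ?thesis unfolding G by (simp add: \<beta>_def)
    qed
    have "(LINT s|lborel. a' s * m s) + d * (c + d / 2) * (LINT s|lborel. s * b s) = 0"
      using weak_form_difference(2)[OF U Ul a_t chi_t] unfolding I2 m_def .
    then have "d * X t * \<beta> - d * (c + d / 2) * t * \<beta>
        = ((LINT s|lborel. a' s * m s) + d * X t * \<beta>) + d * (c + d / 2) * ((LINT s|lborel. s * b s) - t * \<beta>)"
      by (simp add: algebra_simps)
    also have "\<bar>\<dots>\<bar> \<le> \<bar>(LINT s|lborel. a' s * m s) + d * X t * \<beta>\<bar>
        + \<bar>d * (c + d / 2) * ((LINT s|lborel. s * b s) - t * \<beta>)\<bar>"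
      by (rule abs_triangle_ineq)
    also have "\<dots> \<le> C0 * e * \<beta> + \<bar>d * (c + d / 2)\<bar> * (e * \<beta>)"
    proof (rule add_mono[OF I1])
      show "\<bar>d * (c + d / 2) * ((LINT s|lborel. s * b s) - t * \<beta>)\<bar> \<le> \<bar>d * (c + d / 2)\<bar> * (e * \<beta>)"
        unfolding abs_mult[of "d * (c + d / 2)"] using b(7) by (intro mult_left_mono) (simp_all add: \<beta>_def)
    qed
    finally have "\<bar>d * X t * \<beta> - d * (c + d / 2) * t * \<beta>\<bar> \<le> C0 * e * \<beta> + \<bar>d * (c + d / 2)\<bar> * (e * \<beta>)" .
    moreover have "\<bar>d * X t * \<beta> - d * (c + d / 2) * t * \<beta>\<bar> = \<bar>d * X t - d * (c + d / 2) * t\<bar> * \<beta>"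
      using \<beta> abs_mult[of "d * X t - d * (c + d / 2) * t" \<beta>] by (simp only: left_diff_distrib abs_of_pos)
    ultimately have "\<bar>d * X t - d * (c + d / 2) * t\<bar> * \<beta> \<le> ((C0 + \<bar>d * (c + d / 2)\<bar>) * e) * \<beta>"
      by (simp only: distrib_right mult.assoc)
    then show ?thesis using \<beta> by simp
  qed
  have "d * X t - d * (c + d / 2) * t = 0"
  proof (rule ccontr)
    define Y where "Y = \<bar>d * X t - d * (c + d / 2) * t\<bar>"
    define Q where "Q = C0 + \<bar>d * (c + d / 2)\<bar>"
    assume "d * X t - d * (c + d / 2) * t \<noteq> 0"
    then have Y: "0 < Y" by (simp add: Y_def)
    have Q: "0 \<le> Q" using C0 K L(4) by (auto simp: Q_def C0_def)
    \<comment> \<open>The first three bounds meet the smallness conditions of \<open>est\<close>;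
      the last makes \<open>Q * e\<close> less than \<open>Y\<close>.\<close>
    define e where "e = min (min (1/2) ((t - T0) / 2)) (min (1 / \<bar>d\<bar>) (Y / (2 * (Q + 1))))"
    have e: "0 < e" "e \<le> 1/2" "e \<le> (t - T0) / 2" "e \<le> 1 / \<bar>d\<bar>" "e \<le> Y / (2 * (Q + 1))"
    proof -
      show "0 < e" using t d Y Q by (simp add: e_def)
    qed (unfold e_def, linarith+)
    have "\<bar>d\<bar> * e \<le> 1" using e(4) d by (simp add: field_simps)
    then have "Y \<le> Q * e" using est[of e] e t unfolding Y_def Q_def by auto
    also have "\<dots> \<le> Q * (Y / (2 * (Q + 1)))" using e Q by (intro mult_left_mono)
    also have "\<dots> < Y" using Q Y by (simp add: field_simps add_nonneg_pos)
    finally show False by simp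
  qed
  then have "d * (X t - (c + d / 2) * t) = 0" by (simp add: algebra_simps)
  then show ?thesis using d by simp
qed

theorem theorem3:
  fixes ubl ubr p T_S :: real
    and w0 :: "real \<Rightarrow> real"
    and u ul ur :: "real \<Rightarrow> real \<Rightarrow> real"
    and X :: "real \<Rightarrow> real"
    and t :: real
  assumes lr: "ubl > ubr"
    and p: "p > 0"
    and w0_meas: "w0 \<in> borel_measurable lborel"
    and w0_bdd: "\<exists>M. AE x in lborel. \<bar>w0 x\<bar> \<le> M"
    and w0_per: "AE x in lborel. w0 (x + p) = w0 x"
    and w0_avg: "(LINT x : {0..p} | lborel. w0 x) = 0"
    and u_sol: "entropy_solution u (\<lambda>x. if x < 0 then ubl + w0 x else ubr + w0 x)"
    and ul_sol: "entropy_solution ul (\<lambda>x. ubl + w0 x)"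
    and ur_sol: "entropy_solution ur (\<lambda>x. ubr + w0 x)"
    and TS: "T_S > 0"
    and X_lip: "\<exists>L. L-lipschitz_on {T_S<..} X"
    and shock: "\<forall>t'>T_S. AE x in lborel.
                   u t' x = (if x < X t' then ul t' x else ur t' x)"
    and t: "t > T_S"
    and int: "(ubl - ubr) * t / p \<in> \<int>"
  shows "X t = ((ubl + ubr) / 2) * t"
proof -
  define d where "d = ubl - ubr"
  have d: "0 < d" using lr by (simp add: d_def)
  \<comment> \<open>Integrality in the form used: the displacement \<open>d * t\<close> is a whole
    number of periods.\<close>
  obtain n :: int where n: "d * t = of_int n * p"
    using int p by (auto simp: d_def Ints_def field_simps)
  have w0m[measurable]: "w0 \<in> borel_measurable borel" using w0_meas by simp
  obtain M where M: "AE x in lborel. \<bar>w0 x\<bar> \<le> M" using w0_bdd by blast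
  \<comment> \<open>Periodicity holds almost everywhere, so each further period translates the
    exceptional null set.\<close>
  have per_nat: "AE x in lborel. w0 (x + real k * p) = w0 x" for k
  proof (induction k)
    case (Suc k)
    show ?case using Suc AE_translate[OF w0_per, of "real k * p"]
      by eventually_elim (simp add: algebra_simps)
  qed simp
  have per_int: "AE x in lborel. w0 (x + d * t) = w0 x"
  proof (cases "0 \<le> n")
    case True
    then show ?thesis using per_nat[of "nat n"] n by simp
  next
    case False
    then have "AE x in lborel. w0 (x - d * t) = w0 x" using per_nat[of "nat (- n)"] n by simp
    from AE_translate[OF this, of "d * t"] show ?thesis by (auto elim!: eventually_mono)
  qed
  have bl: "AE x in lborel. \<bar>ubl + w0 x\<bar> \<le> \<bar>ubl\<bar> + \<bar>ubr\<bar> + M"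
    and br: "AE x in lborel. \<bar>ubr + w0 x\<bar> \<le> \<bar>ubl\<bar> + \<bar>ubr\<bar> + M"
    and bu: "AE x in lborel. \<bar>if x < 0 then ubl + w0 x else ubr + w0 x\<bar> \<le> \<bar>ubl\<bar> + \<bar>ubr\<bar> + M"
    using M by (auto elim!: eventually_mono)
  have ml: "(\<lambda>x. ubl + w0 x) \<in> borel_measurable borel" and mr: "(\<lambda>x. ubr + w0 x) \<in> borel_measurable borel"
    and mu: "(\<lambda>x. if x < 0 then ubl + w0 x else ubr + w0 x) \<in> borel_measurable borel"
    by measurable
  \<comment> \<open>The boost of \<open>ur\<close> with speed \<open>- d\<close> and shift
    \<open>d * t\<close> has data ubr + w0(x + d t) + d, almost everywhere the data of
    \<open>ul\<close>. The shift is tuned so that the displacement vanishes at time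
    \<open>t\<close>.\<close>
  have gal: "AE z in lborel. 0 < fst z \<longrightarrow> ul (fst z) (snd z) = ur (fst z) (snd z + (- d * fst z + d * t)) - - d"
    by (rule entropy_solution_unique[OF ul_sol entropy_solution_galilei[OF ur_sol mr] ml _ bl])
       (measurable, use per_int in \<open>auto simp: d_def elim!: eventually_mono\<close>)
  \<comment> \<open>The same argument with speed 0 and shift \<open>p\<close>: periodicity of the
    data passes to the solution.\<close>
  have per: "AE z in lborel. 0 < fst z \<longrightarrow> ur (fst z) (snd z) = ur (fst z) (snd z + (0 * fst z + p)) - 0"
    by (rule entropy_solution_unique[OF ur_sol entropy_solution_galilei[OF ur_sol mr] mr _ br])
       (measurable, use w0_per in \<open>auto elim!: eventually_mono\<close>)
  obtain U where U: "entropy_ext U" "AE z in lborel. 0 < fst z \<longrightarrow> U z = u (fst z) (snd z)"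
      "AE z in lborel. fst z \<le> 0 \<longrightarrow> U z = (if snd z < 0 then ubl + w0 (snd z) else ubr + w0 (snd z))"
    by (rule entropy_solution_extend[OF u_sol mu bu])
  obtain Ul where Ul: "entropy_ext Ul" "AE z in lborel. 0 < fst z \<longrightarrow> Ul z = ul (fst z) (snd z)"
      "AE z in lborel. fst z \<le> 0 \<longrightarrow> Ul z = ubl + w0 (snd z)"
    by (rule entropy_solution_extend[OF ul_sol ml bl])
  obtain Ur where Ur: "entropy_ext Ur" "AE z in lborel. 0 < fst z \<longrightarrow> Ur z = ur (fst z) (snd z)"
      "AE z in lborel. fst z \<le> 0 \<longrightarrow> Ur z = ubr + w0 (snd z)"
    by (rule entropy_solution_extend[OF ur_sol mr br])
  have Ur_shift: "AE z in lborel. (0 < fst z \<longrightarrow> Ur (fst z, snd z + g (fst z)) = ur (fst z) (snd z + g (fst z)))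
      \<and> (fst z \<le> 0 \<longrightarrow> Ur (fst z, snd z + g (fst z)) = ubr + w0 (snd z + g (fst z)))"
    if "g \<in> borel_measurable borel" for g
    using AE_shear[OF that Ur(2)] AE_shear[OF that Ur(3)] by eventually_elim simp
  obtain K where K: "K-lipschitz_on {T_S<..} X" using X_lip by blast
  have "X t = (ubr + d / 2) * t"
  proof (rule shock_position_extended[OF U(1) Ul(1) Ur(1) p _ TS t])
    show "AE z in lborel. Ur (fst z, snd z + p) = Ur z"
      using Ur_shift[OF borel_measurable_const[of p]] Ur(2,3) per AE_snd[OF w0_per]
    proof eventually_elim
      case (elim z)
      then show ?case by (cases "0 < fst z") auto
    qed
    show "AE s in lborel. s \<le> 0 \<longrightarrow> (LINT x|lborel. indicator {0..p} x * Ur (s, x)) = p * ubr"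
      using AE_lborel_slices[OF Ur(3)]
    proof (rule eventually_mono, intro impI)
      fix s :: real assume s: "AE x in lborel. fst (s, x) \<le> 0 \<longrightarrow> Ur (s, x) = ubr + w0 (snd (s, x))" "s \<le> 0"
      have Urm[measurable]: "Ur \<in> borel_measurable borel" using Ur(1) by (simp add: entropy_ext_def)
      have i1: "integrable lborel (\<lambda>x. ubr * indicator {0..p} x)"
        by (intro integrable_mult_right integrable_real_indicator emeasure_bounded_finite) auto
      have i2: "integrable lborel (\<lambda>x. indicator {0..p} x * w0 x)"
      proof (rule Bochner_Integration.integrable_bound[where f = "\<lambda>x. M * indicator {0..p} x"])
        show "integrable lborel (\<lambda>x. M * indicator {0..p} x)"
          by (intro integrable_mult_right integrable_real_indicator emeasure_bounded_finite) auto
        show "AE x in lborel. norm (indicator {0..p} x * w0 x) \<le> norm (M * indicator {0..p} x)"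
          using M by (rule eventually_mono) (auto split: split_indicator)
      qed measurable
      have "(LINT x|lborel. indicator {0..p} x * Ur (s, x)) = (LINT x|lborel. ubr * indicator {0..p} x + indicator {0..p} x * w0 x)"
      proof (rule integral_cong_AE)
        show "AE x in lborel. indicator {0..p} x * Ur (s, x) = ubr * indicator {0..p} x + indicator {0..p} x * w0 x"
          using s(1) by (rule eventually_mono) (use s(2) in \<open>auto split: split_indicator\<close>)
      qed measurable
      also have "\<dots> = (LINT x|lborel. ubr * indicator {0..p} x) + (LINT x|lborel. indicator {0..p} x * w0 x)"
        by (rule Bochner_Integration.integral_add[OF i1 i2])
      \<comment> \<open>The zero average of \<open>w0\<close> enters here and fixes the constant in
        the shock speed.\<close>
      also have "\<dots> = p * ubr"
        using w0_avg p by (simp add: set_lebesgue_integral_def)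
      finally show "(LINT x|lborel. indicator {0..p} x * Ur (s, x)) = p * ubr" .
    qed
    show "AE z in lborel. 0 < fst z \<longrightarrow> Ul z = Ur (fst z, snd z - d * (fst z - t)) + d"
    proof -
      have "(\<lambda>s. - d * s + d * t) \<in> borel_measurable borel" by measurable
      from Ur_shift[OF this] Ul(2) gal show ?thesis
        by eventually_elim (auto simp: algebra_simps)
    qed
    show "AE z in lborel. fst z \<le> 0 \<longrightarrow> Ul z = Ur z + d \<and> U z = (if snd z < 0 then Ul z else Ur z)"
      using U(3) Ul(3) Ur(3) by eventually_elim (auto simp: d_def)
    have um: "(\<lambda>z. v (fst z) (snd z)) \<in> borel_measurable borel" if "entropy_solution v v0" for v v0
      using that by (simp add: entropy_solution_alt)
    have [measurable]: "(\<lambda>z. u (fst z) (snd z)) \<in> borel_measurable borel" "(\<lambda>z. ul (fst z) (snd z)) \<in> borel_measurable borel"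
      "(\<lambda>z. ur (fst z) (snd z)) \<in> borel_measurable borel"
      by (rule um[OF u_sol], rule um[OF ul_sol], rule um[OF ur_sol])
    \<comment> \<open>\<open>X\<close> is known to be continuous after \<open>T_S\<close>; the value
      0 elsewhere yields a Borel function on the whole line.\<close>
    define X' where "X' s = (if s \<in> {T_S<..} then X s else 0)" for s
    have X'm[measurable]: "X' \<in> borel_measurable borel"
      unfolding X'_def
      by (rule borel_measurable_continuous_on_if) (use lipschitz_on_continuous_on[OF K] in auto)
    \<comment> \<open>The shock structure is given time by time; measurability of the set lets
      Fubini merge the exceptional sets of all times into one null set of the plane.\<close>
    have "AE z in (lborel \<Otimes>\<^sub>M lborel :: (real \<times> real) measure). T_S < fst z \<longrightarrow>
        u (fst z) (snd z) = (if snd z < X' (fst z) then ul (fst z) (snd z) else ur (fst z) (snd z))"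
    proof (rule lborel_pair.AE_pair_measure)
      have "{z::real \<times> real. T_S < fst z \<longrightarrow>
        u (fst z) (snd z) = (if snd z < X' (fst z) then ul (fst z) (snd z) else ur (fst z) (snd z))} \<in> sets borel"
        by measurable
      then show "{z \<in> space (lborel \<Otimes>\<^sub>M lborel :: (real \<times> real) measure). T_S < fst z \<longrightarrow>
        u (fst z) (snd z) = (if snd z < X' (fst z) then ul (fst z) (snd z) else ur (fst z) (snd z))} \<in> sets (lborel \<Otimes>\<^sub>M lborel)"
        by (simp only: lborel_prod sets_lborel space_lborel) simp
      show "AE s in lborel. AE x in lborel. T_S < fst (s, x) \<longrightarrow> u (fst (s, x)) (snd (s, x))
          = (if snd (s, x) < X' (fst (s, x)) then ul (fst (s, x)) (snd (s, x)) else ur (fst (s, x)) (snd (s, x)))"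
      proof (rule AE_I2)
        fix s
        show "AE x in lborel. T_S < fst (s, x) \<longrightarrow> u (fst (s, x)) (snd (s, x))
          = (if snd (s, x) < X' (fst (s, x)) then ul (fst (s, x)) (snd (s, x)) else ur (fst (s, x)) (snd (s, x)))"
          using shock by (cases "T_S < s") (auto simp: X'_def)
      qed
    qed
    then have "AE z in lborel. T_S < fst z \<longrightarrow>
        u (fst z) (snd z) = (if snd z < X' (fst z) then ul (fst z) (snd z) else ur (fst z) (snd z))"
      by (simp only: lborel_prod)
    with U(2) Ul(2) Ur(2)
    show "AE z in lborel. T_S < fst z \<longrightarrow> U z = (if snd z < X (fst z) then Ul z else Ur z)"
      by eventually_elim (use TS in \<open>auto simp: X'_def\<close>)
    show "\<bar>X s - X t\<bar> \<le> K * \<bar>s - t\<bar>" if "T_S < s" for s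
      using lipschitz_onD[OF K, of s t] that t by (simp add: dist_real_def)
    show "0 \<le> K" using lipschitz_on_nonneg[OF K] .
  qed (use d in simp)
  then show ?thesis by (simp add: d_def field_simps)
qed

end
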